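(* Assume $p\ge n^\kappa$ for some universal constant $\kappa>0$. (i) If there exists a universal constant $K_3>0$ such that $\min_{j\in[p]}\mathrm{Var}(n^{-1/2}\sum_{t=1}^nX_{t,j})\ge K_3$, then $$\hat\rho_n(\mathcal A^{\rm re})\lesssim\rho_n(\mathcal A^{\rm re})+\Delta_{n,r}^{1/3}(\log p)^{2/3}.$$ (ii) Let $\mathcal A$ be a subclass of $\mathcal A^{\rm si}(a,d)$ such that there is a universal constant $K_4>0$ with $\mathrm{Var}(n^{-1/2}\sum_{t=1}^nv^\top X_t)\ge K_4$ for every $A\in\mathcal A$ and any $v\in\mathcal V\{A^K(A)\}$. Then $$\hat\rho_n(\mathcal A)\lesssim\rho_n(\mathcal A)+an^{-1}(d\log p)^{1/2}+\Delta_n^{1/3}(\mathcal A)(d\log p)^{2/3}.$$ (iii) Let $s$ be a positive integer. If there exist a sequence of constants $B_n\ge1$ and a universal constant $\gamma_1\ge1$ such that $\|X_{t,j}\|_{\psi_{\gamma_1}}\le B_n$ for all $t\in[n]$, $j\in[p]$, and a universal constant $K_5>0$ such that $\mathrm{Var}(n^{-1/2}\sum_{t=1}^nv^\top X_t)\ge K_5$ for any $v\in\mathbb S^{p-1}$ with $|v|_0\le s$, then $$\hat\rho_n\{\mathcal A^{\rm sp}(s)\}\lesssim\rho_n\{\mathcal A^{\rm sp}(s)\}+s^2\Delta_{n,r}^{1/3}(\log p)^{2/3}+\{B_n+s(\log p)^{1/2}\}n^{-1}.$$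
   Context: Asymptotic setting: for each $n$, $\mathcal X_n=\{X_1,\dots,X_n\}$ is a sequence of (possibly dependent and non-stationary) random vectors $X_t=(X_{t,1},\dots,X_{t,p})^\top\in\mathbb R^p$ with $\mathbb E(X_t)=0$; $p$, $s$ and the distribution of the sequence may depend on $n$. A "universal constant" is a constant not depending on $n$ or on any quantity allowed to vary with $n$. $a_n\lesssim b_n$ means $\limsup_{n\to\infty}a_n/b_n\le c$ for some universal constant $c>0$ (here the quantities may be random, being functions of $\mathcal X_n$). $[m]=\{1,\dots,m\}$; $\mathbb S^{p-1}$ is the unit sphere; $|v|_0$ is the number of nonzero entries of $v$; $|B|_\infty$ is the maximum absolute entry of a matrix $B$. $S_{n,x}=n^{-1/2}\sum_{t=1}^nX_t$, $\Xi=\mathrm{Cov}(S_{n,x})$, $G\sim N(0,\Xi)$. $\hat\Xi_n$ is a covariance (positive semidefinite) matrix constructed from $\mathcal X_n$ (an estimator of $\Xi$), and $\hat G$ is a random vector with $\hat G\sim N(0,\hat\Xi_n)$ conditionally on $\mathcal X_n$. For a class $\mathcal A$ of (Borel) subsets of $\mathbb R^p$, $\rho_n(\mathcal A)=\sup_{A\in\mathcal A}|\mathbb P(S_{n,x}\in A)-\mathbb P(G\in A)|$ and $\hat\rho_n(\mathcal A)=\sup_{A\in\mathcal A}|\mathbb P(S_{n,x}\in A)-\mathbb P(\hat G\in A\mid\mathcal X_n)|$. Put $\Delta_{n,r}=|\hat\Xi_n-\Xi|_\infty$, and for $\mathcal A\subset\mathcal A^{\rm si}(a,d)$, $\Delta_n(\mathcal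 A)=\sup_{A\in\mathcal A}\sup_{v_1,v_2\in\mathcal V\{A^K(A)\}}|v_1^\top(\hat\Xi_n-\Xi)v_2|$. For $\gamma>0$, $\|\xi\|_{\psi_\gamma}=\inf\{\lambda>0:\mathbb E[\exp\{(|\xi|/\lambda)^{\gamma}\}-1]\le 1\}$. Hyper-rectangles: $\mathcal A^{\rm re}$ consists of all $A=\{w\in\mathbb R^p:a_j\le w_j\le b_j\ \forall j\in[p]\}$ with $-\infty\le a_j\le b_j\le\infty$. Simple convex sets: for a closed convex $A\subset\mathbb R^p$, $\mathcal S_A(v)=\sup\{w^\top v:w\in A\}$, $v\in\mathbb S^{p-1}$. A set $A^K$ is $K$-generated if it is the intersection of $K$ half-spaces; $\mathcal V(A^K)$ is the set of the $K$ unit normal vectors outward to its facets, so $A^K=\bigcap_{v\in\mathcal V(A^K)}\{w:w^\top v\le\mathcal S_{A^K}(v)\}$. For $\epsilon>0$ (and likewise $\epsilon=0$), $A^{K,\epsilon}=\bigcap_{v\in\mathcal V(A^K)}\{w:w^\top v\le\mathcal S_{A^K}(v)+\epsilon\}$. For constants $a\ge0$, $d>0$, $\mathcal A^{\rm si}(a,d)$ is the class of all sets $A\subset\mathbb R^p$ for which there is a $K$-generated $A^K$ with $K\le(pn)^d$ and $A^K\subset A\subset A^{K,\epsilon}$, $\epsilon=a/n$. For each such $A$, $A^K(A)$ denotes a fixed such approximating set. Sparsely convex sets: $A\subset\mathbb R^p$ is $s$-sparsely convex if $A=\cap_{q=1}^{K_*}A_q$ for some positive integer $K_*$ and convex sets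 $A_q\subset\mathbb R^p$ such that each indicator $w\mapsto I(w\in A_q)$ depends on at most $s$ components of $w$. $\mathcal A^{\rm sp}(s)$ is the class of all $s$-sparsely convex sets in $\mathbb R^p$. *)

theory Defs
  imports "HOL-Probability.Probability"
begin

text \<open>
  The dimension changes along the asymptotics, so vectors in \<open>\<real>\<^sup>p\<close> are functions on
  \<open>{1..p}\<close>, extended by \<open>undefined\<close>, and \<open>\<real>\<^sup>p\<close> with its Borel sets is a
  product measure space. Matrices are functions \<open>nat \<Rightarrow> nat \<Rightarrow> real\<close>, of which only the
  entries with both indices in \<open>{1..p}\<close> matter.
\<close>

type_synonym rvec = "nat \<Rightarrow> real"
type_synonym rmat = "nat \<Rightarrow> nat \<Rightarrow> real"

definition borel_vec :: "nat \<Rightarrow> rvec measure" where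
  "borel_vec p = (\<Pi>\<^sub>M j\<in>{1..p}. borel)"

abbreviation vecs :: "nat \<Rightarrow> rvec set" where
  "vecs p \<equiv> space (borel_vec p)"

definition dot :: "nat \<Rightarrow> rvec \<Rightarrow> rvec \<Rightarrow> real" where
  "dot p v w = (\<Sum>j\<in>{1..p}. v j * w j)"

definition unit_sphere :: "nat \<Rightarrow> rvec set" where
  "unit_sphere p = {v \<in> vecs p. dot p v v = 1}"

definition nnz :: "nat \<Rightarrow> rvec \<Rightarrow> nat" where
  "nnz p v = card {j \<in> {1..p}. v j \<noteq> 0}"

definition bilin :: "nat \<Rightarrow> rmat \<Rightarrow> rvec \<Rightarrow> rvec \<Rightarrow> real" where
  "bilin p \<Sigma> v w = (\<Sum>i\<in>{1..p}. \<Sum>j\<in>{1..p}. v i * \<Sigma> i j * w j)"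

definition mat_diff :: "rmat \<Rightarrow> rmat \<Rightarrow> rmat" where
  "mat_diff \<Sigma> \<Sigma>' = (\<lambda>i j. \<Sigma> i j - \<Sigma>' i j)"

definition max_entry :: "nat \<Rightarrow> rmat \<Rightarrow> real" where
  "max_entry p \<Sigma> = (MAX (i, j)\<in>{1..p} \<times> {1..p}. \<bar>\<Sigma> i j\<bar>)"

definition psd :: "nat \<Rightarrow> rmat \<Rightarrow> bool" where
  "psd p \<Sigma> \<longleftrightarrow>
     (\<forall>i\<in>{1..p}. \<forall>j\<in>{1..p}. \<Sigma> i j = \<Sigma> j i) \<and> (\<forall>u\<in>vecs p. 0 \<le> bilin p \<Sigma> u u)"

text \<open>
  A supremum of nonnegative reals, equal to \<open>0\<close> over the empty set, where the library's
  real \<open>Sup\<close> is unspecified.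
\<close>

definition sup_nonneg :: "real set \<Rightarrow> real" where
  "sup_nonneg S = Sup (insert 0 S)"

definition hyper_rectangles :: "nat \<Rightarrow> rvec set set" where
  "hyper_rectangles p =
     {A. \<exists>a b :: nat \<Rightarrow> ereal. (\<forall>j\<in>{1..p}. a j \<le> b j) \<and>
           A = {w \<in> vecs p. \<forall>j\<in>{1..p}. a j \<le> ereal (w j) \<and> ereal (w j) \<le> b j}}"

text \<open>Extended-real valued: the support function of the empty set is \<open>-\<infinity>\<close>.\<close>

definition support_fun :: "nat \<Rightarrow> rvec set \<Rightarrow> rvec \<Rightarrow> ereal" where
  "support_fun p A v = (SUP w\<in>A. ereal (dot p w v))"

text \<open>
  \<open>generated_by p V P\<close>: the set \<open>P\<close> is an intersection of \<open>card V\<close> half-spaces and \<open>V\<close> is the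
  set of their outward unit normals. The set \<open>V\<close> is carried along as data because neither it nor
  its cardinality is determined by \<open>P\<close> when \<open>P\<close> has redundant constraints or empty interior.
\<close>

definition generated_by :: "nat \<Rightarrow> rvec set \<Rightarrow> rvec set \<Rightarrow> bool" where
  "generated_by p V P \<longleftrightarrow> finite V \<and> V \<subseteq> unit_sphere p \<and>
     (\<exists>b :: rvec \<Rightarrow> real. P = {w \<in> vecs p. \<forall>v\<in>V. dot p w v \<le> b v})"

definition relaxed :: "nat \<Rightarrow> rvec set \<Rightarrow> rvec set \<Rightarrow> real \<Rightarrow> rvec set" where
  "relaxed p V P \<epsilon> =
     {w \<in> vecs p. \<forall>v\<in>V. ereal (dot p w v) \<le> support_fun p P v + ereal \<epsilon>}"

lemma relaxed_0:
  assumes "generated_by p V P"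
  shows "relaxed p V P 0 = P"
proof -
  from assms obtain b where P: "P = {w \<in> vecs p. \<forall>v\<in>V. dot p w v \<le> b v}"
    by (auto simp: generated_by_def)
  have "support_fun p P v \<le> ereal (b v)" if "v \<in> V" for v
    using that unfolding support_fun_def P by (intro SUP_least) auto
  then have "relaxed p V P 0 \<subseteq> P"
    unfolding relaxed_def by (subst (2) P) (force dest: order_trans)
  moreover have "ereal (dot p w v) \<le> support_fun p P v" if "w \<in> P" for w v
    using that unfolding support_fun_def by (rule SUP_upper)
  then have "P \<subseteq> relaxed p V P 0"
    using P by (auto simp: relaxed_def)
  ultimately show ?thesis by blast
qed

definition simple_approx ::
  "nat \<Rightarrow> nat \<Rightarrow> real \<Rightarrow> real \<Rightarrow> rvec set \<Rightarrow> rvec set \<Rightarrow> rvec set \<Rightarrow> bool" where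
  "simple_approx n p a d A V P \<longleftrightarrow>
     generated_by p V P \<and> real (card V) \<le> (real p * real n) powr d \<and>
     P \<subseteq> A \<and> A \<subseteq> relaxed p V P (a / real n)"

definition simple_convex_sets :: "nat \<Rightarrow> nat \<Rightarrow> real \<Rightarrow> real \<Rightarrow> rvec set set" where
  "simple_convex_sets n p a d = {A \<in> sets (borel_vec p). \<exists>V P. simple_approx n p a d A V P}"

definition convex_vecs :: "nat \<Rightarrow> rvec set \<Rightarrow> bool" where
  "convex_vecs p A \<longleftrightarrow> A \<subseteq> vecs p \<and>
     (\<forall>x\<in>A. \<forall>y\<in>A. \<forall>u\<in>{0..1}. (\<lambda>j\<in>{1..p}. (1 - u) * x j + u * y j) \<in> A)"

definition depends_on_at_most :: "nat \<Rightarrow> nat \<Rightarrow> rvec set \<Rightarrow> bool" where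
  "depends_on_at_most p s A \<longleftrightarrow>
     (\<exists>J\<subseteq>{1..p}. card J \<le> s \<and>
        (\<forall>x\<in>vecs p. \<forall>y\<in>vecs p. (\<forall>j\<in>J. x j = y j) \<longrightarrow> (x \<in> A \<longleftrightarrow> y \<in> A)))"

text \<open>
  Convex sets need not be Borel; as for all classes considered here, only Borel members are taken.
\<close>

definition sparsely_convex_sets :: "nat \<Rightarrow> nat \<Rightarrow> rvec set set" where
  "sparsely_convex_sets p s =
     {A \<in> sets (borel_vec p). \<exists>(k::nat) C. 1 \<le> k \<and>
        (\<forall>q\<in>{1..k}. convex_vecs p (C q) \<and> depends_on_at_most p s (C q)) \<and>
        A = (\<Inter>q\<in>{1..k}. C q)}"

text \<open>
  \<open>N(0, \<Sigma>)\<close>, possibly degenerate: the law of \<open>L Z\<close> where \<open>L L\<^sup>T = \<Sigma>\<close> and \<open>Z\<close> has i.i.d.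
  standard normal components.
\<close>

definition centered_gaussian :: "nat \<Rightarrow> rmat \<Rightarrow> rvec measure \<Rightarrow> bool" where
  "centered_gaussian p \<Sigma> \<mu> \<longleftrightarrow>
     (\<exists>(m::nat) L.
        (\<forall>i\<in>{1..p}. \<forall>j\<in>{1..p}. \<Sigma> i j = (\<Sum>k\<in>{1..m}. L i k * L j k)) \<and>
        \<mu> = distr (\<Pi>\<^sub>M k\<in>{1..m}. std_normal_distribution) (borel_vec p)
              (\<lambda>z. \<lambda>j\<in>{1..p}. \<Sum>k\<in>{1..m}. L j k * z k))"

text \<open>The infimum is taken in \<open>ennreal\<close>, so that it is \<open>\<infinity>\<close> over the empty set.\<close>

definition psi_norm :: "real \<Rightarrow> 'w measure \<Rightarrow> ('w \<Rightarrow> real) \<Rightarrow> ennreal" where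
  "psi_norm \<gamma> M \<xi> =
     Inf {ennreal l | l. 0 < l \<and>
            (\<integral>\<^sup>+ \<omega>. ennreal (exp ((\<bar>\<xi> \<omega>\<bar> / l) powr \<gamma>) - 1) \<partial>M) \<le> 1}"

definition nsum :: "nat \<Rightarrow> (nat \<Rightarrow> 'w \<Rightarrow> rvec) \<Rightarrow> nat \<Rightarrow> 'w \<Rightarrow> rvec" where
  "nsum n X p \<omega> = (\<lambda>j\<in>{1..p}. (\<Sum>t\<in>{1..n}. X t \<omega> j) / sqrt (real n))"

definition cov_mat :: "'w measure \<Rightarrow> ('w \<Rightarrow> rvec) \<Rightarrow> rmat" where
  "cov_mat M S = (\<lambda>i j.
     prob_space.expectation M (\<lambda>\<omega>.
       (S \<omega> i - prob_space.expectation M (\<lambda>\<omega>. S \<omega> i)) *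
       (S \<omega> j - prob_space.expectation M (\<lambda>\<omega>. S \<omega> j))))"

definition proj_var :: "nat \<Rightarrow> 'w measure \<Rightarrow> (nat \<Rightarrow> 'w \<Rightarrow> rvec) \<Rightarrow> nat \<Rightarrow> rvec \<Rightarrow> real" where
  "proj_var n M X p v =
     prob_space.variance M (\<lambda>\<omega>. (\<Sum>t\<in>{1..n}. dot p v (X t \<omega>)) / sqrt (real n))"

definition sample :: "nat \<Rightarrow> (nat \<Rightarrow> 'w \<Rightarrow> rvec) \<Rightarrow> 'w \<Rightarrow> (nat \<Rightarrow> rvec)" where
  "sample n X \<omega> = (\<lambda>t\<in>{1..n}. X t \<omega>)"

definition class_dist :: "rvec set set \<Rightarrow> rvec measure \<Rightarrow> rvec measure \<Rightarrow> real" where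
  "class_dist \<A> \<mu> \<nu> = sup_nonneg ((\<lambda>A. \<bar>measure \<mu> A - measure \<nu> A\<bar>) ` \<A>)"

definition cov_err :: "nat \<Rightarrow> rmat \<Rightarrow> rvec set set \<Rightarrow> (rvec set \<Rightarrow> rvec set) \<Rightarrow> real" where
  "cov_err p D \<A> V =
     sup_nonneg {\<bar>bilin p D v1 v2\<bar> | A v1 v2. A \<in> \<A> \<and> v1 \<in> V A \<and> v2 \<in> V A}"

text \<open>
  \<open>a \<lesssim> b\<close> with constant \<open>c\<close>. The quotient is taken in \<open>ereal\<close>, where \<open>x / 0 = \<infinity>\<close> for
  \<open>x > 0\<close> and \<open>0 / 0 = 0\<close>.
\<close>

definition asymp_le :: "real \<Rightarrow> (nat \<Rightarrow> real) \<Rightarrow> (nat \<Rightarrow> real) \<Rightarrow> bool" where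
  "asymp_le c a b \<longleftrightarrow> limsup (\<lambda>n. ereal (a n) / ereal (b n)) \<le> ereal c"

text \<open>
  Row \<open>n\<close> of the array lives on \<open>M n\<close>: \<open>X n 1, \<dots>, X n n\<close> are random vectors in dimension \<open>p n\<close>.
  \<open>Xihat n\<close> is the covariance estimator as a function of the sample, \<open>G n\<close> is the law
  \<open>N(0, \<Xi>)\<close>, and \<open>Ghat n x\<close> is the (regular) conditional law \<open>N(0, Xihat n x)\<close> of the Gaussian
  vector attached to the estimator, given that the sample equals \<open>x\<close>. Second moments are only
  required of the normalized sum, which is what the existence of \<open>\<Xi>\<close> means.
\<close>

definition array_setting ::
  "real \<Rightarrow> (nat \<Rightarrow> 'w measure) \<Rightarrow> (nat \<Rightarrow> nat) \<Rightarrow> (nat \<Rightarrow> nat \<Rightarrow> 'w \<Rightarrow> rvec) \<Rightarrow>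
   (nat \<Rightarrow> (nat \<Rightarrow> rvec) \<Rightarrow> rmat) \<Rightarrow> (nat \<Rightarrow> rvec measure) \<Rightarrow>
   (nat \<Rightarrow> (nat \<Rightarrow> rvec) \<Rightarrow> rvec measure) \<Rightarrow> bool" where
  "array_setting \<kappa> M p X Xihat G Ghat \<longleftrightarrow>
     (\<forall>n\<ge>1.
        real n powr \<kappa> \<le> real (p n) \<and>
        prob_space (M n) \<and>
        (\<forall>t\<in>{1..n}. X n t \<in> M n \<rightarrow>\<^sub>M borel_vec (p n)) \<and>
        (\<forall>t\<in>{1..n}. \<forall>j\<in>{1..p n}. integrable (M n) (\<lambda>\<omega>. X n t \<omega> j) \<and>
           prob_space.expectation (M n) (\<lambda>\<omega>. X n t \<omega> j) = 0) \<and>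
        (\<forall>j\<in>{1..p n}. integrable (M n) (\<lambda>\<omega>. (nsum n (X n) (p n) \<omega> j)\<^sup>2)) \<and>
        centered_gaussian (p n) (cov_mat (M n) (nsum n (X n) (p n))) (G n) \<and>
        (\<forall>i\<in>{1..p n}. \<forall>j\<in>{1..p n}.
           (\<lambda>x. Xihat n x i j) \<in> borel_measurable (\<Pi>\<^sub>M t\<in>{1..n}. borel_vec (p n))) \<and>
        (\<forall>\<omega>\<in>space (M n).
           psd (p n) (Xihat n (sample n (X n) \<omega>)) \<and>
           centered_gaussian (p n) (Xihat n (sample n (X n) \<omega>)) (Ghat n (sample n (X n) \<omega>))))"

text \<open>
  In what follows \<open>\<A>\<close> is a class of Borel sets in dimension \<open>p\<close>, and \<open>\<omega>\<close> is a realization in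
  row \<open>n\<close>.
\<close>

definition rho :: "nat \<Rightarrow> 'w measure \<Rightarrow> nat \<Rightarrow> (nat \<Rightarrow> 'w \<Rightarrow> rvec) \<Rightarrow>
    rvec measure \<Rightarrow> rvec set set \<Rightarrow> real" where
  "rho n M p X G \<A> = class_dist \<A> (distr M (borel_vec p) (nsum n X p)) G"

definition rho_hat :: "nat \<Rightarrow> 'w measure \<Rightarrow> nat \<Rightarrow> (nat \<Rightarrow> 'w \<Rightarrow> rvec) \<Rightarrow>
    ((nat \<Rightarrow> rvec) \<Rightarrow> rvec measure) \<Rightarrow> rvec set set \<Rightarrow> 'w \<Rightarrow> real" where
  "rho_hat n M p X Ghat \<A> \<omega> =
     class_dist \<A> (distr M (borel_vec p) (nsum n X p)) (Ghat (sample n X \<omega>))"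

definition Xi_err :: "nat \<Rightarrow> 'w measure \<Rightarrow> nat \<Rightarrow> (nat \<Rightarrow> 'w \<Rightarrow> rvec) \<Rightarrow>
    ((nat \<Rightarrow> rvec) \<Rightarrow> rmat) \<Rightarrow> 'w \<Rightarrow> rmat" where
  "Xi_err n M p X Xihat \<omega> = mat_diff (Xihat (sample n X \<omega>)) (cov_mat M (nsum n X p))"

definition Delta_r :: "nat \<Rightarrow> 'w measure \<Rightarrow> nat \<Rightarrow> (nat \<Rightarrow> 'w \<Rightarrow> rvec) \<Rightarrow>
    ((nat \<Rightarrow> rvec) \<Rightarrow> rmat) \<Rightarrow> 'w \<Rightarrow> real" where
  "Delta_r n M p X Xihat \<omega> = max_entry p (Xi_err n M p X Xihat \<omega>)"

definition Delta_class :: "nat \<Rightarrow> 'w measure \<Rightarrow> nat \<Rightarrow> (nat \<Rightarrow> 'w \<Rightarrow> rvec) \<Rightarrow>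
    ((nat \<Rightarrow> rvec) \<Rightarrow> rmat) \<Rightarrow> rvec set set \<Rightarrow> (rvec set \<Rightarrow> rvec set) \<Rightarrow> 'w \<Rightarrow> real" where
  "Delta_class n M p X Xihat \<A> V \<omega> = cov_err p (Xi_err n M p X Xihat \<omega>) \<A> V"

end

theory Submission
  imports Defs
begin

text \<open>
  All three parts follow from one comparison of centred Gaussian vectors on polytopes
  \<open>{w. \<forall>i. w \<bullet> v i \<le> b i}\<close> with \<open>exp L\<close> constraints, when the covariances of the linear forms
  differ by at most \<open>D\<close> and one side has variances bounded below. Smoothing the maximum at scale
  \<open>\<delta>\<close> by a soft maximum and interpolating between the two vectors costs \<open>D * L / \<delta>\<^sup>2\<close>; removing
  the smoothing costs \<open>\<delta> * sqrt L\<close> by Nazarov's inequality; \<open>\<delta> = (D * sqrt L) powr (1/3)\<close> balances them.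

  Nazarov's inequality is proved by Stein's identity: if \<open>Q i\<close> are soft-argmax weights of unit-variance
  Gaussians \<open>W i\<close> with thresholds \<open>c i\<close>, then \<open>Q i\<close> increases in the direction of \<open>W i\<close>, so
  \<open>E (Q i * H' (W i - c i)) \<le> E (W i * Q i * H (W i - c i))\<close> for \<open>H \<ge> 0\<close>; with \<open>H\<close> of size
  \<open>\<epsilon>\<close> and slope at least one on \<open>[-\<epsilon>, \<epsilon>]\<close>, summing over \<open>i\<close> leaves \<open>\<epsilon> * E (max \<bar>W i\<bar>)\<close>.

  For sparsely convex sets no facial structure is needed: after truncation to a box of polynomial size,
  the polytope whose constraints are the support function on a grid of sparse directions, moved inwards by
  \<open>1 / n\<close>, lies inside the set.
\<close>

section \<open>Stein's identity for Gaussian vectors\<close>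

text \<open>Variances are bounded below for \<open>G\<close> only, since the estimated covariance
  may be degenerate. Nazarov's inequality is therefore applied to the law of \<open>G\<close> alone,
  and the two one-sided comparisons move the thresholds of \<open>G\<close> after, respectively
  before, passing to the other law. The smoothing cost depends on the number of constraints only
  through \<open>L\<close>: softmax weights sum to one, so the double sum of second derivatives
  stays bounded, and the inverse temperature \<open>L / \<delta>\<close> makes the soft maximum
  exceed the maximum by at most \<delta>. For a fixed realization the estimator is a fixed matrix,
  so all estimates are deterministic and the triangle inequality passes from \<open>rho_hat\<close>
  to \<open>rho\<close>. Independence of the interpolated vectors is arranged by writing both as
  linear forms in disjoint blocks of one family of standard normals. In the sparse case
  \<open>B n\<close> matters only for the box: polynomial bounds suffice, because the grid enters
  through the logarithm of its size.\<close>

abbreviation std_gauss :: "'k set \<Rightarrow> ('k \<Rightarrow> real) measure" where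
  "std_gauss T \<equiv> (\<Pi>\<^sub>M k\<in>T. std_normal_distribution)"

lemma product_sigma_finite_std_normal: "product_sigma_finite (\<lambda>_. std_normal_distribution)"
  by (intro product_sigma_finite.intro prob_space_imp_sigma_finite prob_space_normal_density) simp

lemma prob_space_std_gauss: "prob_space (std_gauss T)"
  by (intro prob_space_PiM prob_space_normal_density) auto

text \<open>Integration by parts: the density satisfies \<open>\<phi>' x = - x * \<phi> x\<close>,
  so \<open>- f * \<phi>\<close> is an antiderivative of \<open>\<phi> * (x * f - f')\<close>, and
  it vanishes at both ends because \<open>f\<close> is bounded.\<close>

lemma stein_std_normal:
  fixes f f' :: "real \<Rightarrow> real"
  assumes f: "\<And>x. (f has_real_derivative f' x) (at x)"
    and f': "\<And>x. isCont f' x"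
    and bd: "\<And>x. \<bar>f x\<bar> \<le> C" "\<And>x. \<bar>f' x\<bar> \<le> C"
  shows "(\<integral>x. x * f x \<partial>std_normal_distribution) = (\<integral>x. f' x \<partial>std_normal_distribution)"
proof -
  let ?\<phi> = std_normal_density
  have cf: "isCont f x" for x
    using f DERIV_isCont by blast
  have [measurable]: "f \<in> borel_measurable borel" "f' \<in> borel_measurable borel"
    using cf f' by (auto intro!: borel_measurable_continuous_onI continuous_at_imp_continuous_on)
  have i1: "integrable lborel (\<lambda>x. ?\<phi> x * (x * f x))"
  proof (rule Bochner_Integration.integrable_bound)
    show "integrable lborel (\<lambda>x. C * (?\<phi> x * \<bar>x\<bar> ^ 1))"
      by (intro integrable_mult_right integrable_std_normal_moment_abs)
    show "AE x in lborel. norm (?\<phi> x * (x * f x)) \<le> norm (C * (?\<phi> x * \<bar>x\<bar> ^ 1))"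
    proof (intro AE_I2)
      fix x
      have "\<bar>f x\<bar> * (?\<phi> x * \<bar>x\<bar>) \<le> C * (?\<phi> x * \<bar>x\<bar>)"
        using bd(1) by (intro mult_right_mono) auto
      also have "\<dots> \<le> \<bar>C\<bar> * (?\<phi> x * \<bar>x\<bar>)"
        by (intro mult_right_mono) auto
      finally show "norm (?\<phi> x * (x * f x)) \<le> norm (C * (?\<phi> x * \<bar>x\<bar> ^ 1))"
        by (simp add: abs_mult mult_ac)
    qed
  qed measurable
  have i2: "integrable lborel (\<lambda>x. ?\<phi> x * f' x)"
  proof (rule Bochner_Integration.integrable_bound)
    show "integrable lborel (\<lambda>x. C * (?\<phi> x * \<bar>x\<bar> ^ 0))"
      by (intro integrable_mult_right integrable_std_normal_moment_abs)
    show "AE x in lborel. norm (?\<phi> x * f' x) \<le> norm (C * (?\<phi> x * \<bar>x\<bar> ^ 0))"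
    proof (intro AE_I2)
      fix x
      have "\<bar>f' x\<bar> * ?\<phi> x \<le> \<bar>C\<bar> * ?\<phi> x"
        using bd(2)[of x] by (intro mult_right_mono) auto
      then show "norm (?\<phi> x * f' x) \<le> norm (C * (?\<phi> x * \<bar>x\<bar> ^ 0))"
        by (simp add: abs_mult mult_ac)
    qed
  qed measurable
  have d\<phi>: "(?\<phi> has_real_derivative - x * ?\<phi> x) (at x)" for x
    unfolding std_normal_density_def
    by (auto intro!: derivative_eq_intros simp: field_simps)
  have lim: "((\<lambda>x. - (f x * ?\<phi> x)) \<longlongrightarrow> 0) F" if "(?\<phi> \<longlongrightarrow> 0) F" for F
  proof (rule Lim_null_comparison)
    show "\<forall>\<^sub>F x in F. norm (- (f x * ?\<phi> x)) \<le> C * ?\<phi> x"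
      using bd(1) by (intro always_eventually) (auto simp: abs_mult intro!: mult_right_mono)
    show "((\<lambda>x. C * ?\<phi> x) \<longlongrightarrow> 0) F"
      using tendsto_mult_right_zero[OF that] .
  qed
  have l1: "(?\<phi> \<longlongrightarrow> 0) at_top" "(?\<phi> \<longlongrightarrow> 0) at_bot"
    unfolding std_normal_density_def by real_asymp+
  have "(LBINT x=-\<infinity>..\<infinity>. ?\<phi> x * (x * f x) - ?\<phi> x * f' x) = 0 - 0"
  proof (rule interval_integral_FTC_integrable[where F="\<lambda>x. - (f x * ?\<phi> x)"])
    show "((\<lambda>x. - (f x * ?\<phi> x)) has_vector_derivative ?\<phi> x * (x * f x) - ?\<phi> x * f' x) (at x)" for x
      unfolding has_real_derivative_iff_has_vector_derivative[symmetric]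
      by (auto intro!: derivative_eq_intros f d\<phi> simp: field_simps)
    show "isCont (\<lambda>x. ?\<phi> x * (x * f x) - ?\<phi> x * f' x) x" for x
      by (intro continuous_intros cf f' DERIV_isCont[OF d\<phi>])
    show "set_integrable lborel (einterval (-\<infinity>) \<infinity>) (\<lambda>x. ?\<phi> x * (x * f x) - ?\<phi> x * f' x)"
      using i1 i2 by (simp add: set_integrable_def)
    show "(((\<lambda>x. - (f x * ?\<phi> x)) \<circ> real_of_ereal) \<longlongrightarrow> 0) (at_right (-\<infinity>))"
      "(((\<lambda>x. - (f x * ?\<phi> x)) \<circ> real_of_ereal) \<longlongrightarrow> 0) (at_left \<infinity>)"
      using lim[OF l1(1)] lim[OF l1(2)]
      by (auto simp: ereal_tendsto_simps)
  qed auto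
  then have "(\<integral>x. ?\<phi> x * (x * f x) - ?\<phi> x * f' x \<partial>lborel) = 0"
    by (simp add: interval_lebesgue_integral_def set_lebesgue_integral_def)
  then have "(\<integral>x. ?\<phi> x * (x * f x) \<partial>lborel) = (\<integral>x. ?\<phi> x * f' x \<partial>lborel)"
    using i1 i2 by simp
  then show ?thesis
    by (simp add: integral_density)
qed

text \<open>Completing the square turns the tilted density into a multiple of the normal density
  with mean \<open>t\<close>.\<close>

lemma integrable_exp_std_normal:
  "integrable std_normal_distribution (\<lambda>x. exp (t * x))" (is ?A)
  and integral_exp_std_normal:
  "(\<integral>x. exp (t * x) \<partial>std_normal_distribution) = exp (t\<^sup>2 / 2)" (is ?B)
proof -
  have eq: "std_normal_density x * exp (t * x) = exp (t\<^sup>2 / 2) * normal_density t 1 x" for x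
    unfolding normal_density_def
    by (simp add: exp_add[symmetric] power2_eq_square field_simps)
  have "integrable lborel (\<lambda>x. exp (t\<^sup>2 / 2) * normal_density t 1 x)"
    by (intro integrable_mult_right integrable_normal_density) auto
  then show ?A
    by (subst integrable_density) (auto simp: eq)
  show ?B
    by (subst integral_density) (auto simp: eq integral_normal_density)
qed

lemma finite_measure_std_gauss: "finite_measure (std_gauss T)"
  using prob_space_std_gauss prob_space.finite_measure by blast

lemma integrable_coord_std_gauss:
  assumes "finite T" "k \<in> T"
  shows "integrable (std_gauss T) (\<lambda>z. z k)"
proof -
  interpret product_sigma_finite "\<lambda>_. std_normal_distribution"
    by (rule product_sigma_finite_std_normal)
  have "integrable std_normal_distribution (\<lambda>x. if i = k then x else 1)" for i
    using integrable_std_normal_distribution_moment[of 1]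
    by (cases "i = k")
       (auto intro!: finite_measure.integrable_const prob_space.finite_measure prob_space_normal_density)
  \<comment> \<open>The coordinate is written as a product over all coordinates with the other
    factors equal to 1, the shape in which integrability passes to the product space.\<close>
  then have "integrable (std_gauss T) (\<lambda>z. \<Prod>i\<in>T. (if i = k then z i else 1))"
    by (intro product_integrable_prod[where f="\<lambda>i x. if i = k then x else 1"] assms)
  also have "(\<lambda>z. \<Prod>i\<in>T. (if i = k then z i else 1)) = (\<lambda>z. z k)"
    using assms by (simp add: prod.delta)
  finally show ?thesis .
qed

text \<open>By Fubini: with the other coordinates frozen this is the one-dimensional identity in
  coordinate \<open>k\<close>. Boundedness of \<open>F\<close> and \<open>F'\<close> supplies the
  joint integrability.\<close>

lemma stein_std_gauss:
  fixes F F' :: "('k \<Rightarrow> real) \<Rightarrow> real"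
  assumes T: "finite T" "k \<in> T"
    and [measurable]: "F \<in> borel_measurable (std_gauss T)" "F' \<in> borel_measurable (std_gauss T)"
    and deriv: "\<And>z x. ((\<lambda>x. F (z(k := x))) has_real_derivative F' (z(k := x))) (at x)"
    and cont: "\<And>z x. isCont (\<lambda>x. F' (z(k := x))) x"
    and bd: "\<And>z. \<bar>F z\<bar> \<le> C" "\<And>z. \<bar>F' z\<bar> \<le> C"
  shows "(\<integral>z. z k * F z \<partial>std_gauss T) = (\<integral>z. F' z \<partial>std_gauss T)"
proof -
  interpret product_sigma_finite "\<lambda>_. std_normal_distribution"
    by (rule product_sigma_finite_std_normal)
  interpret finite_measure "std_gauss T"
    by (rule finite_measure_std_gauss)
  have [measurable]: "(\<lambda>z. z k) \<in> borel_measurable (std_gauss T)"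
    using integrable_coord_std_gauss[OF T] by auto
  define S where "S = T - {k}"
  have S: "T = insert k S" "finite S" "k \<notin> S"
    using T by (auto simp: S_def)
  have "integrable (std_gauss T) (\<lambda>z. z k * F z)"
  proof (rule Bochner_Integration.integrable_bound)
    show "integrable (std_gauss T) (\<lambda>z. C * z k)"
      by (intro integrable_mult_right integrable_coord_std_gauss T)
    show "AE z in std_gauss T. norm (z k * F z) \<le> norm (C * z k)"
    proof (intro AE_I2)
      fix z :: "'k \<Rightarrow> real"
      have "\<bar>F z\<bar> * \<bar>z k\<bar> \<le> \<bar>C\<bar> * \<bar>z k\<bar>"
        using bd(1)[of z] by (intro mult_right_mono) auto
      then show "norm (z k * F z) \<le> norm (C * z k)"
        by (simp add: abs_mult mult_ac)
    qed
  qed measurable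
  moreover have "integrable (std_gauss T) F'"
    using bd(2) by (intro integrable_const_bound[where B=C]) auto
  ultimately show ?thesis
    unfolding S(1)
    apply (subst (1 2) product_integral_insert[OF S(2,3)])
    using stein_std_normal[OF deriv cont bd(1) bd(2)]
    by auto
qed

lemma exp_linear_std_gauss:
  fixes a :: "'k \<Rightarrow> real"
  assumes "finite T"
  shows "integrable (std_gauss T) (\<lambda>z. exp (\<Sum>k\<in>T. a k * z k))" (is ?A)
    and "(\<integral>z. exp (\<Sum>k\<in>T. a k * z k) \<partial>std_gauss T) = exp ((\<Sum>k\<in>T. (a k)\<^sup>2) / 2)" (is ?B)
proof -
  interpret product_sigma_finite "\<lambda>_. std_normal_distribution"
    by (rule product_sigma_finite_std_normal)
  show ?A
    using product_integrable_prod[where f="\<lambda>k x. exp (a k * x)", OF assms integrable_exp_std_normal]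
    by (simp add: exp_sum assms)
  show ?B
    using product_integral_prod[where f="\<lambda>k x. exp (a k * x)", OF assms integrable_exp_std_normal]
    by (simp add: exp_sum assms integral_exp_std_normal sum_divide_distrib)
qed

section \<open>Linear forms in independent normals, and gradients along curves\<close>

definition lin :: "'k set \<Rightarrow> ('k \<Rightarrow> real) \<Rightarrow> ('k \<Rightarrow> real) \<Rightarrow> real" where
  "lin T a z = (\<Sum>k\<in>T. a k * z k)"

lemma measurable_lin [measurable]: "lin T a \<in> borel_measurable (std_gauss T)"
  unfolding lin_def by measurable

lemma integrable_lin: "finite T \<Longrightarrow> integrable (std_gauss T) (lin T a)"
  unfolding lin_def[abs_def]
  by (intro Bochner_Integration.integrable_sum integrable_mult_right integrable_coord_std_gauss)

lemma lin_fun_upd: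
  assumes "finite T" "k \<in> T"
  shows "lin T a (z(k := x)) = a k * x + (\<Sum>l\<in>T - {k}. a l * z l)"
  unfolding lin_def using assms by (subst sum.remove[of _ k]) (auto intro!: sum.cong)

text \<open>Vectors are functions on an arbitrary index type without a norm, so differentiability is
  expressed by the chain rule along every differentiable curve. Curves that move one coordinate of
  \<open>z\<close> serve Stein's identity, and the rotation path serves the interpolation.\<close>

definition has_gradient ::
  "'i set \<Rightarrow> (('i \<Rightarrow> real) \<Rightarrow> real) \<Rightarrow> ('i \<Rightarrow> ('i \<Rightarrow> real) \<Rightarrow> real) \<Rightarrow> bool" where
  "has_gradient I f f' \<longleftrightarrow>
     (\<forall>y y' s. (\<forall>j\<in>I. ((\<lambda>s. y s j) has_real_derivative y' j) (at s)) \<longrightarrow>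
        ((\<lambda>s::real. f (y s)) has_real_derivative (\<Sum>j\<in>I. f' j (y s) * y' j)) (at s))"

definition curve_continuous :: "'i set \<Rightarrow> (('i \<Rightarrow> real) \<Rightarrow> real) \<Rightarrow> bool" where
  "curve_continuous I f \<longleftrightarrow>
     (\<forall>y s. (\<forall>j\<in>I. isCont (\<lambda>s. y s j) s) \<longrightarrow> isCont (\<lambda>s::real. f (y s)) s)"

lemma has_gradientD:
  assumes "has_gradient I f f'" "\<And>j. j \<in> I \<Longrightarrow> ((\<lambda>s. y s j) has_real_derivative y' j) (at s)"
  shows "((\<lambda>s. f (y s)) has_real_derivative (\<Sum>j\<in>I. f' j (y s) * y' j)) (at s)"
  using assms unfolding has_gradient_def by blast

lemma curve_continuousD:
  assumes "curve_continuous I f" "\<And>j. j \<in> I \<Longrightarrow> isCont (\<lambda>s. y s j) s"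
  shows "isCont (\<lambda>s::real. f (y s)) s"
  using assms unfolding curve_continuous_def by blast

text \<open>By the chain rule the composition has derivative
  \<open>\<Sum>j\<in>I. f' j * A j k\<close> in \<open>z k\<close>; weighting by \<open>a k\<close>
  and summing over \<open>k\<close> collects the covariances of the form \<open>a\<close> with the
  forms \<open>A j\<close>.\<close>

lemma stein_gradient:
  fixes A :: "'i \<Rightarrow> 'k \<Rightarrow> real"
  assumes fin: "finite T" "finite I"
    and f: "has_gradient I f f'" "\<And>j. j \<in> I \<Longrightarrow> curve_continuous I (f' j)"
    and meas [measurable]: "(\<lambda>z. f (\<lambda>j. lin T (A j) z - c j)) \<in> borel_measurable (std_gauss T)"
      "\<And>j. j \<in> I \<Longrightarrow> (\<lambda>z. f' j (\<lambda>j. lin T (A j) z - c j)) \<in> borel_measurable (std_gauss T)"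
    and bd: "\<And>y. \<bar>f y\<bar> \<le> C" "\<And>j y. j \<in> I \<Longrightarrow> \<bar>f' j y\<bar> \<le> C"
  shows "(\<integral>z. lin T a z * f (\<lambda>j. lin T (A j) z - c j) \<partial>std_gauss T) =
    (\<Sum>j\<in>I. (\<Sum>k\<in>T. a k * A j k) * (\<integral>z. f' j (\<lambda>j. lin T (A j) z - c j) \<partial>std_gauss T))"
proof -
  interpret finite_measure "std_gauss T"
    by (rule finite_measure_std_gauss)
  have C: "0 \<le> C" using bd(1)[of undefined] by linarith
  define Y where "Y z j = lin T (A j) z - c j" for z j
  have Ym [measurable]: "(\<lambda>z. f (Y z)) \<in> borel_measurable (std_gauss T)"
    "\<And>j. j \<in> I \<Longrightarrow> (\<lambda>z. f' j (Y z)) \<in> borel_measurable (std_gauss T)"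
    using meas by (simp_all add: Y_def[abs_def])
  define g where "g k z = (\<Sum>j\<in>I. f' j (Y z) * A j k)" for k z
  have gm [measurable]: "g k \<in> borel_measurable (std_gauss T)" for k
    unfolding g_def[abs_def] by measurable
  have int_f': "integrable (std_gauss T) (\<lambda>z. f' j (Y z))" if "j \<in> I" for j
    using bd(2) that by (intro integrable_const_bound[where B=C]) auto
  have step: "(\<integral>z. z k * f (Y z) \<partial>std_gauss T) = (\<integral>z. g k z \<partial>std_gauss T)" if k: "k \<in> T" for k
  \<comment> \<open>One constant has to bound both the function and its partial derivative in
    \<open>z k\<close>.\<close>
  proof (rule stein_std_gauss[where C="C + (\<Sum>j\<in>I. C * \<bar>A j k\<bar>)"])
    show "((\<lambda>x. f (Y (z(k := x)))) has_real_derivative g k (z(k := x))) (at x)" for z x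
      unfolding g_def
    proof (rule has_gradientD[OF f(1)])
      fix j
      show "((\<lambda>x. Y (z(k := x)) j) has_real_derivative A j k) (at x)"
        unfolding Y_def lin_fun_upd[OF fin(1) k] by (auto intro!: derivative_eq_intros)
    qed
    show "isCont (\<lambda>x. g k (z(k := x))) x" for z x
      unfolding g_def
    proof (intro continuous_intros)
      fix j assume "j \<in> I"
      show "isCont (\<lambda>x. f' j (Y (z(k := x)))) x"
        by (rule curve_continuousD[OF f(2)[OF \<open>j \<in> I\<close>]])
           (auto simp: Y_def lin_fun_upd[OF fin(1) k] intro!: continuous_intros)
    qed
    have nn: "0 \<le> (\<Sum>j\<in>I. C * \<bar>A j k\<bar>)"
      using C by (intro sum_nonneg) auto
    show "\<bar>f (Y z)\<bar> \<le> C + (\<Sum>j\<in>I. C * \<bar>A j k\<bar>)" for z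
      using bd(1)[of "Y z"] nn by linarith
    have *: "\<bar>g k z\<bar> \<le> (\<Sum>j\<in>I. C * \<bar>A j k\<bar>)" for z
      unfolding g_def
      by (rule order_trans[OF sum_abs]) (auto simp: abs_mult intro!: sum_mono mult_right_mono bd)
    show "\<bar>g k z\<bar> \<le> C + (\<Sum>j\<in>I. C * \<bar>A j k\<bar>)" for z
      using C *[of z] by linarith
  qed (use fin k in auto)
  have int_z: "integrable (std_gauss T) (\<lambda>z. z k * f (Y z))" if "k \<in> T" for k
  proof (rule Bochner_Integration.integrable_bound)
    show "integrable (std_gauss T) (\<lambda>z. C * z k)"
      using that by (intro integrable_mult_right integrable_coord_std_gauss fin)
    show "AE z in std_gauss T. norm (z k * f (Y z)) \<le> norm (C * z k)"
      using mult_right_mono[OF bd(1) abs_ge_zero] C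
      by (intro AE_I2) (simp add: abs_mult mult.commute[of "\<bar>_ k\<bar>"])
    show "(\<lambda>z. z k * f (Y z)) \<in> borel_measurable (std_gauss T)"
      using that by measurable
  qed
  have "(\<integral>z. lin T a z * f (Y z) \<partial>std_gauss T) =
    (\<integral>z. (\<Sum>k\<in>T. a k * (z k * f (Y z))) \<partial>std_gauss T)"
    unfolding lin_def sum_distrib_right by (simp only: mult.assoc)
  also have "\<dots> = (\<Sum>k\<in>T. a k * (\<integral>z. g k z \<partial>std_gauss T))"
    using int_z by (subst Bochner_Integration.integral_sum) (auto simp: step)
  also have "\<dots> = (\<Sum>k\<in>T. a k * (\<Sum>j\<in>I. A j k * (\<integral>z. f' j (Y z) \<partial>std_gauss T)))"
    using int_f' unfolding g_def by (subst Bochner_Integration.integral_sum) (auto simp: mult_ac)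
  also have "\<dots> = (\<Sum>j\<in>I. (\<Sum>k\<in>T. a k * A j k) * (\<integral>z. f' j (Y z) \<partial>std_gauss T))"
    unfolding sum_distrib_left sum_distrib_right by (subst sum.swap) (simp add: mult_ac)
  finally show ?thesis
    by (simp add: Y_def[abs_def])
qed

section \<open>Softmax weights\<close>

definition expsum :: "'i set \<Rightarrow> real \<Rightarrow> ('i \<Rightarrow> real) \<Rightarrow> real" where
  "expsum I \<beta> y = (\<Sum>j\<in>I. exp (\<beta> * y j))"

definition softmax :: "'i set \<Rightarrow> real \<Rightarrow> ('i \<Rightarrow> real) \<Rightarrow> 'i \<Rightarrow> real" where
  "softmax I \<beta> y i = exp (\<beta> * y i) / expsum I \<beta> y"

lemma expsum_pos: "finite I \<Longrightarrow> I \<noteq> {} \<Longrightarrow> 0 < expsum I \<beta> y"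
  unfolding expsum_def by (intro sum_pos) auto

lemma softmax_nonneg: "0 \<le> softmax I \<beta> y i"
  unfolding softmax_def expsum_def by (intro divide_nonneg_nonneg sum_nonneg) auto

lemma sum_softmax: "finite I \<Longrightarrow> I \<noteq> {} \<Longrightarrow> (\<Sum>i\<in>I. softmax I \<beta> y i) = 1"
  using expsum_pos[of I \<beta> y]
  by (simp add: softmax_def sum_divide_distrib[symmetric] expsum_def[symmetric])

lemma softmax_le_1: "finite I \<Longrightarrow> i \<in> I \<Longrightarrow> softmax I \<beta> y i \<le> 1"
  using sum_softmax[of I \<beta> y] member_le_sum[of i I "softmax I \<beta> y"] softmax_nonneg by fastforce

lemma expsum_deriv:
  assumes "\<And>j. j \<in> I \<Longrightarrow> ((\<lambda>s. y s j) has_real_derivative y' j) (at s)"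
  shows "((\<lambda>s. expsum I \<beta> (y s)) has_real_derivative
    \<beta> * (\<Sum>j\<in>I. exp (\<beta> * y s j) * y' j)) (at s)"
  unfolding expsum_def sum_distrib_left
  using assms by (intro DERIV_sum) (auto intro!: derivative_eq_intros)

lemma softmax_deriv:
  assumes I: "finite I" "I \<noteq> {}" "i \<in> I"
    and y: "\<And>j. j \<in> I \<Longrightarrow> ((\<lambda>s. y s j) has_real_derivative y' j) (at s)"
  shows "((\<lambda>s. softmax I \<beta> (y s) i) has_real_derivative
    \<beta> * softmax I \<beta> (y s) i * (y' i - (\<Sum>j\<in>I. softmax I \<beta> (y s) j * y' j))) (at s)"
proof -
  have "expsum I \<beta> (y s) \<noteq> 0"
    using expsum_pos[OF I(1,2)] by (metis less_irrefl)
  then show ?thesis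
    unfolding softmax_def
    by (auto intro!: derivative_eq_intros expsum_deriv[OF y] y[OF I(3)]
        simp: field_simps sum_divide_distrib[symmetric] sum_distrib_left[symmetric])
qed

lemma softmax_isCont:
  assumes I: "finite I" "I \<noteq> {}" "i \<in> I"
    and y: "\<And>j. j \<in> I \<Longrightarrow> isCont (\<lambda>s. y s j) s"
  shows "isCont (\<lambda>s. softmax I \<beta> (y s) i) s"
proof -
  have "expsum I \<beta> (y s) \<noteq> 0"
    using expsum_pos[OF I(1,2)] by (metis less_irrefl)
  then show ?thesis
    unfolding softmax_def expsum_def by (intro continuous_intros y I) auto
qed

lemma measurable_softmax [measurable (raw)]:
  assumes [measurable]: "\<And>j. j \<in> I \<Longrightarrow> (\<lambda>z. y z j) \<in> borel_measurable M"
    and i: "i \<in> I"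
  shows "(\<lambda>z. softmax I \<beta> (y z) i) \<in> borel_measurable M"
  using i unfolding softmax_def expsum_def by measurable

text \<open>In effect a bound for the mean of the largest \<open>\<bar>lin T (A i) z\<bar>\<close>,
  stated for arbitrary random weights because these occur in the application. The function
  \<open>ln\<close> is bounded by its tangent at \<open>a\<close>, the mean of the exponential sum
  \<open>R\<close>, which plays the part of Jensen's inequality.\<close>

lemma weighted_abs_bound:
  fixes A :: "'i \<Rightarrow> 'k \<Rightarrow> real"
  assumes fin: "finite T" "finite I" "I \<noteq> {}"
    and var: "\<And>i. i \<in> I \<Longrightarrow> (\<Sum>k\<in>T. (A i k)\<^sup>2) = 1"
    and q: "\<And>z i. i \<in> I \<Longrightarrow> 0 \<le> q z i" "\<And>z. (\<Sum>i\<in>I. q z i) = 1"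
    and [measurable]: "\<And>i. i \<in> I \<Longrightarrow> (\<lambda>z. q z i) \<in> borel_measurable (std_gauss T)"
  shows "(\<integral>z. (\<Sum>i\<in>I. q z i * \<bar>lin T (A i) z\<bar>) \<partial>std_gauss T) \<le> sqrt (2 * ln (2 * card I))"
proof -
  interpret prob_space "std_gauss T"
    by (rule prob_space_std_gauss)
  define K where "K = real (card I)"
  have K: "1 \<le> K" using fin by (simp add: K_def Suc_leI card_gt_0_iff)
  \<comment> \<open>Equalises the two summands \<open>ln (2 * K) / t\<close> and
    \<open>t / 2\<close> of the resulting bound \<open>ln a / t\<close>.\<close>
  define t where "t = sqrt (2 * ln (2 * K))"
  have lnK: "0 < ln (2 * K)" using K by simp
  have t: "0 < t" "t\<^sup>2 = 2 * ln (2 * K)" using lnK by (simp_all add: t_def)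
  define a where "a = 2 * K * exp (t\<^sup>2 / 2)"
  have a: "0 < a" using K by (simp add: a_def)
  have ln_a: "ln a = 2 * ln (2 * K)" using K by (simp add: a_def ln_mult t)
  define R where "R z = (\<Sum>j\<in>I. exp (t * lin T (A j) z) + exp (- t * lin T (A j) z))" for z
  have ex: "integrable (std_gauss T) (\<lambda>z. exp (c * lin T (A j) z))"
    "(\<integral>z. exp (c * lin T (A j) z) \<partial>std_gauss T) = exp (c\<^sup>2 / 2)" if "j \<in> I" for c j
  proof -
    have "(\<Sum>k\<in>T. (c * A j k)\<^sup>2) = c\<^sup>2"
      using var[OF that] by (simp add: power_mult_distrib flip: sum_distrib_left)
    moreover have "(\<Sum>k\<in>T. c * A j k * z k) = c * lin T (A j) z" for z
      by (simp add: lin_def sum_distrib_left mult_ac)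
    ultimately show "integrable (std_gauss T) (\<lambda>z. exp (c * lin T (A j) z))"
      "(\<integral>z. exp (c * lin T (A j) z) \<partial>std_gauss T) = exp (c\<^sup>2 / 2)"
      using exp_linear_std_gauss[OF fin(1), of "\<lambda>k. c * A j k"] by simp_all
  qed
  have iR: "integrable (std_gauss T) R"
    unfolding R_def by (intro Bochner_Integration.integrable_sum Bochner_Integration.integrable_add ex)
  have ER: "(\<integral>z. R z \<partial>std_gauss T) = a"
  proof -
    have "(\<integral>z. exp (t * lin T (A j) z) + exp (- t * lin T (A j) z) \<partial>std_gauss T) = 2 * exp (t\<^sup>2 / 2)"
      if "j \<in> I" for j
      using ex[OF that, of t] ex[OF that, of "- t"] by simp
    then show ?thesis
      unfolding R_def using ex[of _ t] ex[of _ "- t"]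
      by (subst Bochner_Integration.integral_sum) (auto simp: a_def K_def)
  qed
  have pt: "t * \<bar>lin T (A i) z\<bar> \<le> ln a - 1 + R z / a" if i: "i \<in> I" for i z
  proof -
    have "exp (t * \<bar>lin T (A i) z\<bar>) \<le> exp (t * lin T (A i) z) + exp (- t * lin T (A i) z)"
      by (cases "0 \<le> lin T (A i) z") auto
    also have "\<dots> \<le> R z"
      unfolding R_def by (rule member_le_sum[OF i]) (auto intro: fin add_nonneg_nonneg)
    finally have le: "exp (t * \<bar>lin T (A i) z\<bar>) / a \<le> R z / a"
      using a by (simp add: divide_right_mono)
    have "ln (exp (t * \<bar>lin T (A i) z\<bar>) / a) \<le> exp (t * \<bar>lin T (A i) z\<bar>) / a - 1"
      using a by (intro ln_le_minus_one) auto
    then show ?thesis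
      using a le by (simp add: ln_div)
  qed
  have pt2: "(\<Sum>i\<in>I. q z i * \<bar>lin T (A i) z\<bar>) \<le> (ln a - 1 + R z / a) / t" for z
  proof -
    have "(\<Sum>i\<in>I. q z i * \<bar>lin T (A i) z\<bar>) \<le> (\<Sum>i\<in>I. q z i * ((ln a - 1 + R z / a) / t))"
      using pt t q by (intro sum_mono mult_left_mono) (auto simp: field_simps)
    then show ?thesis
      using q(2)[of z] by (simp only: sum_distrib_right[symmetric] mult_1_left)
  qed
  have "(\<integral>z. (\<Sum>i\<in>I. q z i * \<bar>lin T (A i) z\<bar>) \<partial>std_gauss T) \<le>
    (\<integral>z. (ln a - 1 + R z / a) / t \<partial>std_gauss T)"
  proof (rule integral_mono)
    show i2: "integrable (std_gauss T) (\<lambda>z. (ln a - 1 + R z / a) / t)"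
      using iR by simp
    show "integrable (std_gauss T) (\<lambda>z. \<Sum>i\<in>I. q z i * \<bar>lin T (A i) z\<bar>)"
      by (rule Bochner_Integration.integrable_bound[OF i2], measurable)
         (use pt2 q in \<open>auto intro!: AE_I2 order_trans[OF pt2 abs_ge_self] simp: sum_nonneg simp del: abs_divide\<close>)
  qed (rule pt2)
  also have "\<dots> = ln a / t"
    using iR a by (simp add: ER prob_space)
  also have "\<dots> = t"
    using t by (simp add: ln_a power2_eq_square field_simps)
  finally show ?thesis by (simp add: t_def K_def)
qed

section \<open>Anti-concentration\<close>

text \<open>On the event some \<open>Y z l\<close> is positive and no \<open>Y z i\<close> exceeds
  \<open>e\<close>. The indices below \<open>- e\<close> then carry softmax weight at most 1/2 in
  total, so at least half of the weight sits where \<open>h\<close> is at least one. The factor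
  \<open>4 * pi * e\<close> is twice, on account of this half, the bound \<open>2 * pi * e\<close>
  of \<open>H\<close>.\<close>

lemma nazarov:
  fixes A :: "'i \<Rightarrow> 'k \<Rightarrow> real"
  assumes fin: "finite T" "finite I" "I \<noteq> {}"
    and var: "\<And>i. i \<in> I \<Longrightarrow> (\<Sum>k\<in>T. (A i k)\<^sup>2) = 1"
    and e: "0 < e"
  shows "measure (std_gauss T) {z \<in> space (std_gauss T).
      (\<forall>i\<in>I. lin T (A i) z \<le> c i + e) \<and> \<not> (\<forall>i\<in>I. lin T (A i) z \<le> c i)}
    \<le> 4 * pi * e * sqrt (2 * ln (2 * card I))" (is "measure _ ?E \<le> _")
proof -
  interpret prob_space "std_gauss T"
    by (rule prob_space_std_gauss)
  define K where "K = real (card I)"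
  have K: "1 \<le> K" using fin by (simp add: K_def Suc_leI card_gt_0_iff)
  \<comment> \<open>Chosen so that \<open>exp (- \<beta> * e) = 1 / (2 * K)\<close>: against a
    positive coordinate, even \<open>K\<close> indices below \<open>- e\<close> share weight at most
    1/2.\<close>
  define \<beta> where "\<beta> = ln (2 * K) / e"
  have \<beta>: "0 \<le> \<beta>" "\<beta> * e = ln (2 * K)" using e K by (simp_all add: \<beta>_def)
  define Y where "Y z j = lin T (A j) z - c j" for z j
  define q where "q y i = softmax I \<beta> y i" for y i
  \<comment> \<open>A scaled arctangent: increasing, with values between 0 and
    \<open>2 * pi * e\<close>, and with derivative \<open>h\<close> at least one on
    \<open>[-e, e]\<close>.\<close>
  define H where "H x = 2 * e * (arctan (x / e) + pi / 2)" for x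
  define h where "h x = 2 / (1 + (x / e)\<^sup>2)" for x
  have Hd: "(H has_real_derivative h x) (at x)" for x
  proof -
    have "((\<lambda>x. arctan (x / e)) has_real_derivative inverse (1 + (x / e)\<^sup>2) * (1 / e)) (at x)"
      by (rule DERIV_chain2[OF DERIV_arctan DERIV_cdivide[OF DERIV_ident]])
    then have "(H has_real_derivative 2 * e * (inverse (1 + (x / e)\<^sup>2) * (1 / e) + 0)) (at x)"
      unfolding H_def by (intro DERIV_cmult DERIV_add DERIV_const)
    moreover have "2 * e * (inverse (1 + (x / e)\<^sup>2) * (1 / e) + 0) = h x"
      using e unfolding h_def by (simp add: divide_inverse[of 2])
    ultimately show ?thesis by simp
  qed
  have H: "0 \<le> H x" "H x \<le> 2 * pi * e" for x
    using e arctan_lbound[of "x / e"] arctan_ubound[of "x / e"]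
      mult_left_mono[of "arctan (x / e) + pi / 2" pi "2 * e"]
    unfolding H_def by (auto simp: mult_ac)
  have h: "0 \<le> h x" "h x \<le> 2" for x
    by (auto simp: h_def field_simps add_pos_nonneg intro!: divide_nonneg_pos)
  have h1: "1 \<le> h x" if "\<bar>x\<bar> \<le> e" for x
  proof -
    have "(x / e)\<^sup>2 \<le> 1" using that e abs_le_square_iff[of x e] by (simp add: power_divide)
    then show ?thesis by (auto simp: h_def field_simps add_pos_nonneg)
  qed
  have q: "0 \<le> q y i" "(\<Sum>i\<in>I. q y i) = 1" for y i
    by (auto simp: q_def softmax_nonneg sum_softmax fin)
  have q1: "q y i \<le> 1" if "i \<in> I" for y i
    using that fin by (simp add: q_def softmax_le_1)
  have [measurable]: "H \<in> borel_measurable borel" "h \<in> borel_measurable borel"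
    unfolding H_def[abs_def] h_def[abs_def] by measurable
  have [measurable]: "(\<lambda>z. Y z j) \<in> borel_measurable (std_gauss T)" for j
    unfolding Y_def by measurable
  have [measurable]: "(\<lambda>z. q (Y z) j) \<in> borel_measurable (std_gauss T)" if "j \<in> I" for j
    using that unfolding q_def by measurable
  have int_qh: "integrable (std_gauss T) (\<lambda>z. q (Y z) i * h (Y z i))" if i: "i \<in> I" for i
  proof (rule integrable_const_bound[where B="1 * 2"])
    have "\<bar>q y i * h (y i)\<bar> \<le> 1 * 2" for y
      using q(1)[of y i] q1[OF i, of y] h[of "y i"] unfolding abs_mult by (intro mult_mono) auto
    then show "AE z in std_gauss T. norm (q (Y z) i * h (Y z i)) \<le> 1 * 2"
      by simp
  qed (use i in measurable)
  have int_ql: "integrable (std_gauss T) (\<lambda>z. q (Y z) i * \<bar>lin T (A i) z\<bar>)" if i: "i \<in> I" for i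
  proof (rule Bochner_Integration.integrable_bound[OF integrable_lin[OF fin(1), of "A i"]])
    show "AE z in std_gauss T. norm (q (Y z) i * \<bar>lin T (A i) z\<bar>) \<le> norm (lin T (A i) z)"
      using q(1) q1[OF i] by (intro AE_I2) (auto simp: abs_mult mult_left_le_one_le)
  qed (use i in measurable)
  \<comment> \<open>The partial derivative of \<open>q y i * H (y i)\<close> in
    \<open>y j\<close>.\<close>
  define f' where "f' i j y = \<beta> * q y i * H (y i) * ((if j = i then 1 else 0) - q y j)
    + (if j = i then q y i * h (y i) else 0)" for i j y
  have key: "(\<integral>z. q (Y z) i * h (Y z i) \<partial>std_gauss T) \<le>
      2 * pi * e * (\<integral>z. q (Y z) i * \<bar>lin T (A i) z\<bar> \<partial>std_gauss T)" if i: "i \<in> I" for i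
  proof -
    define \<rho> where "\<rho> j = (\<Sum>k\<in>T. A i k * A j k)" for j
    have \<rho>1: "\<rho> i = 1" using var[OF i] by (simp add: \<rho>_def power2_eq_square)
    \<comment> \<open>Correlations of unit-variance variables are at most one, by the
      arithmetic-geometric mean inequality in each summand.\<close>
    have \<rho>: "\<rho> j \<le> 1" if "j \<in> I" for j
    proof -
      have "2 * \<rho> j \<le> (\<Sum>k\<in>T. (A i k)\<^sup>2 + (A j k)\<^sup>2)"
        unfolding \<rho>_def sum_distrib_left
      proof (rule sum_mono)
        fix k
        show "2 * (A i k * A j k) \<le> (A i k)\<^sup>2 + (A j k)\<^sup>2"
          using sum_squares_bound[of "A i k" "A j k"] by simp
      qed
      then show ?thesis using var[OF i] var[OF that] by (simp add: sum.distrib)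
    qed
    have Hq: "0 \<le> q y i * H (y i)" "q y i * H (y i) \<le> 2 * pi * e" for y
      using H[of "y i"] q q1[OF i, of y] mult_mono[of "q y i" 1 "H (y i)" "2 * pi * e"]
      by auto
    have gen: "\<bar>\<beta> * x * d\<bar> \<le> \<beta> * b" if "0 \<le> x" "x \<le> b" "\<bar>d\<bar> \<le> 1" for x b d
    proof -
      have "\<bar>\<beta> * x * d\<bar> = \<beta> * (x * \<bar>d\<bar>)" using \<beta> that by (simp add: abs_mult)
      also have "\<dots> \<le> \<beta> * (b * 1)" using \<beta> that by (intro mult_left_mono mult_mono) auto
      finally show ?thesis by simp
    qed
    have bnd: "\<bar>f' i j y\<bar> \<le> \<beta> * (2 * pi * e) + 2" if "j \<in> I" for j y
    proof -
      have "\<bar>(if j = i then 1 else 0) - q y j\<bar> \<le> 1"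
        using q(1)[of y j] q1[OF that, of y] by auto
      from gen[OF Hq this]
      have "\<bar>\<beta> * (q y i * H (y i)) * ((if j = i then 1 else 0) - q y j)\<bar> \<le> \<beta> * (2 * pi * e)" .
      moreover have "\<bar>if j = i then q y i * h (y i) else 0\<bar> \<le> 1 * 2"
        using q(1)[of y i] q1[OF i, of y] h[of "y i"] mult_mono[of "q y i" 1 "h (y i)" 2] by auto
      ultimately show ?thesis
        unfolding f'_def by (simp only: mult.assoc)
    qed
    have stein: "(\<integral>z. lin T (A i) z * (q (Y z) i * H (Y z i)) \<partial>std_gauss T) =
      (\<Sum>j\<in>I. \<rho> j * (\<integral>z. f' i j (Y z) \<partial>std_gauss T))"
      unfolding \<rho>_def Y_def
    proof (rule stein_gradient[OF fin(1,2), where f="\<lambda>y. q y i * H (y i)" and C="2 * pi * e + \<beta> * (2 * pi * e) + 2"])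
      show "has_gradient I (\<lambda>y. q y i * H (y i)) (f' i)"
        unfolding has_gradient_def
      proof (intro allI impI)
        fix y y' s assume y: "\<forall>j\<in>I. ((\<lambda>s. y s j) has_real_derivative y' j) (at (s::real))"
        have yi: "((\<lambda>s. y s i) has_real_derivative y' i) (at s)"
          using y i by blast
        have d1: "((\<lambda>s. q (y s) i) has_real_derivative
          \<beta> * q (y s) i * (y' i - (\<Sum>j\<in>I. q (y s) j * y' j))) (at s)"
          unfolding q_def using y by (intro softmax_deriv fin i) auto
        have d2: "((\<lambda>s. H (y s i)) has_real_derivative h (y s i) * y' i) (at s)"
          by (rule DERIV_chain2[OF Hd yi])
        have "(\<Sum>j\<in>I. f' i j (y s) * y' j) = (\<Sum>j\<in>I. (if j = i then \<beta> * q (y s) i * H (y s i) * y' j else 0)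
          - \<beta> * q (y s) i * H (y s i) * (q (y s) j * y' j) + (if j = i then q (y s) i * h (y s i) * y' j else 0))"
          by (intro sum.cong) (auto simp: f'_def algebra_simps)
        also have "\<dots> = \<beta> * q (y s) i * H (y s i) * y' i
           - \<beta> * q (y s) i * H (y s i) * (\<Sum>j\<in>I. q (y s) j * y' j) + q (y s) i * h (y s i) * y' i"
          using fin i by (simp add: sum.distrib sum_subtractf sum.delta flip: sum_distrib_left)
        finally show "((\<lambda>s. q (y s) i * H (y s i)) has_real_derivative (\<Sum>j\<in>I. f' i j (y s) * y' j)) (at s)"
          by (auto intro!: derivative_eq_intros d1 d2 simp: algebra_simps)
      qed
      show "curve_continuous I (f' i j)" if j: "j \<in> I" for j
        unfolding curve_continuous_def
      proof (intro allI impI)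
        fix y :: "real \<Rightarrow> 'i \<Rightarrow> real" and s assume y: "\<forall>j\<in>I. isCont (\<lambda>s. y s j) (s::real)"
        have c1: "isCont (\<lambda>s. q (y s) l) s" if "l \<in> I" for l
          unfolding q_def using y by (intro softmax_isCont fin that) auto
        have c2: "isCont (\<lambda>s. H (y s i)) s"
          using isCont_o2[of s "\<lambda>s. y s i" H] y i DERIV_isCont[OF Hd] by auto
        have hc: "isCont h x" for x
          unfolding h_def using e by (intro continuous_intros) (auto simp: add_nonneg_eq_0_iff)
        have c3: "isCont (\<lambda>s. h (y s i)) s"
          using isCont_o2[of s "\<lambda>s. y s i" h] y i hc by auto
        show "isCont (\<lambda>s. f' i j (y s)) s"
          unfolding f'_def using c1[OF i] c1[OF j] c2 c3
          by (cases "j = i") (auto intro!: continuous_intros)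
      qed
      show "(\<lambda>z. q (\<lambda>j. lin T (A j) z - c j) i * H (lin T (A i) z - c i)) \<in> borel_measurable (std_gauss T)"
        using i unfolding Y_def[symmetric] by measurable
      show "(\<lambda>z. f' i j (\<lambda>j. lin T (A j) z - c j)) \<in> borel_measurable (std_gauss T)" if "j \<in> I" for j
        using i that unfolding Y_def[symmetric] f'_def by measurable
      have "0 \<le> 2 * pi * e" using e by simp
      then show "\<bar>q y i * H (y i)\<bar> \<le> 2 * pi * e + \<beta> * (2 * pi * e) + 2" for y
        using Hq[of y] \<beta>(1) mult_nonneg_nonneg[OF \<beta>(1), of "2 * pi * e"] by linarith
      show "\<bar>f' i j y\<bar> \<le> 2 * pi * e + \<beta> * (2 * pi * e) + 2" if "j \<in> I" for j y
        using bnd[OF that, of y] \<open>0 \<le> 2 * pi * e\<close> by linarith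
    qed
    have int_f': "integrable (std_gauss T) (\<lambda>z. f' i j (Y z))" if j: "j \<in> I" for j
    proof (rule integrable_const_bound[where B="\<beta> * (2 * pi * e) + 2"])
      show "(\<lambda>z. f' i j (Y z)) \<in> borel_measurable (std_gauss T)"
        using i j unfolding f'_def by measurable
    qed (use bnd[OF j] in auto)
    have "(\<integral>z. q (Y z) i * h (Y z i) \<partial>std_gauss T) \<le> (\<integral>z. (\<Sum>j\<in>I. \<rho> j * f' i j (Y z)) \<partial>std_gauss T)"
    proof (rule integral_mono)
      show "integrable (std_gauss T) (\<lambda>z. q (Y z) i * h (Y z i))"
        using int_qh[OF i] .
      show "integrable (std_gauss T) (\<lambda>z. \<Sum>j\<in>I. \<rho> j * f' i j (Y z))"
        using int_f' by (intro Bochner_Integration.integrable_sum integrable_mult_right) auto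
      fix z
      have "(\<Sum>j\<in>I. \<rho> j * q (Y z) j) \<le> (\<Sum>j\<in>I. 1 * q (Y z) j)"
        using \<rho> q by (intro sum_mono mult_right_mono) auto
      then have le: "0 \<le> 1 - (\<Sum>j\<in>I. \<rho> j * q (Y z) j)"
        using q(2)[of "Y z"] by simp
      \<comment> \<open>The part coming from the softmax weight is \<open>\<beta> * q * H\<close>
        times \<open>1 - (\<Sum>j\<in>I. \<rho> j * q j)\<close>. It is nonnegative, because
        \<open>\<rho> i = 1\<close> and an average of correlations is at most one; dropping it
        leaves \<open>q * h\<close>.\<close>
      have "(\<Sum>j\<in>I. \<rho> j * f' i j (Y z)) =
        (\<Sum>j\<in>I. (if j = i then \<rho> j * (\<beta> * q (Y z) i * H (Y z i)) else 0)
          - \<beta> * q (Y z) i * H (Y z i) * (\<rho> j * q (Y z) j) + (if j = i then \<rho> j * (q (Y z) i * h (Y z i)) else 0))"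
        by (intro sum.cong) (auto simp: f'_def algebra_simps)
      also have "\<dots> = \<rho> i * (\<beta> * q (Y z) i * H (Y z i))
          - \<beta> * q (Y z) i * H (Y z i) * (\<Sum>j\<in>I. \<rho> j * q (Y z) j) + \<rho> i * (q (Y z) i * h (Y z i))"
        using fin i by (simp add: sum.distrib sum_subtractf sum.delta flip: sum_distrib_left)
      also have "\<dots> = q (Y z) i * h (Y z i) + \<beta> * (q (Y z) i * H (Y z i)) * (1 - (\<Sum>j\<in>I. \<rho> j * q (Y z) j))"
        by (simp add: \<rho>1 algebra_simps)
      finally show "q (Y z) i * h (Y z i) \<le> (\<Sum>j\<in>I. \<rho> j * f' i j (Y z))"
        using mult_nonneg_nonneg[OF mult_nonneg_nonneg[OF \<beta>(1) Hq(1)[of "Y z"]] le] by simp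
    qed
    also have "\<dots> = (\<integral>z. lin T (A i) z * (q (Y z) i * H (Y z i)) \<partial>std_gauss T)"
      unfolding stein using int_f' by (subst Bochner_Integration.integral_sum) auto
    also have "\<dots> \<le> (\<integral>z. 2 * pi * e * (q (Y z) i * \<bar>lin T (A i) z\<bar>) \<partial>std_gauss T)"
    proof (rule integral_mono)
      have il: "integrable (std_gauss T) (\<lambda>z. 2 * pi * e * \<bar>lin T (A i) z\<bar>)"
        using integrable_lin[OF fin(1)] by auto
      show "integrable (std_gauss T) (\<lambda>z. lin T (A i) z * (q (Y z) i * H (Y z i)))"
      proof (rule Bochner_Integration.integrable_bound[OF il])
        show "AE z in std_gauss T. norm (lin T (A i) z * (q (Y z) i * H (Y z i)))
           \<le> norm (2 * pi * e * \<bar>lin T (A i) z\<bar>)"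
        proof (intro AE_I2)
          fix z
          show "norm (lin T (A i) z * (q (Y z) i * H (Y z i))) \<le> norm (2 * pi * e * \<bar>lin T (A i) z\<bar>)"
            using mult_right_mono[OF Hq(2)[of "Y z"], of "\<bar>lin T (A i) z\<bar>"] Hq(1)[of "Y z"] e
            by (simp only: real_norm_def abs_mult[of "lin T (A i) z"] abs_of_nonneg[OF Hq(1)]) (simp add: abs_mult mult_ac)
        qed
      qed (use i in measurable)
      show "integrable (std_gauss T) (\<lambda>z. 2 * pi * e * (q (Y z) i * \<bar>lin T (A i) z\<bar>))"
        using int_ql[OF i] by simp
      fix z
      have "lin T (A i) z * (q (Y z) i * H (Y z i)) \<le> \<bar>lin T (A i) z\<bar> * (q (Y z) i * (2 * pi * e))"
        using H[of "Y z i"] q(1)[of "Y z" i] by (intro mult_mono mult_nonneg_nonneg) auto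
      then show "lin T (A i) z * (q (Y z) i * H (Y z i)) \<le> 2 * pi * e * (q (Y z) i * \<bar>lin T (A i) z\<bar>)"
        by (simp add: mult_ac)
    qed
    also have "\<dots> = 2 * pi * e * (\<integral>z. q (Y z) i * \<bar>lin T (A i) z\<bar> \<partial>std_gauss T)"
      by simp
    finally show ?thesis .
  qed
  have Em: "?E \<in> sets (std_gauss T)"
    using fin by measurable
  have pt: "indicator ?E z \<le> 2 * (\<Sum>i\<in>I. q (Y z) i * h (Y z i))" for z
  proof (cases "z \<in> ?E")
    case True
    then have up: "Y z i \<le> e" if "i \<in> I" for i
      using that by (auto simp: Y_def)
    from True obtain l where l: "l \<in> I" "0 < Y z l"
      by (auto simp: Y_def not_le)
    \<comment> \<open>The denominator of the weight is at least
      \<open>exp (\<beta> * Y z l)\<close>, hence at least one.\<close>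
    have small: "q (Y z) i \<le> 1 / (2 * K)" if i: "i \<in> I" and less: "Y z i < - e" for i
    proof -
      have "1 \<le> exp (\<beta> * Y z l)" using l \<beta> by simp
      also have "\<dots> \<le> expsum I \<beta> (Y z)"
        unfolding expsum_def by (rule member_le_sum[OF l(1)]) (auto intro: fin)
      finally have "q (Y z) i \<le> exp (\<beta> * Y z i) / 1"
        unfolding q_def softmax_def by (intro divide_left_mono) auto
      also have "\<beta> * Y z i \<le> \<beta> * (- e)"
        using less \<beta> by (intro mult_left_mono) auto
      then have "exp (\<beta> * Y z i) / 1 \<le> exp (- ln (2 * K))"
        using \<beta> by simp
      also have "\<dots> = 1 / (2 * K)"
        using K by (simp add: exp_minus field_simps)
      finally show ?thesis .
    qed
    have "1 = (\<Sum>i\<in>I. q (Y z) i)"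
      by (simp add: q)
    also have "\<dots> \<le> (\<Sum>i\<in>I. q (Y z) i * h (Y z i) + 1 / (2 * K))"
    proof (rule sum_mono)
      fix i assume i: "i \<in> I"
      show "q (Y z) i \<le> q (Y z) i * h (Y z i) + 1 / (2 * K)"
      proof (cases "Y z i < - e")
        case True
        have "0 \<le> q (Y z) i * h (Y z i)"
          using q h by simp
        then show ?thesis using small[OF i True] by linarith
      next
        case False
        then have "1 \<le> h (Y z i)" using up[OF i] by (intro h1) auto
        then have "q (Y z) i * 1 \<le> q (Y z) i * h (Y z i)" using q by (intro mult_left_mono) auto
        moreover have "0 \<le> 1 / (2 * K)" using K by simp
        ultimately show ?thesis by linarith
      qed
    qed
    also have "\<dots> = (\<Sum>i\<in>I. q (Y z) i * h (Y z i)) + 1 / 2"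
      using K by (simp add: sum.distrib K_def)
    finally show ?thesis using True by simp
  next
    case False
    then show ?thesis using q h by (simp add: sum_nonneg)
  qed
  have "measure (std_gauss T) ?E = (\<integral>z. indicator ?E z \<partial>std_gauss T)"
    using Em by simp
  also have "\<dots> \<le> (\<integral>z. 2 * (\<Sum>i\<in>I. q (Y z) i * h (Y z i)) \<partial>std_gauss T)"
    using Em int_qh pt
    by (intro integral_mono) (auto intro!: Bochner_Integration.integrable_sum integrable_mult_right simp: emeasure_eq_measure)
  also have "\<dots> = 2 * (\<Sum>i\<in>I. \<integral>z. q (Y z) i * h (Y z i) \<partial>std_gauss T)"
    using int_qh by (simp add: Bochner_Integration.integral_sum)
  also have "\<dots> \<le> 2 * (\<Sum>i\<in>I. 2 * pi * e * (\<integral>z. q (Y z) i * \<bar>lin T (A i) z\<bar> \<partial>std_gauss T))"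
    using key by (intro mult_left_mono sum_mono) auto
  also have "\<dots> = 4 * pi * e * (\<integral>z. (\<Sum>i\<in>I. q (Y z) i * \<bar>lin T (A i) z\<bar>) \<partial>std_gauss T)"
    using int_ql by (simp add: Bochner_Integration.integral_sum sum_distrib_left mult.assoc)
  also have "\<dots> \<le> 4 * pi * e * sqrt (2 * ln (2 * card I))"
    using e q by (intro mult_left_mono weighted_abs_bound fin var) auto
  finally show ?thesis .
qed

section \<open>Gaussian comparison\<close>

text \<open>Dominated convergence along an arbitrary sequence; the mean value inequality bounds the
  difference quotients by \<open>w\<close>.\<close>

lemma has_real_derivative_integral:
  fixes F F' :: "real \<Rightarrow> 'a \<Rightarrow> real"
  assumes int: "\<And>s. integrable M (F s)"
    and meas [measurable]: "\<And>s. F' s \<in> borel_measurable M"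
    and deriv: "\<And>s z. z \<in> space M \<Longrightarrow> ((\<lambda>s. F s z) has_real_derivative F' s z) (at s)"
    and bd: "\<And>s z. z \<in> space M \<Longrightarrow> \<bar>F' s z\<bar> \<le> w z" and w: "integrable M w"
  shows "((\<lambda>s. \<integral>z. F s z \<partial>M) has_real_derivative (\<integral>z. F' s z \<partial>M)) (at s)"
  unfolding has_field_derivative_iff tendsto_at_iff_sequentially comp_def
proof (intro allI impI)
  have [measurable]: "F s \<in> borel_measurable M" for s
    using int by auto
  fix X :: "nat \<Rightarrow> real"
  assume X: "\<forall>i. X i \<in> UNIV - {s}" "X \<longlonglongrightarrow> s"
  have "(\<lambda>n. \<integral>z. (F (X n) z - F s z) / (X n - s) \<partial>M) \<longlonglongrightarrow> (\<integral>z. F' s z \<partial>M)"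
  proof (rule integral_dominated_convergence[OF _ _ w])
    show "AE z in M. (\<lambda>n. (F (X n) z - F s z) / (X n - s)) \<longlonglongrightarrow> F' s z"
      using deriv[of _ s] X
      by (intro AE_I2) (auto simp: has_field_derivative_iff tendsto_at_iff_sequentially comp_def)
    show "AE z in M. norm ((F (X n) z - F s z) / (X n - s)) \<le> w z" for n
    proof (intro AE_I2)
      fix z assume z: "z \<in> space M"
      have "norm (F (X n) z - F s z) \<le> w z * norm (X n - s)"
        using deriv[OF z] bd[OF z]
        by (intro field_differentiable_bound[where S=UNIV and f'="\<lambda>s. F' s z"]) auto
      then show "norm ((F (X n) z - F s z) / (X n - s)) \<le> w z"
        using X(1) by (auto simp: divide_le_eq)
    qed
  qed measurable
  moreover have "(\<integral>z. (F (X n) z - F s z) / (X n - s) \<partial>M) =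
    ((\<integral>z. F (X n) z \<partial>M) - (\<integral>z. F s z \<partial>M)) / (X n - s)" for n
    using int by simp
  ultimately show "(\<lambda>n. ((\<integral>z. F (X n) z \<partial>M) - (\<integral>z. F s z \<partial>M)) / (X n - s))
    \<longlonglongrightarrow> (\<integral>z. F' s z \<partial>M)"
    by (simp only:)
qed

text \<open>
  The path \<open>cos s * A z + sin s * B z\<close> joins two independent Gaussian vectors, and Stein's identity
  turns the derivative along it into second derivatives weighted by the covariance difference.
\<close>

lemma gaussian_interpolation:
  fixes A B :: "'i \<Rightarrow> 'k \<Rightarrow> real"
  assumes fin: "finite T" "finite I" and ne: "I \<noteq> {}"
    and orth: "\<And>i j. i \<in> I \<Longrightarrow> j \<in> I \<Longrightarrow> (\<Sum>k\<in>T. A i k * B j k) = 0"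
    and cov: "\<And>i j. i \<in> I \<Longrightarrow> j \<in> I \<Longrightarrow>
      \<bar>(\<Sum>k\<in>T. B i k * B j k) - (\<Sum>k\<in>T. A i k * A j k)\<bar> \<le> D"
    and f: "has_gradient I f f'" "\<And>i. i \<in> I \<Longrightarrow> has_gradient I (f' i) (f'' i)"
      "\<And>i j. i \<in> I \<Longrightarrow> j \<in> I \<Longrightarrow> curve_continuous I (f'' i j)"
    and meas: "\<And>y. (\<And>j. j \<in> I \<Longrightarrow> (\<lambda>z. y z j) \<in> borel_measurable (std_gauss T)) \<Longrightarrow>
        (\<lambda>z. f (y z)) \<in> borel_measurable (std_gauss T)"
      "\<And>y i. i \<in> I \<Longrightarrow> (\<And>j. j \<in> I \<Longrightarrow> (\<lambda>z. y z j) \<in> borel_measurable (std_gauss T)) \<Longrightarrow>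
        (\<lambda>z. f' i (y z)) \<in> borel_measurable (std_gauss T)"
      "\<And>y i l. i \<in> I \<Longrightarrow> l \<in> I \<Longrightarrow> (\<And>j. j \<in> I \<Longrightarrow> (\<lambda>z. y z j) \<in> borel_measurable (std_gauss T)) \<Longrightarrow>
        (\<lambda>z. f'' i l (y z)) \<in> borel_measurable (std_gauss T)"
    and bd: "\<And>y. \<bar>f y\<bar> \<le> C" "\<And>i y. i \<in> I \<Longrightarrow> \<bar>f' i y\<bar> \<le> C"
    and hess: "\<And>y. (\<Sum>i\<in>I. \<Sum>j\<in>I. \<bar>f'' i j y\<bar>) \<le> H"
  shows "\<bar>(\<integral>z. f (\<lambda>j. lin T (B j) z - c j) \<partial>std_gauss T)
      - (\<integral>z. f (\<lambda>j. lin T (A j) z - c j) \<partial>std_gauss T)\<bar> \<le> pi / 2 * (D * H)"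
proof -
  interpret prob_space "std_gauss T"
    by (rule prob_space_std_gauss)
  obtain i0 where i0: "i0 \<in> I" using ne by blast
  have D: "0 \<le> D" using cov[OF i0 i0] by linarith
  have C: "0 \<le> C" using bd(1)[of undefined] by linarith
  define Y where "Y s z j = lin T (\<lambda>k. cos s * A j k + sin s * B j k) z - c j" for s z j
  \<comment> \<open>The derivative of \<open>Y s z j\<close> in \<open>s\<close>; it is again a
    linear form, so Stein's identity applies to it.\<close>
  define U where "U s j z = lin T (\<lambda>k. cos s * B j k - sin s * A j k) z" for s j z
  have Y_eq: "Y s z j = cos s * lin T (A j) z + sin s * lin T (B j) z - c j" for s z j
    by (simp add: Y_def lin_def sum_distrib_left sum.distrib algebra_simps)
  have U_eq: "U s j z = cos s * lin T (B j) z - sin s * lin T (A j) z" for s z j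
    by (simp add: U_def lin_def sum_distrib_left sum.distrib sum_subtractf algebra_simps)
  have [measurable]: "(\<lambda>z. Y s z j) \<in> borel_measurable (std_gauss T)" for s j
    unfolding Y_def by measurable
  have [measurable]: "U s j \<in> borel_measurable (std_gauss T)" for s j
    unfolding U_def[abs_def] by measurable
  have [measurable]: "(\<lambda>z. f (Y s z)) \<in> borel_measurable (std_gauss T)" for s
    by (rule meas(1)) measurable
  have [measurable]: "(\<lambda>z. f' i (Y s z)) \<in> borel_measurable (std_gauss T)" if "i \<in> I" for i s
    by (rule meas(2)[OF that]) measurable
  have [measurable]: "(\<lambda>z. f'' i j (Y s z)) \<in> borel_measurable (std_gauss T)" if "i \<in> I" "j \<in> I" for i j s
    by (rule meas(3)[OF that]) measurable
  define w where "w z = (\<Sum>i\<in>I. C * (\<bar>lin T (B i) z\<bar> + \<bar>lin T (A i) z\<bar>))" for z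
  have U_le: "\<bar>U s i z\<bar> \<le> \<bar>lin T (B i) z\<bar> + \<bar>lin T (A i) z\<bar>" for s i z
  proof -
    have "\<bar>cos s * lin T (B i) z\<bar> \<le> 1 * \<bar>lin T (B i) z\<bar>" "\<bar>sin s * lin T (A i) z\<bar> \<le> 1 * \<bar>lin T (A i) z\<bar>"
      unfolding abs_mult by (intro mult_right_mono; simp)+
    then show ?thesis unfolding U_eq by linarith
  qed
  define \<phi>' where "\<phi>' s z = (\<Sum>i\<in>I. f' i (Y s z) * U s i z)" for s z
  have int_f'U: "integrable (std_gauss T) (\<lambda>z. f' i (Y s z) * U s i z)" if i: "i \<in> I" for i s
  proof (rule Bochner_Integration.integrable_bound)
    show "integrable (std_gauss T) (\<lambda>z. C * U s i z)"
      unfolding U_def by (intro integrable_mult_right integrable_lin fin)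
    show "AE z in std_gauss T. norm (f' i (Y s z) * U s i z) \<le> norm (C * U s i z)"
      using bd(2)[OF i] C by (intro AE_I2) (simp add: abs_mult mult_right_mono)
  qed (use i in measurable)
  have f''_le: "\<bar>f'' i j y\<bar> \<le> H" if ij: "i \<in> I" "j \<in> I" for i j y
  proof -
    have "\<bar>f'' i j y\<bar> \<le> (\<Sum>j\<in>I. \<bar>f'' i j y\<bar>)"
      by (rule member_le_sum[OF ij(2)]) (auto intro: fin)
    also have "\<dots> \<le> (\<Sum>i\<in>I. \<Sum>j\<in>I. \<bar>f'' i j y\<bar>)"
      by (rule member_le_sum[OF ij(1)]) (auto intro: fin sum_nonneg)
    finally show ?thesis using hess[of y] by linarith
  qed
  have H: "0 \<le> H" using f''_le[OF i0 i0] abs_ge_zero order_trans by blast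
  have int_f'': "integrable (std_gauss T) (\<lambda>z. f'' i j (Y s z))" if ij: "i \<in> I" "j \<in> I" for i j s
    using f''_le[OF ij] ij by (intro integrable_const_bound[where B=H]) auto
  have deriv: "((\<lambda>s. \<integral>z. f (Y s z) \<partial>std_gauss T) has_real_derivative (\<integral>z. \<phi>' s z \<partial>std_gauss T)) (at s)" for s
  proof (rule has_real_derivative_integral[where w=w])
    show "integrable (std_gauss T) (\<lambda>z. f (Y s z))" for s
      using bd(1) by (intro integrable_const_bound[where B=C]) auto
    show "integrable (std_gauss T) w"
      unfolding w_def using integrable_lin[OF fin(1)]
      by (intro Bochner_Integration.integrable_sum integrable_mult_right Bochner_Integration.integrable_add integrable_abs)
    show "\<phi>' s \<in> borel_measurable (std_gauss T)" for s
      unfolding \<phi>'_def[abs_def] by measurable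
    show "\<bar>\<phi>' s z\<bar> \<le> w z" for s z
      unfolding \<phi>'_def w_def
      by (rule order_trans[OF sum_abs])
         (use bd C U_le in \<open>auto simp: abs_mult intro!: sum_mono mult_mono\<close>)
    show "((\<lambda>s. f (Y s z)) has_real_derivative \<phi>' s z) (at s)" for s z
      unfolding \<phi>'_def
    proof (rule has_gradientD[OF f(1)])
      show "((\<lambda>s. Y s z j) has_real_derivative U s j z) (at s)" for j
        unfolding Y_eq U_eq by (auto intro!: derivative_eq_intros)
    qed
  qed
  have bound: "\<bar>\<integral>z. \<phi>' s z \<partial>std_gauss T\<bar> \<le> D * H" for s
  proof -
    have "(\<integral>z. \<phi>' s z \<partial>std_gauss T) = (\<Sum>i\<in>I. \<integral>z. U s i z * f' i (Y s z) \<partial>std_gauss T)"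
      unfolding \<phi>'_def using int_f'U by (subst Bochner_Integration.integral_sum) (auto simp: mult.commute)
    also have "\<dots> = (\<Sum>i\<in>I. \<Sum>j\<in>I. (cos s * sin s * ((\<Sum>k\<in>T. B i k * B j k) - (\<Sum>k\<in>T. A i k * A j k)))
        * (\<integral>z. f'' i j (Y s z) \<partial>std_gauss T))"
    proof (intro sum.cong refl)
      fix i assume i: "i \<in> I"
      have "(\<integral>z. U s i z * f' i (Y s z) \<partial>std_gauss T) =
        (\<Sum>j\<in>I. (\<Sum>k\<in>T. (cos s * B i k - sin s * A i k) * (cos s * A j k + sin s * B j k)) *
           (\<integral>z. f'' i j (Y s z) \<partial>std_gauss T))"
        unfolding U_def Y_def[abs_def]
      proof (rule stein_gradient[OF fin, where C="C + H"])
        show "\<bar>f' i y\<bar> \<le> C + H" for y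
          using bd(2)[OF i, of y] H by linarith
        show "\<bar>f'' i j y\<bar> \<le> C + H" if j: "j \<in> I" for j y
          using f''_le[OF i j, of y] C by linarith
      qed (use i f meas in \<open>auto simp: measurable_lin\<close>)
      also have "\<dots> = (\<Sum>j\<in>I. (cos s * sin s * ((\<Sum>k\<in>T. B i k * B j k) - (\<Sum>k\<in>T. A i k * A j k)))
        * (\<integral>z. f'' i j (Y s z) \<partial>std_gauss T))"
      proof (intro sum.cong refl arg_cong2[where f="(*)"])
        fix j assume j: "j \<in> I"
        \<comment> \<open>The covariance of \<open>U s i\<close> with the \<open>j\<close>-th
          component of \<open>Y s\<close>: the mixed sums vanish by \<open>orth\<close>, and the
          rest is a multiple of the covariance difference.\<close>
        have "(\<Sum>k\<in>T. (cos s * B i k - sin s * A i k) * (cos s * A j k + sin s * B j k)) =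
          cos s * cos s * (\<Sum>k\<in>T. A j k * B i k) - sin s * sin s * (\<Sum>k\<in>T. A i k * B j k)
          + cos s * sin s * ((\<Sum>k\<in>T. B i k * B j k) - (\<Sum>k\<in>T. A i k * A j k))"
          unfolding sum_distrib_left sum_subtractf[symmetric] sum.distrib[symmetric]
          by (intro sum.cong) (auto simp: algebra_simps)
        then show "(\<Sum>k\<in>T. (cos s * B i k - sin s * A i k) * (cos s * A j k + sin s * B j k)) =
          cos s * sin s * ((\<Sum>k\<in>T. B i k * B j k) - (\<Sum>k\<in>T. A i k * A j k))"
          using orth[OF i j] orth[OF j i] by simp
      qed
      finally show "(\<integral>z. U s i z * f' i (Y s z) \<partial>std_gauss T) = \<dots>" .
    qed
    also have "\<bar>\<dots>\<bar> \<le> (\<Sum>i\<in>I. \<Sum>j\<in>I. D * (\<integral>z. \<bar>f'' i j (Y s z)\<bar> \<partial>std_gauss T))"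
    proof (intro order_trans[OF sum_abs] sum_mono)
      fix i j assume ij: "i \<in> I" "j \<in> I"
      have "\<bar>cos s * sin s\<bar> \<le> 1 * 1"
        unfolding abs_mult by (intro mult_mono) auto
      then have "\<bar>cos s * sin s * ((\<Sum>k\<in>T. B i k * B j k) - (\<Sum>k\<in>T. A i k * A j k))\<bar> \<le> 1 * D"
        unfolding abs_mult[of "cos s * sin s"] using cov[OF ij] by (intro mult_mono) auto
      then show "\<bar>(cos s * sin s * ((\<Sum>k\<in>T. B i k * B j k) - (\<Sum>k\<in>T. A i k * A j k)))
        * (\<integral>z. f'' i j (Y s z) \<partial>std_gauss T)\<bar> \<le> D * (\<integral>z. \<bar>f'' i j (Y s z)\<bar> \<partial>std_gauss T)"
        unfolding abs_mult[of _ "integral\<^sup>L _ _"] using D by (intro mult_mono integral_abs_bound) auto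
    qed
    also have "\<dots> = D * (\<integral>z. (\<Sum>i\<in>I. \<Sum>j\<in>I. \<bar>f'' i j (Y s z)\<bar>) \<partial>std_gauss T)"
      using int_f'' by (simp add: Bochner_Integration.integral_sum sum_distrib_left)
    also have "\<dots> \<le> D * (\<integral>z. H \<partial>std_gauss T)"
      using int_f'' D hess
      by (intro mult_left_mono integral_mono Bochner_Integration.integrable_sum integrable_abs) auto
    finally show ?thesis by (simp add: prob_space)
  qed
  \<comment> \<open>The path runs from the \<open>A\<close> vector at 0 to the \<open>B\<close>
    vector at \<open>pi / 2\<close>, so the factor \<open>pi / 2\<close> is the length of the
    parameter interval.\<close>
  have "norm ((\<integral>z. f (Y (pi / 2) z) \<partial>std_gauss T) - (\<integral>z. f (Y 0 z) \<partial>std_gauss T)) \<le> D * H * norm (pi / 2 - 0)"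
    using deriv bound
    by (intro field_differentiable_bound[where S=UNIV and f'="\<lambda>s. \<integral>z. \<phi>' s z \<partial>std_gauss T"]) auto
  moreover have "Y (pi / 2) z = (\<lambda>j. lin T (B j) z - c j)" "Y 0 z = (\<lambda>j. lin T (A j) z - c j)" for z
    by (auto simp: Y_eq)
  ultimately show ?thesis by (simp add: mult_ac)
qed

section \<open>A twice differentiable cutoff and the soft maximum\<close>

definition pos_shift :: "real \<Rightarrow> real \<Rightarrow> real" where
  "pos_shift a x = max 0 (x - a)"

text \<open>One minus the distribution function of a sum of three independent uniform variables.\<close>

definition cutoff :: "real \<Rightarrow> real" where
  "cutoff x = 1 - (pos_shift 0 x ^ 3 - 3 * pos_shift 1 x ^ 3 + 3 * pos_shift 2 x ^ 3 - pos_shift 3 x ^ 3) / 6"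

definition cutoff' :: "real \<Rightarrow> real" where
  "cutoff' x = - (pos_shift 0 x ^ 2 - 3 * pos_shift 1 x ^ 2 + 3 * pos_shift 2 x ^ 2 - pos_shift 3 x ^ 2) / 2"

definition cutoff'' :: "real \<Rightarrow> real" where
  "cutoff'' x = - (pos_shift 0 x - 3 * pos_shift 1 x + 3 * pos_shift 2 x - pos_shift 3 x)"

text \<open>Only the kink at \<open>a\<close> needs an argument: there the difference quotient is at
  most \<open>\<bar>h\<bar> ^ (n - 1)\<close>, which tends to 0 since \<open>n\<close> is at least
  2.\<close>

lemma pos_shift_power_deriv:
  assumes "2 \<le> n"
  shows "((\<lambda>x. pos_shift a x ^ n) has_real_derivative real n * pos_shift a x ^ (n - 1)) (at x)"
proof -
  consider "x < a" | "x = a" | "a < x" by linarith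
  then show ?thesis
  proof cases
    case 1
    have "((\<lambda>x. 0) has_real_derivative 0) (at x)" by simp
    then have "((\<lambda>x. pos_shift a x ^ n) has_real_derivative 0) (at x)"
      by (rule DERIV_cong_ev[THEN iffD1, rotated -1])
        (use 1 assms in \<open>auto simp: pos_shift_def eventually_nhds intro!: exI[of _ "{..<a}"]\<close>)
    then show ?thesis using 1 assms by (simp add: pos_shift_def[of a x] power_0_left)
  next
    case 2
    have "((\<lambda>h. (pos_shift a (a + h) ^ n - pos_shift a a ^ n) / h) \<longlongrightarrow> 0) (at 0)"
    proof (rule Lim_null_comparison)
      show "\<forall>\<^sub>F h in at 0. norm ((pos_shift a (a + h) ^ n - pos_shift a a ^ n) / h) \<le> \<bar>h\<bar> ^ (n - 1)"
      proof (intro always_eventually allI)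
        fix h :: real
        have "pos_shift a (a + h) ^ n \<le> \<bar>h\<bar> ^ n"
          unfolding pos_shift_def by (intro power_mono) auto
        also have "\<bar>h\<bar> ^ n = \<bar>h\<bar> ^ (n - 1) * \<bar>h\<bar>"
          using assms by (metis One_nat_def Suc_pred' less_le_trans mult.commute pos2 power_Suc)
        finally show "norm ((pos_shift a (a + h) ^ n - pos_shift a a ^ n) / h) \<le> \<bar>h\<bar> ^ (n - 1)"
          using assms by (cases "h = 0") (auto simp: pos_shift_def divide_le_eq power_0_left)
      qed
      have "((\<lambda>h::real. \<bar>h\<bar> ^ (n - 1)) \<longlongrightarrow> \<bar>0\<bar> ^ (n - 1)) (at 0)"
        by (intro tendsto_intros)
      then show "((\<lambda>h::real. \<bar>h\<bar> ^ (n - 1)) \<longlongrightarrow> 0) (at 0)"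
        using assms by (simp only: abs_zero power_0_left) (simp split: if_splits)
    qed
    then show ?thesis
      using 2 assms by (simp add: DERIV_def pos_shift_def power_0_left)
  next
    case 3
    have "((\<lambda>x. (x - a) ^ n) has_real_derivative real n * (x - a) ^ (n - 1)) (at x)"
      by (auto intro!: derivative_eq_intros)
    then have "((\<lambda>x. pos_shift a x ^ n) has_real_derivative real n * (x - a) ^ (n - 1)) (at x)"
      by (rule DERIV_cong_ev[THEN iffD1, rotated -1])
        (use 3 in \<open>auto simp: pos_shift_def eventually_nhds intro!: exI[of _ "{a<..}"]\<close>)
    then show ?thesis using 3 by (simp add: pos_shift_def)
  qed
qed

lemma cutoff_deriv: "(cutoff has_real_derivative cutoff' x) (at x)"
proof -
  have "((\<lambda>x. pos_shift a x ^ 3) has_real_derivative 3 * pos_shift a x ^ 2) (at x)" for a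
    using pos_shift_power_deriv[of 3 a x] by simp
  then have "(cutoff has_real_derivative 0 - (3 * pos_shift 0 x ^ 2 - 3 * (3 * pos_shift 1 x ^ 2)
        + 3 * (3 * pos_shift 2 x ^ 2) - 3 * pos_shift 3 x ^ 2) / 6) (at x)"
    unfolding cutoff_def[abs_def] by (intro DERIV_diff DERIV_add DERIV_cdivide DERIV_cmult DERIV_const)
  then show ?thesis
    by (rule DERIV_cong) (simp add: cutoff'_def field_simps)
qed

lemma cutoff'_deriv: "(cutoff' has_real_derivative cutoff'' x) (at x)"
proof -
  have "((\<lambda>x. pos_shift a x ^ 2) has_real_derivative 2 * pos_shift a x) (at x)" for a
    using pos_shift_power_deriv[of 2 a x] by simp
  then have "(cutoff' has_real_derivative - (2 * pos_shift 0 x - 3 * (2 * pos_shift 1 x)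
        + 3 * (2 * pos_shift 2 x) - 2 * pos_shift 3 x) / 2) (at x)"
    unfolding cutoff'_def[abs_def]
    by (intro DERIV_minus DERIV_diff DERIV_add DERIV_cdivide DERIV_cmult DERIV_const)
  then show ?thesis
    by (rule DERIV_cong) (simp add: cutoff''_def)
qed

lemma cutoff''_isCont: "isCont cutoff'' x"
  unfolding cutoff''_def pos_shift_def by (intro continuous_intros)

lemma cutoff''_bound: "\<bar>cutoff'' x\<bar> \<le> 2"
  unfolding cutoff''_def pos_shift_def by (auto simp: max_def split: if_splits)

text \<open>The negative of \<open>cutoff'\<close> is the density of the sum of three uniform
  variables, a quadratic spline with knots 0, 1, 2 and 3; hence the cases. Its maximum is 3/4, and 1
  is a convenient bound.\<close>

lemma cutoff'_bounds: "- 1 \<le> cutoff' x" "cutoff' x \<le> 0"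
proof -
  consider "x \<le> 0" | "0 \<le> x" "x \<le> 1" | "1 \<le> x" "x \<le> 2" | "2 \<le> x" "x \<le> 3" | "3 \<le> x" by linarith
  then have "- 1 \<le> cutoff' x \<and> cutoff' x \<le> 0"
  proof cases
    case 2
    then have "x ^ 2 \<le> 1" by (simp add: power_le_one)
    then show ?thesis using 2 by (simp add: cutoff'_def pos_shift_def)
  next
    case 3
    define t where "t = (2 * x - 3)\<^sup>2"
    have "cutoff' x = (t - 3) / 4"
      using 3 by (simp add: t_def cutoff'_def pos_shift_def power2_eq_square field_simps)
    moreover have "0 \<le> t" "t \<le> 1" using 3 by (simp_all add: t_def abs_square_le_1 abs_le_iff)
    ultimately show ?thesis by auto
  next
    case 4
    have "cutoff' x = - (3 - x)\<^sup>2 / 2"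
      using 4 by (simp add: cutoff'_def pos_shift_def power2_eq_square field_simps)
    moreover have "(3 - x)\<^sup>2 \<le> 1" using 4 by (simp add: abs_square_le_1 abs_le_iff)
    ultimately show ?thesis by simp
  next
    case 5
    then show ?thesis by (simp add: cutoff'_def pos_shift_def power2_eq_square field_simps)
  qed (simp add: cutoff'_def pos_shift_def)
  then show "- 1 \<le> cutoff' x" "cutoff' x \<le> 0" by auto
qed

lemma cutoff_low: "x \<le> 0 \<Longrightarrow> cutoff x = 1"
  by (simp add: cutoff_def pos_shift_def)

lemma cutoff_high: "3 \<le> x \<Longrightarrow> cutoff x = 0"
  by (simp add: cutoff_def pos_shift_def power3_eq_cube field_simps)

lemma cutoff_bounds: "0 \<le> cutoff x" "cutoff x \<le> 1"
proof -
  have anti: "cutoff b \<le> cutoff a" if "a \<le> b" for a b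
    using that cutoff_deriv cutoff'_bounds(2) by (intro DERIV_nonpos_imp_nonincreasing[of a b]) blast+
  show "0 \<le> cutoff x"
    using anti[of x "max x 3"] cutoff_high[of "max x 3"] by simp
  show "cutoff x \<le> 1"
    using anti[of "min x 0" x] cutoff_low[of "min x 0"] by simp
qed

lemma curve_isCont_compose:
  fixes g :: "real \<Rightarrow> real"
  shows "(\<And>x. isCont g x) \<Longrightarrow> isCont u s \<Longrightarrow> isCont (\<lambda>s. g (u s)) s"
  using isCont_o2 by blast

text \<open>The log-sum-exp function with inverse temperature \<beta>; its gradient is
  \<open>softmax\<close>.\<close>

definition smooth_max :: "'i set \<Rightarrow> real \<Rightarrow> ('i \<Rightarrow> real) \<Rightarrow> real" where
  "smooth_max I \<beta> y = ln (expsum I \<beta> y) / \<beta>"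

lemma smooth_max_deriv:
  assumes I: "finite I" "I \<noteq> {}" and \<beta>: "0 < \<beta>"
    and y: "\<And>j. j \<in> I \<Longrightarrow> ((\<lambda>s. y s j) has_real_derivative y' j) (at s)"
  shows "((\<lambda>s. smooth_max I \<beta> (y s)) has_real_derivative (\<Sum>j\<in>I. softmax I \<beta> (y s) j * y' j)) (at s)"
proof -
  have p: "0 < expsum I \<beta> (y s)"
    by (rule expsum_pos[OF I])
  have "((\<lambda>s. ln (expsum I \<beta> (y s))) has_real_derivative
      1 / expsum I \<beta> (y s) * (\<beta> * (\<Sum>j\<in>I. exp (\<beta> * y s j) * y' j))) (at s)"
    using DERIV_chain2[OF DERIV_ln_divide[OF p] expsum_deriv[OF y]] .
  then have "((\<lambda>s. smooth_max I \<beta> (y s)) has_real_derivative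
      (1 / expsum I \<beta> (y s) * (\<beta> * (\<Sum>j\<in>I. exp (\<beta> * y s j) * y' j))) / \<beta>) (at s)"
    unfolding smooth_max_def
    by (rule DERIV_cdivide)
  also have "(1 / expsum I \<beta> (y s) * (\<beta> * (\<Sum>j\<in>I. exp (\<beta> * y s j) * y' j))) / \<beta> =
      (\<Sum>j\<in>I. softmax I \<beta> (y s) j * y' j)"
    using \<beta> by (simp add: softmax_def sum_divide_distrib)
  finally show ?thesis .
qed

lemma smooth_max_isCont:
  assumes I: "finite I" "I \<noteq> {}" and \<beta>: "0 < \<beta>"
    and y: "\<And>j. j \<in> I \<Longrightarrow> isCont (\<lambda>s. y s j) s"
  shows "isCont (\<lambda>s. smooth_max I \<beta> (y s)) s"
proof -
  have "expsum I \<beta> (y s) \<noteq> 0" using expsum_pos[OF I] by (metis less_irrefl)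
  then show ?thesis
    unfolding smooth_max_def expsum_def using \<beta> by (intro continuous_intros y) auto
qed

lemma smooth_max_bounds:
  assumes I: "finite I" "I \<noteq> {}" and \<beta>: "0 < \<beta>"
  shows "j \<in> I \<Longrightarrow> y j \<le> smooth_max I \<beta> y"
    and "(\<And>j. j \<in> I \<Longrightarrow> y j \<le> b) \<Longrightarrow> smooth_max I \<beta> y \<le> b + ln (card I) / \<beta>"
proof -
  have p: "0 < expsum I \<beta> y" by (rule expsum_pos[OF I])
  assume j: "j \<in> I"
  have "exp (\<beta> * y j) \<le> expsum I \<beta> y"
    unfolding expsum_def by (rule member_le_sum[OF j]) (auto intro: I)
  then have "\<beta> * y j \<le> ln (expsum I \<beta> y)"
    using p by (metis exp_gt_zero ln_exp ln_le_cancel_iff)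
  then show "y j \<le> smooth_max I \<beta> y"
    using \<beta> by (simp add: smooth_max_def field_simps)
next
  have p: "0 < expsum I \<beta> y" by (rule expsum_pos[OF I])
  assume le: "\<And>j. j \<in> I \<Longrightarrow> y j \<le> b"
  have c: "0 < real (card I)" using I by (simp add: card_gt_0_iff)
  have "expsum I \<beta> y \<le> (\<Sum>j\<in>I. exp (\<beta> * b))"
    unfolding expsum_def using le \<beta> by (intro sum_mono) auto
  then have "ln (expsum I \<beta> y) \<le> ln (card I * exp (\<beta> * b))"
    using p c by (subst ln_le_cancel_iff) auto
  also have "\<dots> = ln (card I) + \<beta> * b"
    using c by (simp add: ln_mult)
  finally show "smooth_max I \<beta> y \<le> b + ln (card I) / \<beta>"
    using \<beta> by (simp add: smooth_max_def field_simps)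
qed

lemma measurable_smooth_max [measurable (raw)]:
  assumes [measurable]: "\<And>j. j \<in> I \<Longrightarrow> (\<lambda>z. y z j) \<in> borel_measurable M"
  shows "(\<lambda>z. smooth_max I \<beta> (y z)) \<in> borel_measurable M"
  unfolding smooth_max_def expsum_def by measurable

lemma measurable_cutoff [measurable]:
  "cutoff \<in> borel_measurable borel" "cutoff' \<in> borel_measurable borel" "cutoff'' \<in> borel_measurable borel"
  unfolding cutoff_def[abs_def] cutoff'_def[abs_def] cutoff''_def[abs_def] pos_shift_def[abs_def] by measurable

text \<open>The test function is 1 on the left event and vanishes off the right one: the soft
  maximum exceeds the maximum by at most \<delta>, and the cutoff falls from 1 to 0 over a length
  \<open>3 * \<delta>\<close>, together \<open>4 * \<delta>\<close>. The error term is the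
  interpolation bound for this function.\<close>

lemma gaussian_smooth_max_comparison:
  fixes A B :: "'i \<Rightarrow> 'k \<Rightarrow> real"
  assumes fin: "finite T" "finite I" and ne: "I \<noteq> {}"
    and orth: "\<And>i j. i \<in> I \<Longrightarrow> j \<in> I \<Longrightarrow> (\<Sum>k\<in>T. A i k * B j k) = 0"
    and cov: "\<And>i j. i \<in> I \<Longrightarrow> j \<in> I \<Longrightarrow>
      \<bar>(\<Sum>k\<in>T. B i k * B j k) - (\<Sum>k\<in>T. A i k * A j k)\<bar> \<le> D"
    and L: "1 \<le> L" "real (card I) \<le> exp L" and \<delta>: "0 < \<delta>"
  shows "\<P>(z in std_gauss T. \<forall>i\<in>I. lin T (B i) z \<le> c i) \<le>
    \<P>(z in std_gauss T. \<forall>i\<in>I. lin T (A i) z \<le> c i + 4 * \<delta>) + 8 * D * L / \<delta>\<^sup>2"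
proof -
  interpret prob_space "std_gauss T"
    by (rule prob_space_std_gauss)
  obtain i0 where i0: "i0 \<in> I" using ne by blast
  have D: "0 \<le> D" using cov[OF i0 i0] by linarith
  \<comment> \<open>Makes \<open>ln (card I) / \<beta>\<close> at most \<delta>.\<close>
  define \<beta> where "\<beta> = L / \<delta>"
  have \<beta>: "0 < \<beta>" using L \<delta> by (simp add: \<beta>_def)
  define F where "F y = smooth_max I \<beta> y" for y
  define q where "q y i = softmax I \<beta> y i" for y i
  have q: "0 \<le> q y i" "(\<Sum>i\<in>I. q y i) = 1" for y i
    by (auto simp: q_def softmax_nonneg sum_softmax fin ne)
  have q1: "q y i \<le> 1" if "i \<in> I" for y i
    using that fin by (simp add: q_def softmax_le_1)
  define u where "u y = F y / \<delta> - 1" for y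
  define f where "f y = cutoff (u y)" for y
  define f' where "f' i y = cutoff' (u y) * q y i / \<delta>" for i y
  \<comment> \<open>The first summand is the curvature of the cutoff, of order
    \<open>1 / \<delta>\<^sup>2\<close>; the second is the curvature of the soft maximum, of order
    \<open>\<beta> / \<delta> = L / \<delta>\<^sup>2\<close>.\<close>
  define f'' where "f'' i j y = cutoff'' (u y) * q y i * q y j / \<delta>\<^sup>2 +
     cutoff' (u y) / \<delta> * (\<beta> * q y i * ((if j = i then 1 else 0) - q y j))" for i j y
  have ud: "((\<lambda>s. u (y s)) has_real_derivative (\<Sum>j\<in>I. q (y s) j * y' j) / \<delta>) (at s)"
    if "\<And>j. j \<in> I \<Longrightarrow> ((\<lambda>s. y s j) has_real_derivative y' j) (at s)" for y y' s
    using DERIV_diff[OF DERIV_cdivide[OF smooth_max_deriv[OF fin(2) ne \<beta> that]] DERIV_const[of 1]]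
    unfolding u_def F_def q_def by simp
  have uc: "isCont (\<lambda>s. u (y s)) s" if "\<And>j. j \<in> I \<Longrightarrow> isCont (\<lambda>s. y s j) s" for y and s :: real
    unfolding u_def F_def using \<delta> by (intro continuous_intros smooth_max_isCont[OF fin(2) ne \<beta>] that) auto
  have qd: "((\<lambda>s. q (y s) i) has_real_derivative
      \<beta> * q (y s) i * (y' i - (\<Sum>j\<in>I. q (y s) j * y' j))) (at s)"
    if "i \<in> I" "\<And>j. j \<in> I \<Longrightarrow> ((\<lambda>s. y s j) has_real_derivative y' j) (at s)" for i y y' s
    unfolding q_def using that fin ne by (intro softmax_deriv) auto
  have qc: "isCont (\<lambda>s. q (y s) i) s" if "i \<in> I" "\<And>j. j \<in> I \<Longrightarrow> isCont (\<lambda>s. y s j) s" for i y and s :: real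
    unfolding q_def using that fin ne by (intro softmax_isCont) auto
  have "\<bar>(\<integral>z. f (\<lambda>j. lin T (B j) z - c j) \<partial>std_gauss T)
      - (\<integral>z. f (\<lambda>j. lin T (A j) z - c j) \<partial>std_gauss T)\<bar> \<le> pi / 2 * (D * (4 * L / \<delta>\<^sup>2))"
  proof (rule gaussian_interpolation[OF fin ne orth cov, where f'=f' and f''=f'' and C="1 + 1 / \<delta>"])
    show "has_gradient I f f'"
      unfolding has_gradient_def
    proof (intro allI impI)
      fix y y' s assume "\<forall>j\<in>I. ((\<lambda>s. y s j) has_real_derivative y' j) (at (s::real))"
      then have "((\<lambda>s. f (y s)) has_real_derivative cutoff' (u (y s)) * ((\<Sum>j\<in>I. q (y s) j * y' j) / \<delta>)) (at s)"
        unfolding f_def by (intro DERIV_chain2[OF cutoff_deriv] ud) auto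
      also have "cutoff' (u (y s)) * ((\<Sum>j\<in>I. q (y s) j * y' j) / \<delta>) = (\<Sum>j\<in>I. f' j (y s) * y' j)"
        by (simp add: f'_def sum_divide_distrib sum_distrib_left mult.assoc)
      finally show "((\<lambda>s. f (y s)) has_real_derivative (\<Sum>j\<in>I. f' j (y s) * y' j)) (at s)" .
    qed
    show "has_gradient I (f' i) (f'' i)" if i: "i \<in> I" for i
      unfolding has_gradient_def
    proof (intro allI impI)
      fix y y' s assume y: "\<forall>j\<in>I. ((\<lambda>s. y s j) has_real_derivative y' j) (at (s::real))"
      define W where "W = (\<Sum>j\<in>I. q (y s) j * y' j)"
      have "((\<lambda>s. cutoff' (u (y s))) has_real_derivative cutoff'' (u (y s)) * (W / \<delta>)) (at s)"
        unfolding W_def using y by (intro DERIV_chain2[OF cutoff'_deriv] ud) auto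
      moreover have "((\<lambda>s. q (y s) i) has_real_derivative \<beta> * q (y s) i * (y' i - W)) (at s)"
        unfolding W_def using y i by (intro qd) auto
      ultimately have "((\<lambda>s. f' i (y s)) has_real_derivative
         (cutoff'' (u (y s)) * (W / \<delta>) * q (y s) i + \<beta> * q (y s) i * (y' i - W) * cutoff' (u (y s))) / \<delta>) (at s)"
        unfolding f'_def by (intro DERIV_cdivide DERIV_mult)
      also have "(cutoff'' (u (y s)) * (W / \<delta>) * q (y s) i + \<beta> * q (y s) i * (y' i - W) * cutoff' (u (y s))) / \<delta>
        = cutoff'' (u (y s)) * q (y s) i / \<delta>\<^sup>2 * W + cutoff' (u (y s)) / \<delta> * \<beta> * q (y s) i * y' i
          - cutoff' (u (y s)) / \<delta> * \<beta> * q (y s) i * W"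
        using \<delta> by (simp add: field_simps power2_eq_square)
      also have "\<dots> = (\<Sum>j\<in>I. cutoff'' (u (y s)) * q (y s) i / \<delta>\<^sup>2 * (q (y s) j * y' j)
          + (if j = i then cutoff' (u (y s)) / \<delta> * \<beta> * q (y s) i * y' j else 0)
          - cutoff' (u (y s)) / \<delta> * \<beta> * q (y s) i * (q (y s) j * y' j))"
        unfolding W_def using fin i by (simp only: sum.distrib sum_subtractf sum_distrib_left[symmetric]) simp
      also have "\<dots> = (\<Sum>j\<in>I. f'' i j (y s) * y' j)"
        using \<delta> by (intro sum.cong) (auto simp: f''_def field_simps)
      finally show "((\<lambda>s. f' i (y s)) has_real_derivative (\<Sum>j\<in>I. f'' i j (y s) * y' j)) (at s)" .
    qed
    show "curve_continuous I (f'' i j)" if ij: "i \<in> I" "j \<in> I" for i j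
      unfolding curve_continuous_def
    proof (intro allI impI)
      fix y :: "real \<Rightarrow> 'i \<Rightarrow> real" and s assume y: "\<forall>j\<in>I. isCont (\<lambda>s. y s j) (s::real)"
      have u: "isCont (\<lambda>s. u (y s)) s" using y by (intro uc) auto
      have c: "isCont (\<lambda>s. cutoff' (u (y s))) s" "isCont (\<lambda>s. cutoff'' (u (y s))) s"
        by (auto intro!: curve_isCont_compose[OF _ u] DERIV_isCont[OF cutoff'_deriv] cutoff''_isCont)
      have q: "isCont (\<lambda>s. q (y s) i) s" "isCont (\<lambda>s. q (y s) j) s"
        using y ij by (auto intro!: qc)
      show "isCont (\<lambda>s. f'' i j (y s)) s"
        unfolding f''_def using c q \<delta> by (cases "j = i") (auto intro!: continuous_intros)
    qed
    show "(\<lambda>z. f (y z)) \<in> borel_measurable (std_gauss T)"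
      if [measurable]: "\<And>j. j \<in> I \<Longrightarrow> (\<lambda>z. y z j) \<in> borel_measurable (std_gauss T)" for y
      unfolding f_def u_def F_def by measurable
    show "(\<lambda>z. f' i (y z)) \<in> borel_measurable (std_gauss T)"
      if [measurable]: "i \<in> I" "\<And>j. j \<in> I \<Longrightarrow> (\<lambda>z. y z j) \<in> borel_measurable (std_gauss T)" for y i
      unfolding f'_def u_def F_def q_def by measurable
    show "(\<lambda>z. f'' i j (y z)) \<in> borel_measurable (std_gauss T)"
      if [measurable]: "i \<in> I" "j \<in> I" "\<And>j. j \<in> I \<Longrightarrow> (\<lambda>z. y z j) \<in> borel_measurable (std_gauss T)" for y i j
      unfolding f''_def u_def F_def q_def by measurable
    show "\<bar>f y\<bar> \<le> 1 + 1 / \<delta>" for y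
      using cutoff_bounds[of "u y"] \<delta> by (simp add: f_def add_increasing2)
    show "\<bar>f' i y\<bar> \<le> 1 + 1 / \<delta>" if "i \<in> I" for i y
    proof -
      have "\<bar>cutoff' (u y) * q y i\<bar> \<le> 1 * 1"
        unfolding abs_mult using cutoff'_bounds[of "u y"] q q1[OF that] by (intro mult_mono) auto
      then have "\<bar>f' i y\<bar> \<le> 1 / \<delta>"
        using \<delta> unfolding f'_def by (simp add: abs_divide divide_right_mono)
      then show ?thesis by simp
    qed
    show "(\<Sum>i\<in>I. \<Sum>j\<in>I. \<bar>f'' i j y\<bar>) \<le> 4 * L / \<delta>\<^sup>2" for y
    proof -
      \<comment> \<open>Summed over \<open>i\<close> and \<open>j\<close>, the products of weights
        give 1 and the diagonal terms give 1, whatever the number of indices.\<close>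
      have "(\<Sum>i\<in>I. \<Sum>j\<in>I. \<bar>f'' i j y\<bar>) \<le> (\<Sum>i\<in>I. \<Sum>j\<in>I. 2 / \<delta>\<^sup>2 * (q y i * q y j) +
          \<beta> / \<delta> * (q y i * ((if j = i then 1 else 0) + q y j)))"
      proof (intro sum_mono)
        fix i j
        have gen: "\<bar>f\<bar> \<le> x + y" if "\<bar>a\<bar> \<le> x" "\<bar>b\<bar> \<le> y" "f = a + b" for a b x y f :: real
          using that by linarith
        define d where "d = (if j = i then 1 else 0) - q y j"
        define d' where "d' = (if j = i then 1 else 0) + q y j"
        have d: "\<bar>d\<bar> \<le> d'" using q(1)[of y j] by (auto simp: d_def d'_def)
        have "\<bar>cutoff'' (u y) * (q y i * q y j / \<delta>\<^sup>2)\<bar> \<le> 2 * (q y i * q y j / \<delta>\<^sup>2)"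
          unfolding abs_mult[of "cutoff'' _"] using cutoff''_bound[of "u y"] q \<delta> by (intro mult_mono) auto
        moreover have "\<bar>cutoff' (u y) * ((\<beta> / \<delta> * q y i) * d)\<bar> \<le> 1 * ((\<beta> / \<delta> * q y i) * d')"
          unfolding abs_mult[of "cutoff' _"] abs_mult[of _ d] using cutoff'_bounds[of "u y"] q \<delta> d \<beta>
          by (intro mult_mono) auto
        moreover have "f'' i j y = cutoff'' (u y) * (q y i * q y j / \<delta>\<^sup>2) + cutoff' (u y) * ((\<beta> / \<delta> * q y i) * d)"
          by (simp add: f''_def d_def)
        moreover have e: "2 / \<delta>\<^sup>2 * (q y i * q y j) + \<beta> / \<delta> * (q y i * d') =
            2 * (q y i * q y j / \<delta>\<^sup>2) + 1 * ((\<beta> / \<delta> * q y i) * d')"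
          by simp
        ultimately show "\<bar>f'' i j y\<bar> \<le> 2 / \<delta>\<^sup>2 * (q y i * q y j) + \<beta> / \<delta> * (q y i * ((if j = i then 1 else 0) + q y j))"
          unfolding d'_def[symmetric] e by (intro gen)
      qed
      also have "\<dots> = 2 / \<delta>\<^sup>2 + 2 * (\<beta> / \<delta>)"
      proof -
        have "(\<Sum>i\<in>I. \<Sum>j\<in>I. 2 / \<delta>\<^sup>2 * (q y i * q y j) +
            \<beta> / \<delta> * (q y i * ((if j = i then 1 else 0) + q y j))) =
          (\<Sum>i\<in>I. 2 / \<delta>\<^sup>2 * q y i + \<beta> / \<delta> * (2 * q y i))"
          by (intro sum.cong refl) (simp only: sum.distrib sum_distrib_left[symmetric] q(2); simp add: fin)
        also have "\<dots> = 2 / \<delta>\<^sup>2 + 2 * (\<beta> / \<delta>)"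
          by (simp only: sum.distrib sum_distrib_left[symmetric] q) simp
        finally show ?thesis .
      qed
      also have "\<dots> \<le> 4 * L / \<delta>\<^sup>2"
      proof -
        have "\<beta> / \<delta> = L / \<delta>\<^sup>2" by (simp add: \<beta>_def power2_eq_square)
        then have "2 / \<delta>\<^sup>2 + 2 * (\<beta> / \<delta>) = (2 + 2 * L) / \<delta>\<^sup>2" by (simp add: add_divide_distrib)
        also have "\<dots> \<le> 4 * L / \<delta>\<^sup>2" using L by (intro divide_right_mono) auto
        finally show ?thesis .
      qed
      finally show ?thesis .
    qed
  qed auto
  also have "pi / 2 * (D * (4 * L / \<delta>\<^sup>2)) \<le> 2 * (D * (4 * L / \<delta>\<^sup>2))"
    using pi_less_4 D L by (intro mult_right_mono mult_nonneg_nonneg divide_nonneg_nonneg) auto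
  finally have main: "(\<integral>z. f (\<lambda>j. lin T (B j) z - c j) \<partial>std_gauss T) \<le>
      (\<integral>z. f (\<lambda>j. lin T (A j) z - c j) \<partial>std_gauss T) + 8 * D * L / \<delta>\<^sup>2"
    by simp
  have [measurable]: "(\<lambda>z. f (\<lambda>j. lin T (M j) z - c j)) \<in> borel_measurable (std_gauss T)" for M
    unfolding f_def u_def F_def by measurable
  have int: "integrable (std_gauss T) (\<lambda>z. f (\<lambda>j. lin T (M j) z - c j))" for M
  proof (rule integrable_const_bound[where B=1])
    have "\<bar>f y\<bar> \<le> 1" for y
      using cutoff_bounds[of "u y"] by (simp add: f_def)
    then show "AE z in std_gauss T. norm (f (\<lambda>j. lin T (M j) z - c j)) \<le> 1"
      by simp
  qed measurable
  let ?EB = "{z \<in> space (std_gauss T). \<forall>i\<in>I. lin T (B i) z \<le> c i}"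
  let ?EA = "{z \<in> space (std_gauss T). \<forall>i\<in>I. lin T (A i) z \<le> c i + 4 * \<delta>}"
  have m: "?EB \<in> sets (std_gauss T)" "?EA \<in> sets (std_gauss T)"
    using fin by measurable
  have "measure (std_gauss T) ?EB = (\<integral>z. indicator ?EB z \<partial>std_gauss T)"
    using m by simp
  also have "\<dots> \<le> (\<integral>z. f (\<lambda>j. lin T (B j) z - c j) \<partial>std_gauss T)"
  proof (intro integral_mono int)
    show "integrable (std_gauss T) (indicat_real ?EB)"
      using m by (simp add: emeasure_eq_measure)
    fix z
    show "indicat_real ?EB z \<le> f (\<lambda>j. lin T (B j) z - c j)"
    proof (cases "z \<in> ?EB")
      case True
      have "F (\<lambda>j. lin T (B j) z - c j) \<le> 0 + ln (card I) / \<beta>"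
        unfolding F_def using True by (intro smooth_max_bounds(2)[OF fin(2) ne \<beta>]) auto
      also have "ln (card I) \<le> L"
        using L(2) fin ne by (metis card_gt_0_iff exp_gt_zero ln_exp ln_le_cancel_iff of_nat_0_less_iff)
      then have "0 + ln (card I) / \<beta> \<le> L / \<beta>"
        using \<beta> by (simp add: divide_right_mono)
      also have "L / \<beta> = \<delta>" using L \<delta> by (simp add: \<beta>_def)
      finally have "u (\<lambda>j. lin T (B j) z - c j) \<le> 0"
        using \<delta> by (simp add: u_def)
      then show ?thesis using True by (simp add: f_def cutoff_low)
    qed (simp add: f_def cutoff_bounds)
  qed
  also note main
  also have "(\<integral>z. f (\<lambda>j. lin T (A j) z - c j) \<partial>std_gauss T) \<le> (\<integral>z. indicator ?EA z \<partial>std_gauss T)"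
  proof (intro integral_mono int)
    show "integrable (std_gauss T) (indicat_real ?EA)"
      using m by (simp add: emeasure_eq_measure)
    fix z assume z: "z \<in> space (std_gauss T)"
    show "f (\<lambda>j. lin T (A j) z - c j) \<le> indicat_real ?EA z"
    proof (cases "z \<in> ?EA")
      case False
      then obtain i where i: "i \<in> I" "c i + 4 * \<delta> < lin T (A i) z"
        using z by (auto simp: not_le)
      have "4 * \<delta> < F (\<lambda>j. lin T (A j) z - c j)"
        unfolding F_def using i smooth_max_bounds(1)[OF fin(2) ne \<beta> i(1), of "\<lambda>j. lin T (A j) z - c j"] by simp
      then have "3 \<le> u (\<lambda>j. lin T (A j) z - c j)"
        using \<delta> by (simp add: u_def field_simps)
      then show ?thesis using False by (simp add: f_def cutoff_high)
    qed (simp add: f_def cutoff_bounds)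
  qed
  also have "(\<integral>z. indicator ?EA z \<partial>std_gauss T) = measure (std_gauss T) ?EA"
    using m by simp
  finally show ?thesis by simp
qed

text \<open>Nazarov's inequality after dividing each form and threshold by the standard deviation of
  the form. These are at least \<open>sqrt K\<close>, so every margin becomes at most
  \<open>e / sqrt K\<close>.\<close>

lemma gaussian_anti_concentration:
  fixes A :: "'i \<Rightarrow> 'k \<Rightarrow> real"
  assumes fin: "finite T" "finite I" "I \<noteq> {}"
    and K: "0 < K" "\<And>i. i \<in> I \<Longrightarrow> K \<le> (\<Sum>k\<in>T. (A i k)\<^sup>2)"
    and L: "1 \<le> L" "real (card I) \<le> exp L" and e: "0 \<le> e"
  shows "\<P>(z in std_gauss T. \<forall>i\<in>I. lin T (A i) z \<le> c i + e) \<le>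
    \<P>(z in std_gauss T. \<forall>i\<in>I. lin T (A i) z \<le> c i) + 32 / sqrt K * (e * sqrt L)"
proof (cases "e = 0")
  case False
  then have e: "0 < e" using e by simp
  interpret prob_space "std_gauss T"
    by (rule prob_space_std_gauss)
  define \<sigma> where "\<sigma> i = sqrt (\<Sum>k\<in>T. (A i k)\<^sup>2)" for i
  have \<sigma>: "sqrt K \<le> \<sigma> i" "0 < \<sigma> i" "(\<sigma> i)\<^sup>2 = (\<Sum>k\<in>T. (A i k)\<^sup>2)" if "i \<in> I" for i
    using K(1) K(2)[OF that] by (auto simp: \<sigma>_def intro!: sum_nonneg)
  define A' where "A' i k = A i k / \<sigma> i" for i k
  have lin: "lin T (A' i) z = lin T (A i) z / \<sigma> i" for i z
    by (simp add: lin_def A'_def sum_divide_distrib)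
  let ?S = "{z \<in> space (std_gauss T). \<forall>i\<in>I. lin T (A i) z \<le> c i}"
  let ?S' = "{z \<in> space (std_gauss T). \<forall>i\<in>I. lin T (A i) z \<le> c i + e}"
  let ?E = "{z \<in> space (std_gauss T). (\<forall>i\<in>I. lin T (A' i) z \<le> c i / \<sigma> i + e / sqrt K) \<and>
    \<not> (\<forall>i\<in>I. lin T (A' i) z \<le> c i / \<sigma> i)}"
  have m: "?S \<in> sets (std_gauss T)" "?E \<in> sets (std_gauss T)"
    using fin by measurable
  have "?S' \<subseteq> ?S \<union> ?E"
  proof (intro subsetI)
    fix z assume z: "z \<in> ?S'"
    have "lin T (A' i) z \<le> c i / \<sigma> i + e / sqrt K" if i: "i \<in> I" for i
    proof -
      have "lin T (A' i) z \<le> c i / \<sigma> i + e / \<sigma> i"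
        using z i \<sigma>[OF i] by (auto simp: lin divide_right_mono simp flip: add_divide_distrib)
      also have "e / \<sigma> i \<le> e / sqrt K"
        using \<sigma>[OF i] K e by (intro divide_left_mono) auto
      finally show ?thesis by simp
    qed
    moreover have "lin T (A' i) z \<le> c i / \<sigma> i \<longleftrightarrow> lin T (A i) z \<le> c i" if i: "i \<in> I" for i
      using \<sigma>[OF i] by (simp add: lin divide_le_cancel)
    ultimately show "z \<in> ?S \<union> ?E" using z by auto
  qed
  then have "prob ?S' \<le> prob ?S + prob ?E"
    using m by (intro order_trans[OF finite_measure_mono measure_Un_le]) auto
  also have "prob ?E \<le> 4 * pi * (e / sqrt K) * sqrt (2 * ln (2 * card I))"
  proof (rule nazarov[OF fin])
    fix i assume i: "i \<in> I"
    have "(\<Sum>k\<in>T. (A' i k)\<^sup>2) = (\<Sum>k\<in>T. (A i k)\<^sup>2) / (\<sigma> i)\<^sup>2"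
      by (simp add: A'_def power_divide sum_divide_distrib)
    then show "(\<Sum>k\<in>T. (A' i k)\<^sup>2) = 1"
      unfolding \<sigma>(3)[OF i, symmetric] using \<sigma>(2)[OF i] by simp
  qed (use e K in auto)
  \<comment> \<open>Here \<open>pi\<close> is replaced by 4, and \<open>ln (2 * card I)\<close> is
    at most \<open>2 * L\<close> because \<open>L\<close> is at least 1; hence the constant
    32.\<close>
  also have "\<dots> \<le> 4 * 4 * (e / sqrt K) * (2 * sqrt L)"
  proof -
    have "ln (2 * card I) \<le> 2 * L"
    proof -
      have c: "0 < real (card I)" using fin by (simp add: card_gt_0_iff)
      have "ln (2 * card I) = ln 2 + ln (card I)" using c by (simp add: ln_mult)
      moreover have "ln (card I) \<le> L"
        using L(2) c by (metis exp_gt_zero ln_exp ln_le_cancel_iff)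
      moreover have "ln 2 \<le> L" using L ln_2_less_1 by linarith
      ultimately show ?thesis by linarith
    qed
    then have "sqrt (2 * ln (2 * card I)) \<le> sqrt (4 * L)"
      by simp
    also have "\<dots> = 2 * sqrt L" by (simp add: real_sqrt_mult)
    finally have le: "sqrt (2 * ln (2 * card I)) \<le> 2 * sqrt L" .
    have "1 \<le> real (card I)" using fin by (simp add: Suc_leI card_gt_0_iff)
    then have "0 \<le> ln (2 * card I)" by (intro ln_ge_zero) simp
    then show ?thesis
      using pi_less_4 e K le by (intro mult_mono) auto
  qed
  finally show ?thesis by (simp add: field_simps)
qed simp

text \<open>Only the \<open>A\<close> side has variances bounded below, so both inequalities use
  anti-concentration for \<open>A\<close>: in the first after passing from \<open>B\<close> to
  \<open>A\<close>, in the second before passing from \<open>A\<close> to \<open>B\<close>. The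
  margin \<open>e\<close> makes room for an inner polytope.\<close>

lemma gaussian_polytope_comparison:
  fixes A B :: "'i \<Rightarrow> 'k \<Rightarrow> real"
  assumes fin: "finite T" "finite I" and ne: "I \<noteq> {}"
    and orth: "\<And>i j. i \<in> I \<Longrightarrow> j \<in> I \<Longrightarrow> (\<Sum>k\<in>T. A i k * B j k) = 0"
    and cov: "\<And>i j. i \<in> I \<Longrightarrow> j \<in> I \<Longrightarrow>
      \<bar>(\<Sum>k\<in>T. B i k * B j k) - (\<Sum>k\<in>T. A i k * A j k)\<bar> \<le> D"
    and L: "1 \<le> L" "real (card I) \<le> exp L"
    and K: "0 < K" "\<And>i. i \<in> I \<Longrightarrow> K \<le> (\<Sum>k\<in>T. (A i k)\<^sup>2)" and e: "0 \<le> e"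
  shows "\<P>(z in std_gauss T. \<forall>i\<in>I. lin T (B i) z \<le> c i) \<le>
      \<P>(z in std_gauss T. \<forall>i\<in>I. lin T (A i) z \<le> c i - e) +
      (8 + 128 / sqrt K) * (e * sqrt L + D powr (1/3) * L powr (2/3))" (is ?upper)
    and "\<P>(z in std_gauss T. \<forall>i\<in>I. lin T (A i) z \<le> c i) \<le>
      \<P>(z in std_gauss T. \<forall>i\<in>I. lin T (B i) z \<le> c i - e) +
      (8 + 128 / sqrt K) * (e * sqrt L + D powr (1/3) * L powr (2/3))" (is ?lower)
proof -
  obtain i0 where i0: "i0 \<in> I" using ne by blast
  have D: "0 \<le> D" using cov[OF i0 i0] by linarith
  define PA where "PA c = \<P>(z in std_gauss T. \<forall>i\<in>I. lin T (A i) z \<le> c i)" for c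
  define PB where "PB c = \<P>(z in std_gauss T. \<forall>i\<in>I. lin T (B i) z \<le> c i)" for c
  define err where "err \<delta> = 32 / sqrt K * ((4 * \<delta> + e) * sqrt L) + 8 * D * L / \<delta>\<^sup>2" for \<delta>
  have conc: "PA (\<lambda>i. c i + t) \<le> PA c + 32 / sqrt K * (t * sqrt L)" if "0 \<le> t" for c t
    unfolding PA_def by (rule gaussian_anti_concentration[OF fin ne K L that])
  have cov': "\<bar>(\<Sum>k\<in>T. A i k * A j k) - (\<Sum>k\<in>T. B i k * B j k)\<bar> \<le> D" if "i \<in> I" "j \<in> I" for i j
    using cov[OF that] by linarith
  have orth': "(\<Sum>k\<in>T. B i k * A j k) = 0" if "i \<in> I" "j \<in> I" for i j
    using orth[OF that(2,1)] by (simp add: mult.commute)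
  have up: "PB c \<le> PA (\<lambda>i. c i - e) + err \<delta>" if \<delta>: "0 < \<delta>" for \<delta>
  proof -
    have "PB c \<le> PA (\<lambda>i. c i + 4 * \<delta>) + 8 * D * L / \<delta>\<^sup>2"
      unfolding PA_def PB_def by (rule gaussian_smooth_max_comparison[OF fin ne orth cov L \<delta>])
    also have "PA (\<lambda>i. c i + 4 * \<delta>) \<le> PA (\<lambda>i. c i - e) + 32 / sqrt K * ((4 * \<delta> + e) * sqrt L)"
      using conc[of "4 * \<delta> + e" "\<lambda>i. c i - e"] \<delta> e by (simp add: add.commute)
    finally show ?thesis by (simp add: err_def)
  qed
  have lo: "PA c \<le> PB (\<lambda>i. c i - e) + err \<delta>" if \<delta>: "0 < \<delta>" for \<delta>
  proof -
    have "PA c \<le> PA (\<lambda>i. c i - e - 4 * \<delta>) + 32 / sqrt K * ((4 * \<delta> + e) * sqrt L)"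
      using conc[of "4 * \<delta> + e" "\<lambda>i. c i - e - 4 * \<delta>"] \<delta> e by simp
    also have "PA (\<lambda>i. c i - e - 4 * \<delta>) \<le> PB (\<lambda>i. (c i - e - 4 * \<delta>) + 4 * \<delta>) + 8 * D * L / \<delta>\<^sup>2"
      unfolding PA_def PB_def by (rule gaussian_smooth_max_comparison[OF fin ne orth' cov' L \<delta>])
    finally show ?thesis by (simp add: err_def)
  qed
  have lim: "x \<le> (8 + 128 / sqrt K) * (e * sqrt L + D powr (1/3) * L powr (2/3))"
    if x: "\<And>\<delta>. 0 < \<delta> \<Longrightarrow> x \<le> err \<delta>" for x
  proof (cases "D = 0")
    case False
    then have D: "0 < D" using D by simp
    \<comment> \<open>Makes \<open>\<delta> * sqrt L\<close> equal to
      \<open>D * L / \<delta>\<^sup>2\<close>.\<close>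
    define \<delta> where "\<delta> = D powr (1/3) * L powr (1/6)"
    have \<delta>: "0 < \<delta>" using D L by (simp add: \<delta>_def)
    have sL: "sqrt L = L powr (1/2)" using L by (simp add: powr_half_sqrt)
    have 1: "\<delta> * sqrt L = D powr (1/3) * L powr (2/3)"
      using L by (simp add: \<delta>_def sL mult.assoc flip: powr_add)
    have "\<delta>\<^sup>2 = \<delta> powr 2" using \<delta> by (simp add: powr_numeral)
    also have "\<dots> = D powr (2/3) * L powr (1/3)"
      using D L by (simp add: \<delta>_def powr_mult powr_powr)
    finally have "D * L / \<delta>\<^sup>2 = D powr 1 / D powr (2/3) * (L powr 1 / L powr (1/3))"
      using D L by simp
    also have "\<dots> = D powr (1/3) * L powr (2/3)"
      by (simp only: powr_diff[symmetric]) simp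
    finally have 2: "D * L / \<delta>\<^sup>2 = D powr (1/3) * L powr (2/3)" .
    have "err \<delta> = 32 / sqrt K * (4 * (\<delta> * sqrt L) + e * sqrt L) + 8 * (D * L / \<delta>\<^sup>2)"
      by (simp add: err_def algebra_simps)
    also have "\<dots> = (8 + 128 / sqrt K) * (D powr (1/3) * L powr (2/3)) + 32 / sqrt K * (e * sqrt L)"
      unfolding 1 2 by (simp add: algebra_simps)
    also have "\<dots> \<le> (8 + 128 / sqrt K) * (D powr (1/3) * L powr (2/3)) + (8 + 128 / sqrt K) * (e * sqrt L)"
      using K e L by (intro add_left_mono mult_right_mono mult_nonneg_nonneg)
        (auto intro!: add_increasing divide_right_mono)
    finally show ?thesis using x[OF \<delta>] by (simp add: algebra_simps)
  next
    case True
    \<comment> \<open>For \<open>D = 0\<close> the balanced scale would be 0, which is not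
      admissible; an arbitrarily small one is used instead.\<close>
    have "x \<le> 32 / sqrt K * (e * sqrt L) + \<eta>" if \<eta>: "0 < \<eta>" for \<eta>
    proof -
      define \<delta> where "\<delta> = \<eta> / (128 / sqrt K * sqrt L)"
      have "0 < \<delta>" using \<eta> K L by (simp add: \<delta>_def)
      from x[OF this] have "x \<le> 32 / sqrt K * ((4 * \<delta> + e) * sqrt L)"
        using True by (simp add: err_def)
      also have "\<dots> = 32 / sqrt K * (e * sqrt L) + \<delta> * (128 / sqrt K * sqrt L)"
        by (simp add: algebra_simps)
      also have "\<delta> * (128 / sqrt K * sqrt L) = \<eta>"
        using K L by (simp add: \<delta>_def)
      finally show ?thesis .
    qed
    then have "x \<le> 32 / sqrt K * (e * sqrt L)"
      by (rule field_le_epsilon)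
    also have "\<dots> \<le> (8 + 128 / sqrt K) * (e * sqrt L)"
      using K e L by (intro mult_right_mono mult_nonneg_nonneg)
        (auto intro!: add_increasing divide_right_mono)
    finally show ?thesis using True by simp
  qed
  show ?upper
    using lim[of "PB c - PA (\<lambda>i. c i - e)"] up unfolding PA_def PB_def by (simp add: algebra_simps)
  show ?lower
    using lim[of "PA c - PB (\<lambda>i. c i - e)"] lo unfolding PA_def PB_def by (simp add: algebra_simps)
qed

text \<open>Selecting coordinates of the larger product measure gives the smaller one, and
  coordinates outside the image of \<open>f\<close> have coefficient 0. This places two separately
  given Gaussian vectors on disjoint blocks of one space.\<close>

lemma polytope_reindex:
  fixes a :: "'i \<Rightarrow> 'k \<Rightarrow> real" and a' :: "'i \<Rightarrow> 'l \<Rightarrow> real"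
  assumes fin: "finite T" "finite T'" "finite I" and f: "inj_on f T" "f \<in> T \<rightarrow> T'"
    and a': "\<And>i k. i \<in> I \<Longrightarrow> k \<in> T \<Longrightarrow> a' i (f k) = a i k"
      "\<And>i k. i \<in> I \<Longrightarrow> k \<in> T' - f ` T \<Longrightarrow> a' i k = 0"
  shows "\<P>(z in std_gauss T. \<forall>i\<in>I. lin T (a i) z \<le> c i) =
    \<P>(z in std_gauss T'. \<forall>i\<in>I. lin T' (a' i) z \<le> c i)"
proof -
  have eq: "distr (std_gauss T') (std_gauss T) (\<lambda>\<omega>. \<lambda>n\<in>T. \<omega> (f n)) = std_gauss T"
    using f by (intro distr_PiM_reindex prob_space_normal_density) auto
  have [measurable]: "(\<lambda>\<omega>. \<lambda>n\<in>T. \<omega> (f n)) \<in> measurable (std_gauss T') (std_gauss T)"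
    using f by (intro measurable_restrict measurable_component_singleton) auto
  have lin: "lin T' (a' i) z = lin T (a i) (\<lambda>n\<in>T. z (f n))" if "i \<in> I" for i z
  proof -
    have "lin T' (a' i) z = (\<Sum>k\<in>f ` T. a' i k * z k)"
      unfolding lin_def using f a'(2)[OF that] fin
      by (intro sum.mono_neutral_right) auto
    also have "\<dots> = (\<Sum>k\<in>T. a' i (f k) * z (f k))"
      using f by (simp add: sum.reindex)
    finally show ?thesis using a'(1)[OF that] by (simp add: lin_def)
  qed
  have m: "{z \<in> space (std_gauss T). \<forall>i\<in>I. lin T (a i) z \<le> c i} \<in> sets (std_gauss T)"
    using fin by measurable
  show ?thesis
    apply (subst eq[symmetric])
    apply (subst measure_distr)
    using m by (auto simp: lin space_PiM intro!: arg_cong[where f="measure _"])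
qed

lemma bilin_gram:
  assumes "\<And>i j. i \<in> {1..p} \<Longrightarrow> j \<in> {1..p} \<Longrightarrow> \<Sigma> i j = (\<Sum>k\<in>T. M i k * M j k)"
  shows "bilin p \<Sigma> v w = (\<Sum>k\<in>T. (\<Sum>j\<in>{1..p}. v j * M j k) * (\<Sum>j\<in>{1..p}. w j * M j k))"
proof -
  have "bilin p \<Sigma> v w = (\<Sum>i\<in>{1..p}. \<Sum>j\<in>{1..p}. \<Sum>k\<in>T. (v i * M i k) * (w j * M j k))"
    unfolding bilin_def using assms
    by (intro sum.cong refl) (simp add: sum_distrib_left sum_distrib_right mult_ac)
  also have "\<dots> = (\<Sum>k\<in>T. \<Sum>i\<in>{1..p}. \<Sum>j\<in>{1..p}. (v i * M i k) * (w j * M j k))"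
    by (subst sum.swap, subst (2) sum.swap, rule refl)
  finally show ?thesis by (simp add: sum_product)
qed

lemma bilin_diff: "bilin p (mat_diff \<Sigma> \<Sigma>') v w = bilin p \<Sigma> v w - bilin p \<Sigma>' v w"
  by (simp add: bilin_def mat_diff_def algebra_simps sum_subtractf)

declare One_nat_def [simp del]

lemma sets_centered_gaussian:
  assumes "centered_gaussian p \<Sigma> \<mu>"
  shows "sets \<mu> = sets (borel_vec p)" "space \<mu> = vecs p"
  using assms by (auto simp: centered_gaussian_def)

lemma measurable_gaussian_map:
  "(\<lambda>z. \<lambda>j\<in>{1..p}. \<Sum>k\<in>{1..m}. L j k * z k) \<in> measurable (std_gauss {1..m}) (borel_vec p)"
  unfolding borel_vec_def by measurable

lemma prob_space_centered_gaussian: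
  assumes "centered_gaussian p \<Sigma> \<mu>"
  shows "prob_space \<mu>"
proof -
  obtain m :: nat and L where \<mu>: "\<mu> = distr (std_gauss {1..m}) (borel_vec p) (\<lambda>z. \<lambda>j\<in>{1..p}. \<Sum>k\<in>{1..m}. L j k * z k)"
    using assms unfolding centered_gaussian_def by blast
  show ?thesis
    unfolding \<mu> by (intro prob_space.prob_space_distr prob_space_std_gauss measurable_gaussian_map)
qed

lemma measurable_dot [measurable]: "(\<lambda>w. dot p w v) \<in> borel_measurable (borel_vec p)"
  unfolding dot_def borel_vec_def by measurable

text \<open>\<open>centered_gaussian\<close> asserts only that some factor exists; the Gram identity
  and the polytope probabilities have to refer to the same one.\<close>

lemma centered_gaussian_polytope:
  assumes "centered_gaussian p \<Sigma> \<mu>"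
  obtains m L where "\<And>i j. i \<in> {1..p} \<Longrightarrow> j \<in> {1..p} \<Longrightarrow> \<Sigma> i j = (\<Sum>k\<in>{1..m::nat}. L i k * L j k)"
    and "\<And>(I :: 'i set) v b. finite I \<Longrightarrow> measure \<mu> {w \<in> vecs p. \<forall>i\<in>I. dot p w (v i) \<le> b i} =
      measure (std_gauss {1..m})
        {z \<in> space (std_gauss {1..m}). \<forall>i\<in>I. lin {1..m} (\<lambda>k. \<Sum>j\<in>{1..p}. v i j * L j k) z \<le> b i}"
proof -
  from assms obtain m L where L: "\<And>i j. i \<in> {1..p} \<Longrightarrow> j \<in> {1..p} \<Longrightarrow> \<Sigma> i j = (\<Sum>k\<in>{1..m::nat}. L i k * L j k)"
    and \<mu>: "\<mu> = distr (std_gauss {1..m}) (borel_vec p) (\<lambda>z. \<lambda>j\<in>{1..p}. \<Sum>k\<in>{1..m}. L j k * z k)"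
    by (auto simp: centered_gaussian_def)
  note [measurable] = measurable_gaussian_map[where m=m and L=L and p=p]
  have dot: "dot p (\<lambda>j\<in>{1..p}. \<Sum>k\<in>{1..m}. L j k * z k) v = lin {1..m} (\<lambda>k. \<Sum>j\<in>{1..p}. v j * L j k) z" for v z
  proof -
    have "dot p (\<lambda>j\<in>{1..p}. \<Sum>k\<in>{1..m}. L j k * z k) v = (\<Sum>j\<in>{1..p}. \<Sum>k\<in>{1..m}. v j * L j k * z k)"
      unfolding dot_def by (intro sum.cong) (auto simp: sum_distrib_left sum_distrib_right mult_ac)
    then show ?thesis
      unfolding lin_def sum_distrib_right by (subst (asm) sum.swap)
  qed
  have "measure \<mu> {w \<in> vecs p. \<forall>i\<in>I. dot p w (v i) \<le> b i} =
      measure (std_gauss {1..m})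
        {z \<in> space (std_gauss {1..m}). \<forall>i\<in>I. lin {1..m} (\<lambda>k. \<Sum>j\<in>{1..p}. v i j * L j k) z \<le> b i}"
    if "finite I" for I :: "'i set" and v b
  proof -
    have m: "{w \<in> vecs p. \<forall>i\<in>I. dot p w (v i) \<le> b i} \<in> sets (borel_vec p)"
      using that by measurable
    show ?thesis
      unfolding \<mu> using m measurable_space[OF measurable_gaussian_map[where m=m and L=L and p=p]]
      by (subst measure_distr) (auto simp: dot intro!: arg_cong[where f="measure _"])
  qed
  with L show thesis by (rule that)
qed

text \<open>The common interface for the three classes. Rectangles take \<open>e = 0\<close> and the
  whole space for \<open>X\<close>, simple convex sets take \<open>e = a / n\<close>, and sparsely
  convex sets take \<open>e = 1 / n\<close> with a box for \<open>X\<close>. Passing between the set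
  and its polytopes costs \<eta> once from above and once from below.\<close>

lemma gaussian_comparison:
  fixes v :: "'i \<Rightarrow> rvec"
  assumes \<mu>: "centered_gaussian p \<Sigma> \<mu>" and \<nu>: "centered_gaussian p \<Sigma>' \<nu>"
    and fin: "finite I" "I \<noteq> {}"
    and L: "1 \<le> L" "real (card I) \<le> exp L"
    and K: "0 < K" "\<And>i. i \<in> I \<Longrightarrow> K \<le> bilin p \<Sigma> (v i) (v i)"
    and D: "\<And>i j. i \<in> I \<Longrightarrow> j \<in> I \<Longrightarrow> \<bar>bilin p (mat_diff \<Sigma>' \<Sigma>) (v i) (v j)\<bar> \<le> D"
    and e: "0 \<le> e"
    and A: "A \<in> sets (borel_vec p)" and X: "X \<in> sets (borel_vec p)"
    and upper: "\<And>w i. w \<in> A \<Longrightarrow> w \<in> X \<Longrightarrow> i \<in> I \<Longrightarrow> dot p w (v i) \<le> b i"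
    and lower: "\<And>w. w \<in> X \<Longrightarrow> (\<And>i. i \<in> I \<Longrightarrow> dot p w (v i) \<le> b i - e) \<Longrightarrow> w \<in> A"
    and \<eta>: "measure \<mu> (vecs p - X) \<le> \<eta>" "measure \<nu> (vecs p - X) \<le> \<eta>"
  shows "\<bar>measure \<mu> A - measure \<nu> A\<bar> \<le>
    (8 + 128 / sqrt K) * (e * sqrt L + D powr (1/3) * L powr (2/3)) + 2 * \<eta>"
proof -
  obtain m1 L1 where L1: "\<And>i j. i \<in> {1..p} \<Longrightarrow> j \<in> {1..p} \<Longrightarrow> \<Sigma> i j = (\<Sum>k\<in>{1..m1::nat}. L1 i k * L1 j k)"
    and \<mu>_poly: "\<And>(I :: 'i set) v b. finite I \<Longrightarrow> measure \<mu> {w \<in> vecs p. \<forall>i\<in>I. dot p w (v i) \<le> b i} =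
      measure (std_gauss {1..m1})
        {z \<in> space (std_gauss {1..m1}). \<forall>i\<in>I. lin {1..m1} (\<lambda>k. \<Sum>j\<in>{1..p}. v i j * L1 j k) z \<le> b i}"
    by (rule centered_gaussian_polytope[OF \<mu>]) (rule that; assumption)
  obtain m2 L2 where L2: "\<And>i j. i \<in> {1..p} \<Longrightarrow> j \<in> {1..p} \<Longrightarrow> \<Sigma>' i j = (\<Sum>k\<in>{1..m2::nat}. L2 i k * L2 j k)"
    and \<nu>_poly: "\<And>(I :: 'i set) v b. finite I \<Longrightarrow> measure \<nu> {w \<in> vecs p. \<forall>i\<in>I. dot p w (v i) \<le> b i} =
      measure (std_gauss {1..m2})
        {z \<in> space (std_gauss {1..m2}). \<forall>i\<in>I. lin {1..m2} (\<lambda>k. \<Sum>j\<in>{1..p}. v i j * L2 j k) z \<le> b i}"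
    by (rule centered_gaussian_polytope[OF \<nu>]) (rule that; assumption)
  define M1 where "M1 i k = (\<Sum>j\<in>{1..p}. v i j * L1 j k)" for i k
  define M2 where "M2 i k = (\<Sum>j\<in>{1..p}. v i j * L2 j k)" for i k
  define T where "T = {1..m1 + m2}"
  \<comment> \<open>The first \<open>m1\<close> coordinates carry \<mu> and the next
    \<open>m2\<close> carry \<nu>, so the two families of forms are independent.\<close>
  define A1 where "A1 i k = (if k \<le> m1 then M1 i k else 0)" for i k
  define A2 where "A2 i k = (if k \<le> m1 then 0 else M2 i (k - m1))" for i k
  have T: "finite T" by (simp add: T_def)
  have s1: "(\<Sum>k\<in>T. A1 i k * A1 j k) = bilin p \<Sigma> (v i) (v j)" for i j
  proof -
    have "(\<Sum>k\<in>T. A1 i k * A1 j k) = (\<Sum>k\<in>{1..m1}. M1 i k * M1 j k)"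
      by (rule sum.mono_neutral_cong_right) (auto simp: T_def A1_def)
    then show ?thesis using bilin_gram[OF L1] by (simp add: M1_def)
  qed
  have s2: "(\<Sum>k\<in>T. A2 i k * A2 j k) = bilin p \<Sigma>' (v i) (v j)" for i j
  proof -
    have "(\<Sum>k\<in>T. A2 i k * A2 j k) = (\<Sum>k\<in>(\<lambda>k. k + m1) ` {1..m2}. A2 i k * A2 j k)"
      by (rule sum.mono_neutral_right) (auto simp: T_def A2_def image_iff intro: le_add_diff_inverse2[symmetric])
    also have "\<dots> = (\<Sum>k\<in>{1..m2}. M2 i k * M2 j k)"
      by (subst sum.reindex) (auto simp: A2_def intro!: sum.cong)
    finally show ?thesis using bilin_gram[OF L2] by (simp add: M2_def)
  qed
  have \<mu>_eq: "measure \<mu> {w \<in> vecs p. \<forall>i\<in>I. dot p w (v i) \<le> b i} =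
      \<P>(z in std_gauss T. \<forall>i\<in>I. lin T (A1 i) z \<le> b i)" for b
    unfolding \<mu>_poly[OF fin(1)] M1_def[symmetric]
    by (rule polytope_reindex[where f="\<lambda>k. k"]) (use fin in \<open>auto simp: T_def A1_def\<close>)
  have \<nu>_eq: "measure \<nu> {w \<in> vecs p. \<forall>i\<in>I. dot p w (v i) \<le> b i} =
      \<P>(z in std_gauss T. \<forall>i\<in>I. lin T (A2 i) z \<le> b i)" for b
    unfolding \<nu>_poly[OF fin(1)] M2_def[symmetric]
    by (rule polytope_reindex[where f="\<lambda>k. k + m1"])
       (use fin in \<open>auto simp: T_def A2_def image_iff intro: le_add_diff_inverse2[symmetric]\<close>)
  define err where "err = (8 + 128 / sqrt K) * (e * sqrt L + D powr (1/3) * L powr (2/3))"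
  have orth: "(\<Sum>k\<in>T. A1 i k * A2 j k) = 0" for i j
    by (intro sum.neutral) (auto simp: A1_def A2_def)
  have cov: "\<bar>(\<Sum>k\<in>T. A2 i k * A2 j k) - (\<Sum>k\<in>T. A1 i k * A1 j k)\<bar> \<le> D" if "i \<in> I" "j \<in> I" for i j
    using D[OF that] by (simp add: s1 s2 bilin_diff)
  have K': "K \<le> (\<Sum>k\<in>T. (A1 i k)\<^sup>2)" if "i \<in> I" for i
    using K(2)[OF that] by (simp add: s1 power2_eq_square)
  let ?U = "{w \<in> vecs p. \<forall>i\<in>I. dot p w (v i) \<le> b i}"
  let ?Lo = "{w \<in> vecs p. \<forall>i\<in>I. dot p w (v i) \<le> b i - e}"
  note cmp = gaussian_polytope_comparison[OF T fin orth cov L K(1) K' e, folded err_def]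
  have 1: "measure \<nu> ?U \<le> measure \<mu> ?Lo + err"
    unfolding \<mu>_eq \<nu>_eq by (rule cmp(1))
  have 2: "measure \<mu> ?U \<le> measure \<nu> ?Lo + err"
    unfolding \<mu>_eq \<nu>_eq by (rule cmp(2))
  have m: "?U \<in> sets (borel_vec p)" "?Lo \<in> sets (borel_vec p)"
    using fin by measurable
  have sp: "A \<subseteq> vecs p"
    using A sets.sets_into_space by blast
  have up: "measure M A \<le> measure M ?U + \<eta>" and low: "measure M ?Lo \<le> measure M A + \<eta>"
    if M: "prob_space M" "sets M = sets (borel_vec p)" "measure M (vecs p - X) \<le> \<eta>" for M
  proof -
    interpret prob_space M by fact
    have Xc: "vecs p - X \<in> sets M" using X M by auto
    have "measure M A \<le> measure M (?U \<union> (vecs p - X))"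
      using upper sp m Xc M by (intro finite_measure_mono) auto
    also have "\<dots> \<le> measure M ?U + measure M (vecs p - X)"
      using m Xc M by (intro measure_Un_le) auto
    finally show "measure M A \<le> measure M ?U + \<eta>" using M by simp
    have "measure M ?Lo \<le> measure M (A \<union> (vecs p - X))"
      using lower A Xc M by (intro finite_measure_mono) auto
    also have "\<dots> \<le> measure M A + measure M (vecs p - X)"
      using A Xc M by (intro measure_Un_le) auto
    finally show "measure M ?Lo \<le> measure M A + \<eta>" using M by simp
  qed
  note sets = sets_centered_gaussian(1)[OF \<mu>] sets_centered_gaussian(1)[OF \<nu>]
  note prob = prob_space_centered_gaussian[OF \<mu>] prob_space_centered_gaussian[OF \<nu>]
  have "measure \<mu> A \<le> measure \<nu> A + err + 2 * \<eta>" "measure \<nu> A \<le> measure \<mu> A + err + 2 * \<eta>"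
    using up[OF prob(1) sets(1) \<eta>(1)] low[OF prob(1) sets(1) \<eta>(1)]
      up[OF prob(2) sets(2) \<eta>(2)] low[OF prob(2) sets(2) \<eta>(2)] 1 2 by linarith+
  then show ?thesis by (simp add: err_def abs_le_iff)
qed

text \<open>Exponential moments at scale \<sigma> combined with \<open>x \<le> exp x\<close>. Decay
  like \<open>1 / R\<close> suffices, as the box may have polynomial size. Only an upper bound
  \<sigma> for the standard deviation enters, so degenerate laws are covered.\<close>

lemma gaussian_coord_tail:
  assumes \<mu>: "centered_gaussian p \<Sigma> \<mu>" and j: "j \<in> {1..p}"
    and \<sigma>: "0 < \<sigma>" "\<Sigma> j j \<le> \<sigma>\<^sup>2" and R: "0 < R"
  shows "measure \<mu> {w \<in> vecs p. R < \<bar>w j\<bar>} \<le> 4 * \<sigma> / R"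
proof -
  obtain m L where L: "\<And>i j. i \<in> {1..p} \<Longrightarrow> j \<in> {1..p} \<Longrightarrow> \<Sigma> i j = (\<Sum>k\<in>{1..m::nat}. L i k * L j k)"
    and \<mu>_eq: "\<mu> = distr (std_gauss {1..m}) (borel_vec p) (\<lambda>z. \<lambda>j\<in>{1..p}. \<Sum>k\<in>{1..m}. L j k * z k)"
    using \<mu> by (auto simp: centered_gaussian_def)
  note [measurable] = measurable_gaussian_map[where m=m and L=L and p=p]
  interpret prob_space "std_gauss {1..m}" by (rule prob_space_std_gauss)
  have mj [measurable]: "(\<lambda>w. w j) \<in> borel_measurable (borel_vec p)"
    using j unfolding borel_vec_def by measurable
  define Y where "Y = lin {1..m} (L j)"
  have Ym [measurable]: "Y \<in> borel_measurable (std_gauss {1..m})" by (simp add: Y_def measurable_lin)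
  have "{w \<in> vecs p. R < \<bar>w j\<bar>} \<in> sets (borel_vec p)" by measurable
  then have "measure \<mu> {w \<in> vecs p. R < \<bar>w j\<bar>} = prob {z \<in> space (std_gauss {1..m}). R < \<bar>Y z\<bar>}"
    unfolding \<mu>_eq using j measurable_space[OF measurable_gaussian_map[where m=m and L=L and p=p]]
    by (subst measure_distr) (auto simp: Y_def lin_def intro!: arg_cong[where f="measure _"])
  also have "\<dots> = (\<integral>z. indicator {z \<in> space (std_gauss {1..m}). R < \<bar>Y z\<bar>} z \<partial>std_gauss {1..m})"
    by simp
  also have "\<dots> \<le> (\<integral>z. (exp (1 / \<sigma> * Y z) + exp (- 1 / \<sigma> * Y z)) * (\<sigma> / R) \<partial>std_gauss {1..m})"
  proof (rule integral_mono)
    show "integrable (std_gauss {1..m}) (indicat_real {z \<in> space (std_gauss {1..m}). R < \<bar>Y z\<bar>})"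
      by (simp add: emeasure_eq_measure)
    have "integrable (std_gauss {1..m}) (\<lambda>z. exp (c * Y z))" for c
      using exp_linear_std_gauss(1)[of "{1..m}" "\<lambda>k. c * L j k"]
      by (simp add: Y_def lin_def sum_distrib_left mult.assoc)
    then show "integrable (std_gauss {1..m}) (\<lambda>z. (exp (1 / \<sigma> * Y z) + exp (- 1 / \<sigma> * Y z)) * (\<sigma> / R))"
      by (intro integrable_mult_left Bochner_Integration.integrable_add)
    fix z
    show "indicat_real {z \<in> space (std_gauss {1..m}). R < \<bar>Y z\<bar>} z \<le>
      (exp (1 / \<sigma> * Y z) + exp (- 1 / \<sigma> * Y z)) * (\<sigma> / R)"
    proof (cases "R < \<bar>Y z\<bar>")
      case True
      have "R / \<sigma> \<le> \<bar>Y z\<bar> / \<sigma>" using True \<sigma> by (simp add: divide_right_mono)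
      also have "\<dots> \<le> exp (\<bar>Y z\<bar> / \<sigma>)"
        using exp_ge_add_one_self[of "\<bar>Y z\<bar> / \<sigma>"] by linarith
      also have "\<dots> \<le> exp (1 / \<sigma> * Y z) + exp (- 1 / \<sigma> * Y z)"
        by (cases "0 \<le> Y z") auto
      finally have "R / \<sigma> * (\<sigma> / R) \<le> (exp (1 / \<sigma> * Y z) + exp (- 1 / \<sigma> * Y z)) * (\<sigma> / R)"
        using \<sigma> R by (intro mult_right_mono) auto
      then have "1 \<le> (exp (1 / \<sigma> * Y z) + exp (- 1 / \<sigma> * Y z)) * (\<sigma> / R)"
        using \<sigma> R by simp
      then show ?thesis using indicator_le_1 order_trans by blast
    next
      case False
      then show ?thesis using \<sigma> R by (simp add: add_nonneg_nonneg)
    qed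
  qed
  also have "\<dots> = 2 * exp (\<Sigma> j j * (1 / \<sigma>)\<^sup>2 / 2) * (\<sigma> / R)"
  proof -
    have E: "integrable (std_gauss {1..m}) (\<lambda>z. exp (c * Y z))"
      "(\<integral>z. exp (c * Y z) \<partial>std_gauss {1..m}) = exp (\<Sigma> j j * c\<^sup>2 / 2)" for c
    proof -
      have "(\<Sum>k\<in>{1..m}. (c * L j k)\<^sup>2) = \<Sigma> j j * c\<^sup>2"
        unfolding L[OF j j] sum_distrib_right by (simp add: power2_eq_square mult_ac)
      then show "integrable (std_gauss {1..m}) (\<lambda>z. exp (c * Y z))"
        "(\<integral>z. exp (c * Y z) \<partial>std_gauss {1..m}) = exp (\<Sigma> j j * c\<^sup>2 / 2)"
        using exp_linear_std_gauss[of "{1..m}" "\<lambda>k. c * L j k"]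
        by (simp_all add: Y_def lin_def sum_distrib_left mult.assoc)
    qed
    show ?thesis
      using E[of "1 / \<sigma>"] E[of "- 1 / \<sigma>"] by simp
  qed
  also have "\<dots> \<le> 2 * 2 * (\<sigma> / R)"
  proof -
    have "\<Sigma> j j * (1 / \<sigma>)\<^sup>2 \<le> 1"
      using \<sigma> by (simp add: power_divide)
    then have "exp (\<Sigma> j j * (1 / \<sigma>)\<^sup>2 / 2) \<le> exp (1 / 2)" by simp
    also have "\<dots> \<le> 2" using exp_half_le2 by simp
    finally show ?thesis using \<sigma> R by (intro mult_right_mono mult_left_mono) auto
  qed
  finally show ?thesis by simp
qed

section \<open>Reduction to Gaussian comparison\<close>

text \<open>In the case \<open>b n = 0\<close> the inequality forces \<open>a n = 0\<close>, and the
  quotient is then 0 by the convention for \<open>0 / 0\<close>.\<close>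

lemma asymp_leI:
  assumes "\<forall>\<^sub>F n in sequentially. 0 \<le> a n \<and> 0 \<le> b n \<and> a n \<le> c * b n" "0 \<le> c"
  shows "asymp_le c a b"
  unfolding asymp_le_def
proof (rule Limsup_bounded)
  show "\<forall>\<^sub>F n in sequentially. ereal (a n) / ereal (b n) \<le> ereal c"
    using assms(1)
  proof eventually_elim
    case (elim n)
    show ?case
    proof (cases "b n = 0")
      case True
      then have "a n = 0" using elim by auto
      then show ?thesis using True assms(2) by (simp add: divide_ereal_def)
    next
      case False
      then have "0 < b n" using elim by auto
      then show ?thesis using elim by (simp add: divide_le_eq)
    qed
  qed
qed

lemma eventually_ln_ge:
  assumes "0 < \<kappa>" "\<And>n. 1 \<le> n \<Longrightarrow> real n powr \<kappa> \<le> real (p n)"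
  shows "\<forall>\<^sub>F n in sequentially. C \<le> ln (real (p n))"
proof -
  have "filterlim (\<lambda>n. \<kappa> * ln (real n)) at_top sequentially"
    using assms(1) by real_asymp
  then have "\<forall>\<^sub>F n in sequentially. C \<le> \<kappa> * ln (real n)"
    by (simp add: filterlim_at_top)
  then show ?thesis
    using eventually_ge_at_top[of 1]
  proof eventually_elim
    case (elim n)
    have "\<kappa> * ln (real n) = ln (real n powr \<kappa>)" using elim by (simp add: ln_powr)
    also have "\<dots> \<le> ln (real (p n))"
      using assms(2)[OF elim(2)] elim by (intro ln_mono) auto
    finally show ?case using elim by linarith
  qed
qed

text \<open>Turns logarithms of \<open>n\<close> into logarithms of \<open>p\<close>; this is how
  \<kappa> enters the constants.\<close>

lemma ln_le_ln_dim:
  assumes "0 < \<kappa>" "1 \<le> n" "real n powr \<kappa> \<le> real p"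
  shows "ln (real n) \<le> ln (real p) / \<kappa>"
proof -
  have "\<kappa> * ln (real n) = ln (real n powr \<kappa>)" using assms by (simp add: ln_powr)
  also have "\<dots> \<le> ln (real p)" using assms by (intro ln_mono) auto
  finally show ?thesis using assms by (simp add: field_simps)
qed

text \<open>For exponents up to one, a factor \<open>C\<close> at least one comes out as at most
  \<open>C\<close>, so the same constant serves the powers 1/2 and 2/3.\<close>

lemma powr_le_scaled:
  fixes x y C r :: real
  assumes "0 \<le> x" "x \<le> C * y" "1 \<le> C" "0 \<le> y" "0 \<le> r" "r \<le> 1"
  shows "x powr r \<le> C * y powr r"
proof -
  have "x powr r \<le> (C * y) powr r" using assms by (intro powr_mono2) auto
  also have "\<dots> = C powr r * y powr r" using assms by (simp add: powr_mult)
  also have "\<dots> \<le> C powr 1 * y powr r" using assms by (intro mult_right_mono powr_mono) auto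
  finally show ?thesis using assms by simp
qed

lemma sup_nonneg_upper:
  assumes "bdd_above S" shows "x \<in> S \<Longrightarrow> x \<le> sup_nonneg S" "0 \<le> sup_nonneg S"
  using assms by (auto simp: sup_nonneg_def intro!: cSup_upper)

lemma sup_nonneg_least: "0 \<le> b \<Longrightarrow> (\<And>x. x \<in> S \<Longrightarrow> x \<le> b) \<Longrightarrow> sup_nonneg S \<le> b"
  unfolding sup_nonneg_def by (intro cSup_least) auto

lemma class_dist_bounds:
  assumes "prob_space \<mu>" "prob_space \<nu>"
  shows "A \<in> \<A> \<Longrightarrow> \<bar>measure \<mu> A - measure \<nu> A\<bar> \<le> class_dist \<A> \<mu> \<nu>" and "0 \<le> class_dist \<A> \<mu> \<nu>"
proof -
  have "\<bar>measure \<mu> A - measure \<nu> A\<bar> \<le> 1" for A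
    using prob_space.prob_le_1[OF assms(1), of A] prob_space.prob_le_1[OF assms(2), of A]
      measure_nonneg[of \<mu> A] measure_nonneg[of \<nu> A] by linarith
  then have "bdd_above ((\<lambda>A. \<bar>measure \<mu> A - measure \<nu> A\<bar>) ` \<A>)"
    by (intro bdd_aboveI2)
  then show "A \<in> \<A> \<Longrightarrow> \<bar>measure \<mu> A - measure \<nu> A\<bar> \<le> class_dist \<A> \<mu> \<nu>" "0 \<le> class_dist \<A> \<mu> \<nu>"
    unfolding class_dist_def by (auto intro: sup_nonneg_upper)
qed

lemma class_dist_triangle:
  assumes P: "prob_space P" "prob_space \<mu>" "prob_space \<nu>"
    and "0 \<le> e" "\<And>A. A \<in> \<A> \<Longrightarrow> \<bar>measure \<mu> A - measure \<nu> A\<bar> \<le> e"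
  shows "class_dist \<A> P \<nu> \<le> class_dist \<A> P \<mu> + e"
  unfolding class_dist_def[of _ _ \<nu>]
proof (rule sup_nonneg_least)
  show "0 \<le> class_dist \<A> P \<mu> + e" using class_dist_bounds(2)[OF P(1,2)] assms by simp
  fix x assume "x \<in> (\<lambda>A. \<bar>measure P A - measure \<nu> A\<bar>) ` \<A>"
  then obtain A where "A \<in> \<A>" "x = \<bar>measure P A - measure \<nu> A\<bar>" by auto
  then show "x \<le> class_dist \<A> P \<mu> + e"
    using class_dist_bounds(1)[OF P(1,2), of A \<A>] assms(5)[of A] by linarith
qed

section \<open>One row of the array at a fixed realization\<close>

lemma variance_linear:
  fixes S :: "'w \<Rightarrow> nat \<Rightarrow> real"
  assumes M: "prob_space M" and J: "finite J"
    and meas: "\<And>j. j \<in> J \<Longrightarrow> (\<lambda>\<omega>. S \<omega> j) \<in> borel_measurable M"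
    and sq: "\<And>j. j \<in> J \<Longrightarrow> integrable M (\<lambda>\<omega>. (S \<omega> j)\<^sup>2)"
  shows "prob_space.variance M (\<lambda>\<omega>. \<Sum>j\<in>J. v j * S \<omega> j) = (\<Sum>i\<in>J. \<Sum>j\<in>J. v i * cov_mat M S i j * v j)"
proof -
  interpret prob_space M by fact
  have int: "integrable M (\<lambda>\<omega>. S \<omega> j)" if "j \<in> J" for j
    using square_integrable_imp_integrable[OF meas[OF that] sq[OF that]] .
  define C where "C j \<omega> = S \<omega> j - expectation (\<lambda>\<omega>. S \<omega> j)" for j \<omega>
  have Csq: "integrable M (\<lambda>\<omega>. (C j \<omega>)\<^sup>2)" if "j \<in> J" for j
    unfolding C_def power2_diff using int[OF that] sq[OF that] by auto
  have Cm: "(\<lambda>\<omega>. C j \<omega>) \<in> borel_measurable M" if "j \<in> J" for j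
    unfolding C_def using meas[OF that] by measurable
  have prod: "integrable M (\<lambda>\<omega>. C i \<omega> * C j \<omega>)" if "i \<in> J" "j \<in> J" for i j
  proof (rule Bochner_Integration.integrable_bound)
    show "integrable M (\<lambda>\<omega>. (C i \<omega>)\<^sup>2 + (C j \<omega>)\<^sup>2)"
      using Csq that by auto
    show "(\<lambda>\<omega>. C i \<omega> * C j \<omega>) \<in> borel_measurable M"
      using Cm[OF that(1)] Cm[OF that(2)] by measurable
    show "AE \<omega> in M. norm (C i \<omega> * C j \<omega>) \<le> norm ((C i \<omega>)\<^sup>2 + (C j \<omega>)\<^sup>2)"
    proof (intro AE_I2)
      fix \<omega>
      have "2 * (\<bar>C i \<omega>\<bar> * \<bar>C j \<omega>\<bar>) \<le> (C i \<omega>)\<^sup>2 + (C j \<omega>)\<^sup>2"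
        using sum_squares_bound[of "\<bar>C i \<omega>\<bar>" "\<bar>C j \<omega>\<bar>"] by (simp add: mult.assoc)
      moreover have "0 \<le> \<bar>C i \<omega>\<bar> * \<bar>C j \<omega>\<bar>" by simp
      ultimately show "norm (C i \<omega> * C j \<omega>) \<le> norm ((C i \<omega>)\<^sup>2 + (C j \<omega>)\<^sup>2)"
        by (simp only: real_norm_def abs_mult)
    qed
  qed
  have E: "expectation (\<lambda>\<omega>. \<Sum>j\<in>J. v j * S \<omega> j) = (\<Sum>j\<in>J. v j * expectation (\<lambda>\<omega>. S \<omega> j))"
    using int by (subst Bochner_Integration.integral_sum) auto
  have "variance (\<lambda>\<omega>. \<Sum>j\<in>J. v j * S \<omega> j) = expectation (\<lambda>\<omega>. (\<Sum>j\<in>J. v j * C j \<omega>)\<^sup>2)"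
    unfolding E C_def by (simp add: sum_subtractf right_diff_distrib)
  also have "\<dots> = expectation (\<lambda>\<omega>. \<Sum>i\<in>J. \<Sum>j\<in>J. v i * v j * (C i \<omega> * C j \<omega>))"
    by (simp add: power2_eq_square sum_product mult_ac)
  also have "\<dots> = (\<Sum>i\<in>J. \<Sum>j\<in>J. v i * v j * expectation (\<lambda>\<omega>. C i \<omega> * C j \<omega>))"
    using prod by (simp add: Bochner_Integration.integral_sum Bochner_Integration.integrable_sum)
  also have "\<dots> = (\<Sum>i\<in>J. \<Sum>j\<in>J. v i * cov_mat M S i j * v j)"
    by (simp add: cov_mat_def C_def mult_ac)
  finally show ?thesis .
qed

text \<open>With \<omega> fixed, the estimator is a fixed matrix, and \<open>G\<close> and
  \<open>Ghat\<close> give two fixed Gaussian laws. Bounds proved here hold for every row and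
  realization, hence along every sequence of realizations.\<close>

locale array_row =
  fixes \<kappa> :: real and n p :: nat and M :: "'w measure" and X :: "nat \<Rightarrow> 'w \<Rightarrow> rvec"
    and Xihat :: "(nat \<Rightarrow> rvec) \<Rightarrow> rmat" and G :: "rvec measure" and Ghat :: "(nat \<Rightarrow> rvec) \<Rightarrow> rvec measure"
    and \<omega> :: 'w
  assumes n: "1 \<le> n" and np: "real n powr \<kappa> \<le> real p" and M: "prob_space M"
    and X: "\<And>t. t \<in> {1..n} \<Longrightarrow> X t \<in> measurable M (borel_vec p)"
    and X_int: "\<And>t j. t \<in> {1..n} \<Longrightarrow> j \<in> {1..p} \<Longrightarrow> integrable M (\<lambda>\<omega>. X t \<omega> j)"
    and S_sq: "\<And>j. j \<in> {1..p} \<Longrightarrow> integrable M (\<lambda>\<omega>. (nsum n X p \<omega> j)\<^sup>2)"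
    and G: "centered_gaussian p (cov_mat M (nsum n X p)) G"
    and Ghat: "centered_gaussian p (Xihat (sample n X \<omega>)) (Ghat (sample n X \<omega>))"
begin

abbreviation "\<Xi> \<equiv> cov_mat M (nsum n X p)"
abbreviation "\<Xi>h \<equiv> Xihat (sample n X \<omega>)"
abbreviation "\<Delta> \<equiv> Delta_r n M p X Xihat \<omega>"
abbreviation "gap A \<equiv> \<bar>measure G A - measure (Ghat (sample n X \<omega>)) A\<bar>"

lemma p_ge_1: "1 \<le> p"
proof -
  have "0 < real n powr \<kappa>" using n by simp
  then show ?thesis using np by (cases p) auto
qed

lemma measurable_nsum: "nsum n X p \<in> measurable M (borel_vec p)"
proof -
  have "(\<lambda>\<omega>. X t \<omega> j) \<in> borel_measurable M" if "t \<in> {1..n}" "j \<in> {1..p}" for t j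
    using X_int[OF that] by auto
  then show ?thesis
    unfolding nsum_def[abs_def] borel_vec_def by measurable
qed

lemma measurable_nsum_coord: "j \<in> {1..p} \<Longrightarrow> (\<lambda>\<omega>. nsum n X p \<omega> j) \<in> borel_measurable M"
  using measurable_nsum unfolding borel_vec_def by measurable

lemma proj_var_eq: "proj_var n M X p v = bilin p \<Xi> v v"
proof -
  have "(\<Sum>t\<in>{1..n}. dot p v (X t \<omega>)) / sqrt (real n) = (\<Sum>j\<in>{1..p}. v j * nsum n X p \<omega> j)" for \<omega>
  proof -
    have "(\<Sum>t\<in>{1..n}. dot p v (X t \<omega>)) = (\<Sum>j\<in>{1..p}. v j * (\<Sum>t\<in>{1..n}. X t \<omega> j))"
      unfolding dot_def sum_distrib_left by (rule sum.swap)
    moreover have "(\<Sum>j\<in>{1..p}. v j * nsum n X p \<omega> j) =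
        (\<Sum>j\<in>{1..p}. v j * (\<Sum>t\<in>{1..n}. X t \<omega> j) / sqrt (real n))"
      by (intro sum.cong) (auto simp: nsum_def)
    ultimately show "(\<Sum>t\<in>{1..n}. dot p v (X t \<omega>)) / sqrt (real n) = (\<Sum>j\<in>{1..p}. v j * nsum n X p \<omega> j)"
      by (simp only: sum_divide_distrib)
  qed
  then show ?thesis
    unfolding proj_var_def bilin_def
    using variance_linear[OF M, of "{1..p}" "nsum n X p" v] measurable_nsum_coord S_sq
    by (simp only: finite_atLeastAtMost)
qed

lemma variance_coord_eq:
  assumes "j \<in> {1..p}"
  shows "prob_space.variance M (\<lambda>\<omega>. (\<Sum>t\<in>{1..n}. X t \<omega> j) / sqrt (real n)) = \<Xi> j j"
proof -
  have "(\<Sum>t\<in>{1..n}. X t \<omega> j) / sqrt (real n) = nsum n X p \<omega> j" for \<omega>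
    using assms by (simp add: nsum_def)
  then show ?thesis by (simp only: cov_mat_def power2_eq_square)
qed

lemma prob_spaces:
  "prob_space (distr M (borel_vec p) (nsum n X p))" "prob_space G" "prob_space (Ghat (sample n X \<omega>))"
  using prob_space.prob_space_distr[OF M measurable_nsum] prob_space_centered_gaussian[OF G]
    prob_space_centered_gaussian[OF Ghat] by auto

lemma rho_hat_le:
  assumes "0 \<le> e" "\<And>A. A \<in> \<A> \<Longrightarrow> gap A \<le> e"
  shows "rho_hat n M p X Ghat \<A> \<omega> \<le> rho n M p X G \<A> + e"
  unfolding rho_hat_def rho_def by (intro class_dist_triangle prob_spaces assms)

lemma rho_nonneg: "0 \<le> rho n M p X G \<A>" "0 \<le> rho_hat n M p X Ghat \<A> \<omega>"
  unfolding rho_hat_def rho_def by (intro class_dist_bounds prob_spaces)+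

lemma Xi_err_eq: "Xi_err n M p X Xihat \<omega> = mat_diff \<Xi>h \<Xi>"
  by (simp add: Xi_err_def)

lemma Delta_r_ge:
  assumes "i \<in> {1..p}" "j \<in> {1..p}"
  shows "\<bar>mat_diff \<Xi>h \<Xi> i j\<bar> \<le> \<Delta>"
  unfolding Delta_r_def Xi_err_eq max_entry_def
  using assms by (intro Max_ge) (auto intro: rev_image_eqI[of "(i, j)"])

lemma Delta_r_nonneg: "0 \<le> \<Delta>"
  using Delta_r_ge[of 1 1] p_ge_1 by force

end

lemma array_setting_row:
  assumes "array_setting \<kappa> M p X Xihat G Ghat" "1 \<le> n" "\<omega> \<in> space (M n)"
  shows "array_row \<kappa> n (p n) (M n) (X n) (Xihat n) (G n) (Ghat n) \<omega>"
  using assms unfolding array_setting_def array_row_def by blast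

lemma eventually_array_row:
  assumes "0 < \<kappa>" "array_setting \<kappa> M p X Xihat G Ghat" "\<forall>n\<ge>1. \<omega> n \<in> space (M n)"
  shows "\<forall>\<^sub>F n in sequentially. 1 \<le> n \<and> C \<le> ln (real (p n)) \<and>
    array_row \<kappa> n (p n) (M n) (X n) (Xihat n) (G n) (Ghat n) (\<omega> n)"
proof -
  have "real n powr \<kappa> \<le> real (p n)" if "1 \<le> n" for n
    using assms(2) that by (auto simp: array_setting_def)
  from eventually_ln_ge[OF assms(1) this, where C=C]
  have "\<forall>\<^sub>F n in sequentially. C \<le> ln (real (p n))" by simp
  then show ?thesis
    using eventually_ge_at_top[of 1]
    by eventually_elim (simp add: array_setting_row[OF assms(2)] assms(3))
qed

text \<open>Row by row, \<open>rho_hat \<le> rho + C * Q \<le> (1 + C) * (rho + Q)\<close>. What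
  remains in each part is to compare the two Gaussian laws on single sets.\<close>

lemma rho_hat_asymp:
  assumes "0 < \<kappa>" "array_setting \<kappa> M p X Xihat G Ghat" "\<forall>n\<ge>1. \<omega> n \<in> space (M n)"
    and C: "0 \<le> C"
    and bound: "\<forall>\<^sub>F n in sequentially. 0 \<le> Q n \<and>
      (\<forall>A\<in>\<A> n. \<bar>measure (G n) A - measure (Ghat n (sample n (X n) (\<omega> n))) A\<bar> \<le> C * Q n)"
  shows "asymp_le (1 + C) (\<lambda>n. rho_hat n (M n) (p n) (X n) (Ghat n) (\<A> n) (\<omega> n))
    (\<lambda>n. rho n (M n) (p n) (X n) (G n) (\<A> n) + Q n)"
proof (rule asymp_leI)
  show "\<forall>\<^sub>F n in sequentially. 0 \<le> rho_hat n (M n) (p n) (X n) (Ghat n) (\<A> n) (\<omega> n) \<and>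
      0 \<le> rho n (M n) (p n) (X n) (G n) (\<A> n) + Q n \<and>
      rho_hat n (M n) (p n) (X n) (Ghat n) (\<A> n) (\<omega> n) \<le>
        (1 + C) * (rho n (M n) (p n) (X n) (G n) (\<A> n) + Q n)"
    using bound eventually_array_row[OF assms(1-3), where C=0]
  proof eventually_elim
    case (elim n)
    then interpret array_row \<kappa> n "p n" "M n" "X n" "Xihat n" "G n" "Ghat n" "\<omega> n" by simp
    define r where "r = rho n (M n) (p n) (X n) (G n) (\<A> n)"
    have r: "0 \<le> r" unfolding r_def by (rule rho_nonneg)
    have "rho_hat n (M n) (p n) (X n) (Ghat n) (\<A> n) (\<omega> n) \<le> r + C * Q n"
      unfolding r_def using elim C by (intro rho_hat_le) auto
    also have "\<dots> \<le> (1 + C) * (r + Q n)"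
      using elim mult_nonneg_nonneg[OF C r] by (simp add: algebra_simps)
    finally show ?case
      using rho_nonneg(2) r elim(1) unfolding r_def by simp
  qed
qed (use C in simp)

section \<open>Hyper-rectangles\<close>

lemma bilin_coord:
  assumes "j \<in> {1..p}" "k \<in> {1..p}"
  shows "bilin p \<Sigma> (\<lambda>i. if i = j then s else 0) (\<lambda>i. if i = k then t else 0) = s * \<Sigma> j k * t"
proof -
  have "bilin p \<Sigma> (\<lambda>i. if i = j then s else 0) (\<lambda>i. if i = k then t else 0) =
    (\<Sum>i\<in>{1..p}. \<Sum>l\<in>{1..p}. if i = j then if l = k then s * \<Sigma> i l * t else 0 else 0)"
    unfolding bilin_def by (intro sum.cong) auto
  also have "\<dots> = (\<Sum>i\<in>{1..p}. if i = j then s * \<Sigma> i k * t else 0)"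
    using assms by (intro sum.cong) auto
  also have "\<dots> = s * \<Sigma> j k * t"
    using assms by simp
  finally show ?thesis .
qed

lemma dot_coord:
  "j \<in> {1..p} \<Longrightarrow> dot p w (\<lambda>i. if i = j then s else 0) = s * w j"
proof -
  assume j: "j \<in> {1..p}"
  have "dot p w (\<lambda>i. if i = j then s else 0) = (\<Sum>i\<in>{1..p}. if i = j then s * w i else 0)"
    unfolding dot_def by (intro sum.cong) auto
  then show ?thesis using j by simp
qed

lemma measurable_vec_coord: "j \<in> {1..p} \<Longrightarrow> (\<lambda>w. w j) \<in> borel_measurable (borel_vec p)"
  unfolding borel_vec_def by measurable

lemma sets_hyper_rectangles: "A \<in> hyper_rectangles p \<Longrightarrow> A \<in> sets (borel_vec p)"
proof -
  assume "A \<in> hyper_rectangles p"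
  then obtain a b :: "nat \<Rightarrow> ereal" where
    A: "A = {w \<in> vecs p. \<forall>j\<in>{1..p}. a j \<le> ereal (w j) \<and> ereal (w j) \<le> b j}"
    by (auto simp: hyper_rectangles_def)
  note [measurable] = measurable_vec_coord
  show ?thesis unfolding A by measurable
qed

context array_row
begin

lemma hyper_rectangle_bound:
  assumes A: "A \<in> hyper_rectangles p" and K: "0 < K" "\<And>j. j \<in> {1..p} \<Longrightarrow> K \<le> \<Xi> j j"
  shows "gap A \<le>
    (8 + 128 / sqrt K) * (\<Delta> powr (1/3) * (1 + ln (2 * real p)) powr (2/3))"
    (is "_ \<le> ?bound")
proof -
  obtain a b :: "nat \<Rightarrow> ereal" where
    A_eq: "A = {w \<in> vecs p. \<forall>j\<in>{1..p}. a j \<le> ereal (w j) \<and> ereal (w j) \<le> b j}"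
    using A by (auto simp: hyper_rectangles_def)
  define L where "L = 1 + ln (2 * real p)"
  have L: "1 \<le> L" "exp L \<ge> 2 * real p"
    using p_ge_1 by (auto simp: L_def exp_add)
  have nn: "0 \<le> ?bound" using K by (intro mult_nonneg_nonneg) auto
  \<comment> \<open>One constraint for each side that is not vacuous, hence at most
    \<open>2 * p\<close> of them.\<close>
  define I where "I = {(j, s). j \<in> {1..p} \<and> (if s then b j \<noteq> \<infinity> else a j \<noteq> - \<infinity>)}"
  have Isub: "I \<subseteq> {1..p} \<times> UNIV" by (auto simp: I_def)
  have fin: "finite I" by (rule finite_subset[OF Isub]) auto
  have cI: "real (card I) \<le> exp L"
  proof -
    have "card I \<le> card ({1..p} \<times> (UNIV :: bool set))"
      by (rule card_mono[OF _ Isub]) auto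
    then have "real (card I) \<le> 2 * real p" by (simp add: card_cartesian_product)
    then show ?thesis using L by linarith
  qed
  show ?thesis
  \<comment> \<open>A lower end \<open>\<infinity>\<close> or an upper end
    \<open>- \<infinity>\<close> admits no real vector; \<open>real_of_ereal\<close> would hide this
    by returning 0.\<close>
  proof (cases "(\<exists>j\<in>{1..p}. a j = \<infinity> \<or> b j = - \<infinity>)")
    case True
    then have "A = {}" unfolding A_eq by force
    then show ?thesis using nn by simp
  next
    case fin_ab: False
    show ?thesis
    proof (cases "I = {}")
      case True
      have "A = vecs p"
      proof -
        have "a j = - \<infinity>" "b j = \<infinity>" if "j \<in> {1..p}" for j
          using True that by (auto simp: I_def split: if_splits)
        then show ?thesis by (auto simp: A_eq)
      qed
      then show ?thesis
        using prob_space.prob_space[OF prob_spaces(2)] prob_space.prob_space[OF prob_spaces(3)] nn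
        by (simp add: sets_centered_gaussian(2)[OF G] sets_centered_gaussian(2)[OF Ghat])
    next
      case False
      \<comment> \<open>For signed coordinate vectors the quadratic form of \<Xi> is a diagonal
        entry, and the bilinear form of the covariance error is, up to sign, one of its
        entries.\<close>
      define v :: "nat \<times> bool \<Rightarrow> rvec" where
        "v = (\<lambda>(j, s) i. if i = j then (if s then 1 else - 1) else 0)"
      define c where "c = (\<lambda>(j, s). if s then real_of_ereal (b j) else - real_of_ereal (a j))"
      have bil: "bilin p \<Sigma> (v (j, s)) (v (k, t)) = (if s then 1 else - 1) * \<Sigma> j k * (if t then 1 else - 1)"
        if "j \<in> {1..p}" "k \<in> {1..p}" for \<Sigma> j k s t
        unfolding v_def prod.case by (rule bilin_coord[OF that])
      have dot: "dot p w (v (j, s)) = (if s then 1 else - 1) * w j" if "j \<in> {1..p}" for w j s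
        unfolding v_def prod.case by (rule dot_coord[OF that])
      have bdd: "ereal (w j) \<le> b j \<longleftrightarrow> (b j \<noteq> \<infinity> \<longrightarrow> w j \<le> real_of_ereal (b j))"
        "a j \<le> ereal (w j) \<longleftrightarrow> (a j \<noteq> - \<infinity> \<longrightarrow> - w j \<le> - real_of_ereal (a j))"
        if "j \<in> {1..p}" for w j
        using fin_ab that by (cases "b j"; cases "a j"; force)+
      have all_I: "(\<forall>i\<in>I. Q i) \<longleftrightarrow> (\<forall>j\<in>{1..p}. (a j \<noteq> - \<infinity> \<longrightarrow> Q (j, False)) \<and> (b j \<noteq> \<infinity> \<longrightarrow> Q (j, True)))"
        for Q
        unfolding I_def Ball_def by (simp add: split_paired_All all_bool_eq) blast
      have iff: "w \<in> A \<longleftrightarrow> w \<in> vecs p \<and> (\<forall>i\<in>I. dot p w (v i) \<le> c i)" for w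
      proof -
        have "w \<in> A \<longleftrightarrow> w \<in> vecs p \<and>
          (\<forall>j\<in>{1..p}. (a j \<noteq> - \<infinity> \<longrightarrow> - w j \<le> - real_of_ereal (a j)) \<and> (b j \<noteq> \<infinity> \<longrightarrow> w j \<le> real_of_ereal (b j)))"
          unfolding A_eq using bdd by auto
        also have "\<dots> \<longleftrightarrow> w \<in> vecs p \<and> (\<forall>i\<in>I. dot p w (v i) \<le> c i)"
          unfolding all_I by (auto simp: c_def dot)
        finally show ?thesis .
      qed
      have "gap A \<le>
        (8 + 128 / sqrt K) * (0 * sqrt L + \<Delta> powr (1/3) * L powr (2/3)) + 2 * 0"
      proof (rule gaussian_comparison[OF G Ghat fin False L(1) cI K(1), where v=v and X="vecs p" and b=c])
        show "K \<le> bilin p \<Xi> (v i) (v i)" if "i \<in> I" for i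
          using that K(2) by (cases i) (auto simp: bil I_def)
        show "\<bar>bilin p (mat_diff \<Xi>h \<Xi>) (v i) (v j)\<bar> \<le> \<Delta>" if "i \<in> I" "j \<in> I" for i j
          using that Delta_r_ge by (cases i; cases j) (auto simp: bil I_def)
        show "A \<in> sets (borel_vec p)" using A by (rule sets_hyper_rectangles)
      qed (auto simp: iff)
      then show ?thesis by (simp add: L_def)
    qed
  qed
qed

end

section \<open>Simple convex sets\<close>

lemma unit_sphere_coord: "v \<in> unit_sphere p \<Longrightarrow> j \<in> {1..p} \<Longrightarrow> \<bar>v j\<bar> \<le> 1"
proof -
  assume v: "v \<in> unit_sphere p" and j: "j \<in> {1..p}"
  have "v j * v j \<le> (\<Sum>j\<in>{1..p}. v j * v j)"
    by (rule member_le_sum[OF j]) auto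
  also have "\<dots> = 1" using v by (simp add: unit_sphere_def dot_def)
  finally show ?thesis using abs_square_le_1[of "v j"] by (simp add: power2_eq_square)
qed

lemma abs_bilin_le:
  assumes "\<And>j. j \<in> {1..p} \<Longrightarrow> \<bar>v j\<bar> \<le> 1" "\<And>j. j \<in> {1..p} \<Longrightarrow> \<bar>w j\<bar> \<le> 1"
  shows "\<bar>bilin p D v w\<bar> \<le> (\<Sum>i\<in>{1..p}. \<Sum>j\<in>{1..p}. \<bar>D i j\<bar>)"
  unfolding bilin_def
proof (intro order_trans[OF sum_abs] sum_mono)
  fix i j assume "i \<in> {1..p}" "j \<in> {1..p}"
  then have "\<bar>v i\<bar> * \<bar>D i j\<bar> * \<bar>w j\<bar> \<le> 1 * \<bar>D i j\<bar> * 1"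
    using assms by (intro mult_mono) auto
  then show "\<bar>v i * D i j * w j\<bar> \<le> \<bar>D i j\<bar>" by (simp add: abs_mult)
qed

text \<open>Unit normals have entries of absolute value at most one, so all the bilinear forms are
  bounded by the sum of the \<open>\<bar>D i j\<bar>\<close>; this makes the real supremum an upper
  bound.\<close>

lemma cov_err_ge:
  assumes "\<And>A. A \<in> \<A> \<Longrightarrow> V A \<subseteq> unit_sphere p" "A \<in> \<A>" "v \<in> V A" "w \<in> V A"
  shows "\<bar>bilin p D v w\<bar> \<le> cov_err p D \<A> V"
  unfolding cov_err_def
proof (rule sup_nonneg_upper)
  show "bdd_above {\<bar>bilin p D v1 v2\<bar> |A v1 v2. A \<in> \<A> \<and> v1 \<in> V A \<and> v2 \<in> V A}"
  proof (rule bdd_aboveI)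
    fix x assume "x \<in> {\<bar>bilin p D v1 v2\<bar> |A v1 v2. A \<in> \<A> \<and> v1 \<in> V A \<and> v2 \<in> V A}"
    then obtain A v1 v2 where "A \<in> \<A>" "v1 \<in> V A" "v2 \<in> V A" and x: "x = \<bar>bilin p D v1 v2\<bar>" by blast
    then have "v1 \<in> unit_sphere p" "v2 \<in> unit_sphere p" using assms(1) by blast+
    then show "x \<le> (\<Sum>i\<in>{1..p}. \<Sum>j\<in>{1..p}. \<bar>D i j\<bar>)"
      unfolding x by (intro abs_bilin_le unit_sphere_coord)
  qed
qed (use assms in blast)

context array_row
begin

lemma prob_vecs: "measure G (vecs p) = 1" "measure (Ghat (sample n X \<omega>)) (vecs p) = 1"
  using prob_space.prob_space[OF prob_spaces(2)] prob_space.prob_space[OF prob_spaces(3)]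
  by (simp_all add: sets_centered_gaussian(2)[OF G] sets_centered_gaussian(2)[OF Ghat])

text \<open>The thresholds are the support function plus \<open>a / n\<close>: at this height the
  polytope contains \<open>A\<close>, and lowered by \<open>a / n\<close> it is \<open>P\<close>
  itself by \<open>relaxed_0\<close>.\<close>

lemma simple_convex_bound:
  assumes A: "A \<in> sets (borel_vec p)" and approx: "simple_approx n p a d A V P" and a: "0 \<le> a"
    and K: "0 < K" "\<And>v. v \<in> V \<Longrightarrow> K \<le> bilin p \<Xi> v v"
    and D: "\<And>v w. v \<in> V \<Longrightarrow> w \<in> V \<Longrightarrow> \<bar>bilin p (mat_diff \<Xi>h \<Xi>) v w\<bar> \<le> D"
    and L: "1 \<le> L" "(real p * real n) powr d \<le> exp L"
  shows "gap A \<le>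
    (8 + 128 / sqrt K) * (a / real n * sqrt L + D powr (1/3) * L powr (2/3))" (is "_ \<le> ?bound")
proof -
  have gen: "generated_by p V P" and card: "real (card V) \<le> exp L"
    and PA: "P \<subseteq> A" and AR: "A \<subseteq> relaxed p V P (a / real n)"
    using approx L unfolding simple_approx_def by auto
  have fin: "finite V" using gen by (simp add: generated_by_def)
  have nn: "0 \<le> ?bound" using K a L by (intro mult_nonneg_nonneg add_nonneg_nonneg) auto
  show ?thesis
  \<comment> \<open>The comparison requires at least one constraint; without any, \<open>A\<close>
    is the whole space.\<close>
  proof (cases "V = {}")
    case True
    then have "P = vecs p" using gen by (auto simp: generated_by_def)
    then have "A = vecs p" using PA sets.sets_into_space[OF A] by blast
    then show ?thesis using nn prob_vecs by simp
  next
    case V: False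
    show ?thesis
    proof (cases "P = {}")
      case True
      \<comment> \<open>The support function of the empty set is \<open>- \<infinity>\<close>, and
        adding \<open>a / n\<close> leaves it so.\<close>
      have "relaxed p V P (a / real n) = {}"
        using V True by (auto simp: relaxed_def support_fun_def bot_ereal_def)
      then show ?thesis using AR nn by simp
    next
      case False
      define S where "S v = real_of_ereal (support_fun p P v)" for v
      have S: "support_fun p P v = ereal (S v)" if v: "v \<in> V" for v
      proof -
        obtain b where P: "P = {w \<in> vecs p. \<forall>v\<in>V. dot p w v \<le> b v}"
          using gen by (auto simp: generated_by_def)
        have "support_fun p P v \<le> ereal (b v)"
          unfolding support_fun_def using v P by (intro SUP_least) auto
        moreover obtain w where "w \<in> P" using False by blast
        then have "ereal (dot p w v) \<le> support_fun p P v"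
          unfolding support_fun_def by (rule SUP_upper)
        ultimately show ?thesis unfolding S_def by (cases "support_fun p P v") auto
      qed
      have "gap A \<le>
        (8 + 128 / sqrt K) * (a / real n * sqrt L + D powr (1/3) * L powr (2/3)) + 2 * 0"
      proof (rule gaussian_comparison[OF G Ghat fin V L(1) card K(1),
            where v="\<lambda>v. v" and X="vecs p" and b="\<lambda>v. S v + a / real n"])
        show "dot p w v \<le> S v + a / real n" if "w \<in> A" "v \<in> V" for w v
          using AR that S[of v] by (force simp: relaxed_def)
        show "w \<in> A" if "w \<in> vecs p" "\<And>v. v \<in> V \<Longrightarrow> dot p w v \<le> S v + a / real n - a / real n" for w
        proof -
          have "w \<in> relaxed p V P 0" using that by (auto simp: relaxed_def S)
          then show ?thesis using relaxed_0[OF gen] PA by blast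
        qed
        show "K \<le> bilin p \<Xi> v v" if "v \<in> V" for v by (rule K(2)[OF that])
        show "\<bar>bilin p (mat_diff \<Xi>h \<Xi>) v w\<bar> \<le> D" if "v \<in> V" "w \<in> V" for v w by (rule D[OF that])
      qed (use A a in auto)
      then show ?thesis by simp
    qed
  qed
qed

lemma hyper_rectangle_ln_bound:
  assumes A: "A \<in> hyper_rectangles p" and K: "0 < K" "\<And>j. j \<in> {1..p} \<Longrightarrow> K \<le> \<Xi> j j"
    and lnp: "1 \<le> ln (real p)"
  shows "gap A \<le> (8 + 128 / sqrt K) * 3 * (\<Delta> powr (1/3) * ln (real p) powr (2/3))"
proof -
  have "(1 + ln (2 * real p)) powr (2/3) \<le> 3 * ln (real p) powr (2/3)"
  proof (rule powr_le_scaled)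
    \<comment> \<open>With \<open>ln 2 \<le> 1 \<le> ln p\<close> each of the three summands is at
      most \<open>ln p\<close>, which gives the factor 3.\<close>
    have "ln (2 * real p) = ln 2 + ln (real p)" using p_ge_1 by (simp add: ln_mult)
    then show "1 + ln (2 * real p) \<le> 3 * ln (real p)" "0 \<le> 1 + ln (2 * real p)"
      using lnp ln_2_less_1 ln_gt_zero[of "2::real"] by linarith+
  qed (use lnp in auto)
  then have "(8 + 128 / sqrt K) * (\<Delta> powr (1/3) * (1 + ln (2 * real p)) powr (2/3)) \<le>
      (8 + 128 / sqrt K) * (\<Delta> powr (1/3) * (3 * ln (real p) powr (2/3)))"
    using K by (intro mult_left_mono) auto
  with hyper_rectangle_bound[OF A K] have "gap A \<le> (8 + 128 / sqrt K) * (\<Delta> powr (1/3) * (3 * ln (real p) powr (2/3)))"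
    by (rule order_trans)
  then show ?thesis by (simp only: mult_ac)
qed

text \<open>With \<open>d * ln p\<close> at least one, \<open>1 + d * ln (p * n)\<close> is at most
  \<open>(2 + 1 / \<kappa>) * (d * ln p)\<close>: the summand 1 and the logarithm of
  \<open>p\<close> account for 2, the logarithm of \<open>n\<close> for
  \<open>1 / \<kappa>\<close>.\<close>

lemma simple_convex_ln_bound:
  assumes \<kappa>: "0 < \<kappa>" and A: "A \<in> sets (borel_vec p)" and approx: "simple_approx n p a d A V P"
    and a: "0 \<le> a" and d: "0 < d" "1 \<le> d * ln (real p)"
    and K: "0 < K" "\<And>v. v \<in> V \<Longrightarrow> K \<le> bilin p \<Xi> v v"
    and D: "\<And>v w. v \<in> V \<Longrightarrow> w \<in> V \<Longrightarrow> \<bar>bilin p (mat_diff \<Xi>h \<Xi>) v w\<bar> \<le> D"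
  shows "gap A \<le> (8 + 128 / sqrt K) * (2 + 1 / \<kappa>) *
    (a / real n * (d * ln (real p)) powr (1/2) + D powr (1/3) * (d * ln (real p)) powr (2/3))"
proof -
  define c where "c = 8 + 128 / sqrt K"
  define C where "C = 2 + 1 / \<kappa>"
  define l where "l = d * ln (real p)"
  define L where "L = 1 + d * ln (real p * real n)"
  have c: "0 \<le> c" using K by (simp add: c_def)
  have C: "1 \<le> C" using \<kappa> by (simp add: C_def)
  have l: "1 \<le> l" using d by (simp add: l_def)
  have pn: "1 \<le> real p" "1 \<le> real n" using p_ge_1 n by auto
  have "1 * 1 \<le> real p * real n" using pn by (intro mult_mono) auto
  then have L1: "1 \<le> L" using d by (simp add: L_def)
  have Lexp: "(real p * real n) powr d \<le> exp L"
    using pn by (simp add: L_def powr_def)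
  have "d * ln (real n) \<le> d * (ln (real p) / \<kappa>)"
    using ln_le_ln_dim[OF \<kappa> n np] d by (intro mult_left_mono) auto
  then have "L \<le> 1 + l + l / \<kappa>"
    using pn by (simp add: L_def l_def ln_mult distrib_left)
  also have "\<dots> \<le> C * l" using l by (simp add: C_def algebra_simps)
  finally have LC: "L \<le> C * l" .
  have s1: "sqrt L \<le> C * l powr (1/2)"
    using powr_le_scaled[of L C l "1/2"] L1 LC C l by (simp add: powr_half_sqrt)
  have s2: "L powr (2/3) \<le> C * l powr (2/3)"
    using powr_le_scaled[of L C l "2/3"] L1 LC C l by simp
  have "gap A \<le> c * (a / real n * sqrt L + D powr (1/3) * L powr (2/3))"
    unfolding c_def by (rule simple_convex_bound[OF A approx a K D L1 Lexp])
  also have "\<dots> \<le> c * (a / real n * (C * l powr (1/2)) + D powr (1/3) * (C * l powr (2/3)))"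
    using s1 s2 c a by (intro mult_left_mono add_mono) auto
  finally show ?thesis
    unfolding c_def[symmetric] C_def[symmetric] l_def[symmetric] by (simp add: algebra_simps)
qed

end

section \<open>Asymptotic form for rectangles and simple convex sets\<close>

lemma hyper_rectangles_asymp:
  fixes \<kappa> K3 :: real and M :: "nat \<Rightarrow> 'w measure"
  assumes \<kappa>: "0 < \<kappa>" and K3: "0 < K3" and setting: "array_setting \<kappa> M p X Xihat G Ghat"
    and var: "\<And>n. 1 \<le> n \<Longrightarrow> K3 \<le> (MIN j\<in>{1..p n}.
            prob_space.variance (M n) (\<lambda>\<omega>. (\<Sum>t\<in>{1..n}. X n t \<omega> j) / sqrt (real n)))"
    and \<omega>: "\<forall>n\<ge>1. \<omega> n \<in> space (M n)"
  shows "asymp_le (1 + (8 + 128 / sqrt K3) * 3)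
     (\<lambda>n. rho_hat n (M n) (p n) (X n) (Ghat n) (hyper_rectangles (p n)) (\<omega> n))
     (\<lambda>n. rho n (M n) (p n) (X n) (G n) (hyper_rectangles (p n)) +
          Delta_r n (M n) (p n) (X n) (Xihat n) (\<omega> n) powr (1/3) * ln (real (p n)) powr (2/3))"
proof (rule rho_hat_asymp[OF \<kappa> setting \<omega>])
  show "\<forall>\<^sub>F n in sequentially.
      0 \<le> Delta_r n (M n) (p n) (X n) (Xihat n) (\<omega> n) powr (1/3) * ln (real (p n)) powr (2/3) \<and>
      (\<forall>A\<in>hyper_rectangles (p n). \<bar>measure (G n) A - measure (Ghat n (sample n (X n) (\<omega> n))) A\<bar> \<le>
        (8 + 128 / sqrt K3) * 3 *
          (Delta_r n (M n) (p n) (X n) (Xihat n) (\<omega> n) powr (1/3) * ln (real (p n)) powr (2/3)))"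
    using eventually_array_row[OF \<kappa> setting \<omega>, where C=1]
  proof eventually_elim
    case (elim n)
    then interpret array_row \<kappa> n "p n" "M n" "X n" "Xihat n" "G n" "Ghat n" "\<omega> n" by simp
    have "K3 \<le> \<Xi> j j" if j: "j \<in> {1..p n}" for j
    proof -
      have "K3 \<le> (MIN j\<in>{1..p n}.
            prob_space.variance (M n) (\<lambda>\<omega>. (\<Sum>t\<in>{1..n}. X n t \<omega> j) / sqrt (real n)))"
        by (rule var[OF n])
      also have "\<dots> \<le> prob_space.variance (M n) (\<lambda>\<omega>. (\<Sum>t\<in>{1..n}. X n t \<omega> j) / sqrt (real n))"
        using j by (intro Min_le) auto
      finally show ?thesis unfolding variance_coord_eq[OF j] .
    qed
    then show ?case
      using hyper_rectangle_ln_bound K3 elim by simp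
  qed
qed (use K3 in auto)

lemma simple_convex_asymp:
  fixes \<kappa> K4 a d :: real and M :: "nat \<Rightarrow> 'w measure"
  assumes \<kappa>: "0 < \<kappa>" and K4: "0 < K4" and a: "0 \<le> a" and d: "0 < d"
    and setting: "array_setting \<kappa> M p X Xihat G Ghat"
    and \<A>: "\<And>n. 1 \<le> n \<Longrightarrow> \<A> n \<subseteq> simple_convex_sets n (p n) a d"
    and approx: "\<And>n A. 1 \<le> n \<Longrightarrow> A \<in> \<A> n \<Longrightarrow> simple_approx n (p n) a d A (V n A) (P n A)"
    and var: "\<And>n A v. 1 \<le> n \<Longrightarrow> A \<in> \<A> n \<Longrightarrow> v \<in> V n A \<Longrightarrow> K4 \<le> proj_var n (M n) (X n) (p n) v"
    and \<omega>: "\<forall>n\<ge>1. \<omega> n \<in> space (M n)"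
  shows "asymp_le (1 + (8 + 128 / sqrt K4) * (2 + 1 / \<kappa>))
     (\<lambda>n. rho_hat n (M n) (p n) (X n) (Ghat n) (\<A> n) (\<omega> n))
     (\<lambda>n. rho n (M n) (p n) (X n) (G n) (\<A> n) + a / real n * (d * ln (real (p n))) powr (1/2) +
          Delta_class n (M n) (p n) (X n) (Xihat n) (\<A> n) (V n) (\<omega> n) powr (1/3) *
            (d * ln (real (p n))) powr (2/3))"
  unfolding add.assoc[of "rho _ _ _ _ _ _"]
proof (rule rho_hat_asymp[OF \<kappa> setting \<omega>])
  show "\<forall>\<^sub>F n in sequentially.
      0 \<le> a / real n * (d * ln (real (p n))) powr (1/2) +
          Delta_class n (M n) (p n) (X n) (Xihat n) (\<A> n) (V n) (\<omega> n) powr (1/3) *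
            (d * ln (real (p n))) powr (2/3) \<and>
      (\<forall>A\<in>\<A> n. \<bar>measure (G n) A - measure (Ghat n (sample n (X n) (\<omega> n))) A\<bar> \<le>
        (8 + 128 / sqrt K4) * (2 + 1 / \<kappa>) * (a / real n * (d * ln (real (p n))) powr (1/2) +
          Delta_class n (M n) (p n) (X n) (Xihat n) (\<A> n) (V n) (\<omega> n) powr (1/3) *
            (d * ln (real (p n))) powr (2/3)))"
    \<comment> \<open>The row from which on \<open>d * ln p\<close> is at least 1 depends on
      \<open>d\<close>, but the limit superior ignores it, so the constant stays free of
      \<open>d\<close>.\<close>
    using eventually_array_row[OF \<kappa> setting \<omega>, where C="1 / d"]
  proof eventually_elim
    case (elim n)
    then interpret array_row \<kappa> n "p n" "M n" "X n" "Xihat n" "G n" "Ghat n" "\<omega> n" by simp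
    have l: "1 \<le> d * ln (real (p n))" using elim d by (simp add: field_simps)
    have unit: "V n A \<subseteq> unit_sphere (p n)" if "A \<in> \<A> n" for A
      using approx[OF n that] by (simp add: simple_approx_def generated_by_def)
    have "gap A \<le> (8 + 128 / sqrt K4) * (2 + 1 / \<kappa>) * (a / real n * (d * ln (real (p n))) powr (1/2) +
          Delta_class n (M n) (p n) (X n) (Xihat n) (\<A> n) (V n) (\<omega> n) powr (1/3) *
            (d * ln (real (p n))) powr (2/3))" if A: "A \<in> \<A> n" for A
    proof (rule simple_convex_ln_bound[OF \<kappa> _ approx[OF n A] a d l K4])
      show "A \<in> sets (borel_vec (p n))" using \<A>[OF n] A by (auto simp: simple_convex_sets_def)
      show "K4 \<le> bilin (p n) \<Xi> v v" if "v \<in> V n A" for v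
        using var[OF n A that] by (simp add: proj_var_eq)
      show "\<bar>bilin (p n) (mat_diff \<Xi>h \<Xi>) v w\<bar> \<le>
          Delta_class n (M n) (p n) (X n) (Xihat n) (\<A> n) (V n) (\<omega> n)"
        if "v \<in> V n A" "w \<in> V n A" for v w
        unfolding Delta_class_def Xi_err_eq using unit A that by (rule cov_err_ge)
    qed
    then show ?case using a by simp
  qed
qed (use K4 \<kappa> in auto)

section \<open>Sparsely convex sets\<close>

text \<open>Weights are total functions vanishing off \<open>F\<close>, so they range over a product
  of compact intervals and points, compact by Tychonoff's theorem; the condition on the sum is
  closed.\<close>

lemma compact_simplex:
  fixes F :: "'a set"
  assumes "finite F"
  shows "compact {l :: 'a \<Rightarrow> real. (\<forall>f. 0 \<le> l f) \<and> (\<forall>f. f \<notin> F \<longrightarrow> l f = 0) \<and> sum l F = 1}" (is "compact ?S")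
proof -
  let ?B = "PiE UNIV (\<lambda>f. if f \<in> F then {0..1} else {0}) :: ('a \<Rightarrow> real) set"
  have "compactin (product_topology (\<lambda>_. euclidean) UNIV) ?B"
    by (subst compactin_PiE) auto
  then have "compact ?B"
    by (simp add: euclidean_product_topology)
  moreover have "closed {l :: 'a \<Rightarrow> real. sum l F = 1}"
    by (intro closed_Collect_eq continuous_on_sum continuous_on_const continuous_on_product_coordinates)
  ultimately have "compact (?B \<inter> {l. sum l F = 1})"
    by (rule compact_Int_closed)
  also have "?B \<inter> {l. sum l F = 1} = ?S"
  proof -
    have "l f \<le> 1" if "\<forall>f. 0 \<le> l f" "sum l F = 1" "f \<in> F" for l :: "'a \<Rightarrow> real" and f
      using member_le_sum[of f F l] that assms by simp
    moreover have "l \<in> ?B \<longleftrightarrow> (\<forall>f. l f \<in> (if f \<in> F then {0..1} else {0}))" for l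
      by (simp add: PiE_iff)
    moreover have "(\<forall>f. l f \<in> (if f \<in> F then {0..1} else {0})) \<longleftrightarrow>
        (\<forall>f. 0 \<le> l f) \<and> (\<forall>f. f \<notin> F \<longrightarrow> l f = 0) \<and> (\<forall>f\<in>F. l f \<le> 1)" for l :: "'a \<Rightarrow> real"
    proof -
      have "c \<in> (if f \<in> F then {0..1} else {0}) \<longleftrightarrow> 0 \<le> c \<and> (f \<notin> F \<longrightarrow> c = 0) \<and> (f \<in> F \<longrightarrow> c \<le> 1)"
        for c :: real and f
        by auto
      then show ?thesis by blast
    qed
    ultimately show ?thesis by blast
  qed
  finally show ?thesis .
qed

text \<open>The separating direction is the point of least norm in the convex hull of the \<open>x f - w\<close>.\<close>

lemma finite_hull_separation:
  fixes x :: "'a \<Rightarrow> 'b \<Rightarrow> real" and w :: "'b \<Rightarrow> real"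
  assumes F: "finite F" "F \<noteq> {}" and J: "finite J"
  obtains (hull) l where "\<And>f. 0 \<le> l f" "sum l F = 1" "\<And>j. j \<in> J \<Longrightarrow> (\<Sum>f\<in>F. l f * x f j) = w j"
  | (sep) u where "\<And>j. j \<notin> J \<Longrightarrow> u j = 0" "(\<Sum>j\<in>J. (u j)\<^sup>2) = 1"
      "\<And>f. f \<in> F \<Longrightarrow> (\<Sum>j\<in>J. u j * x f j) \<le> (\<Sum>j\<in>J. u j * w j)"
proof -
  define S where "S = {l :: 'a \<Rightarrow> real. (\<forall>f. 0 \<le> l f) \<and> (\<forall>f. f \<notin> F \<longrightarrow> l f = 0) \<and> sum l F = 1}"
  define g where "g l j = (\<Sum>f\<in>F. l f * (x f j - w j))" for l j
  define N where "N l = (\<Sum>j\<in>J. (g l j)\<^sup>2)" for l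
  have "compact S" unfolding S_def by (rule compact_simplex[OF F(1)])
  moreover have "S \<noteq> {}"
  proof -
    obtain f where "f \<in> F" using F by blast
    then have "(\<lambda>f'. if f' = f then 1 else 0) \<in> S" using F by (auto simp: S_def)
    then show ?thesis by blast
  qed
  moreover have "continuous_on S (\<lambda>l. l f)" for f
    by (rule continuous_on_subset[OF continuous_on_product_coordinates]) simp
  then have "continuous_on S N"
    unfolding N_def g_def
    by (intro continuous_on_sum continuous_on_power continuous_on_mult continuous_on_const)
  ultimately obtain l where l: "l \<in> S" "\<And>l'. l' \<in> S \<Longrightarrow> N l \<le> N l'"
    using continuous_attains_inf[of S N] by blast
  have l0: "\<And>f. 0 \<le> l f" "\<And>f. f \<notin> F \<Longrightarrow> l f = 0" "sum l F = 1" using l(1) by (auto simp: S_def)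
  have N0: "0 \<le> N l" by (simp add: N_def sum_nonneg)
  show thesis
  proof (cases "N l = 0")
    case True
    show thesis
    proof (rule hull)
      show "(\<Sum>f\<in>F. l f * x f j) = w j" if "j \<in> J" for j
      proof -
        have "g l j = 0" using True that J by (simp add: N_def sum_nonneg_eq_0_iff)
        then have "(\<Sum>f\<in>F. l f * x f j) = (\<Sum>f\<in>F. l f) * w j"
          by (simp add: g_def right_diff_distrib sum_subtractf sum_distrib_right)
        then show ?thesis using l0 by simp
      qed
    qed (use l0 in auto)
  next
    case False
    then have Npos: "0 < N l" using N0 by simp
    \<comment> \<open>The variational inequality for the point of least norm: moving from the
      minimiser towards the vertex \<open>f\<close> cannot decrease the norm.\<close>
    have min: "N l \<le> (\<Sum>j\<in>J. g l j * (x f j - w j))" if f: "f \<in> F" for f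
    proof -
      define y where "y j = x f j - w j - g l j" for j
      define a where "a = (\<Sum>j\<in>J. g l j * y j)"
      define b where "b = (\<Sum>j\<in>J. (y j)\<^sup>2)"
      have quad: "0 \<le> 2 * a + t * b" if t: "0 < t" "t \<le> 1" for t
      proof -
        define l' where "l' f' = (1 - t) * l f' + t * (if f' = f then 1 else 0)" for f'
        have l'S: "l' \<in> S"
          using l0 t f F by (auto simp: S_def l'_def sum.distrib simp flip: sum_distrib_left)
        have gl': "g l' j = g l j + t * y j" for j
        proof -
          have "g l' j = (\<Sum>f'\<in>F. (1 - t) * (l f' * (x f' j - w j)) + t * (if f' = f then x f' j - w j else 0))"
            unfolding g_def l'_def by (intro sum.cong) (auto simp: algebra_simps)
          also have "\<dots> = (1 - t) * g l j + t * (x f j - w j)"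
            using f F by (simp add: sum.distrib g_def flip: sum_distrib_left)
          finally show ?thesis by (simp add: y_def algebra_simps)
        qed
        have sq: "(c + t * d)\<^sup>2 = c\<^sup>2 + (2 * t) * (c * d) + t\<^sup>2 * d\<^sup>2" for c d
          by (simp add: power2_eq_square algebra_simps)
        from l(2)[OF l'S] have "N l \<le> (\<Sum>j\<in>J. (g l j + t * y j)\<^sup>2)"
          unfolding N_def gl' .
        also have "\<dots> = (\<Sum>j\<in>J. (g l j)\<^sup>2 + (2 * t) * (g l j * y j) + t\<^sup>2 * (y j)\<^sup>2)"
          by (intro sum.cong refl) (rule sq)
        also have "\<dots> = N l + (2 * t) * a + t\<^sup>2 * b"
          by (simp only: sum.distrib sum_distrib_left[symmetric] N_def a_def b_def)
        also have "\<dots> = N l + t * (2 * a + t * b)"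
          by (simp add: power2_eq_square distrib_left)
        finally have "0 \<le> t * (2 * a + t * b)" by simp
        then show ?thesis using t(1) zero_le_mult_iff[of t "2 * a + t * b"] by linarith
      qed
      \<comment> \<open>Letting \<open>t\<close> tend to 0 removes the quadratic term.\<close>
      have "0 \<le> 2 * a"
      proof (rule field_le_epsilon)
        fix e :: real assume e: "0 < e"
        define t where "t = min 1 (e / (b + 1))"
        have b: "0 \<le> b" by (simp add: b_def sum_nonneg)
        have t: "0 < t" "t \<le> 1" "t \<le> e / (b + 1)" using e b by (auto simp: t_def)
        have "t * b \<le> e / (b + 1) * (b + 1)" using t b e by (intro mult_mono) auto
        also have "\<dots> = e" using b by simp
        finally show "0 \<le> 2 * a + e" using quad[OF t(1,2)] by linarith
      qed
      moreover have "a = (\<Sum>j\<in>J. g l j * (x f j - w j)) - N l"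
        unfolding a_def N_def y_def by (simp add: power2_eq_square right_diff_distrib sum_subtractf)
      ultimately show ?thesis by simp
    qed
    \<comment> \<open>The unit vector pointing from the nearest point of the hull towards
      \<open>w\<close>.\<close>
    define u where "u j = (if j \<in> J then - g l j / sqrt (N l) else 0)" for j
    show thesis
    proof (rule sep)
      show "u j = 0" if "j \<notin> J" for j using that by (simp add: u_def)
      have "(\<Sum>j\<in>J. (u j)\<^sup>2) = (\<Sum>j\<in>J. (g l j)\<^sup>2 / N l)"
        using N0 by (intro sum.cong) (auto simp: u_def power_divide)
      then show "(\<Sum>j\<in>J. (u j)\<^sup>2) = 1"
        using Npos by (simp add: N_def flip: sum_divide_distrib)
      show "(\<Sum>j\<in>J. u j * x f j) \<le> (\<Sum>j\<in>J. u j * w j)" if "f \<in> F" for f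
      proof -
        have "(\<Sum>j\<in>J. u j * x f j) - (\<Sum>j\<in>J. u j * w j) = (\<Sum>j\<in>J. - (g l j * (x f j - w j)) / sqrt (N l))"
          unfolding sum_subtractf[symmetric]
          by (intro sum.cong) (auto simp: u_def algebra_simps diff_divide_distrib)
        also have "\<dots> = - (\<Sum>j\<in>J. g l j * (x f j - w j)) / sqrt (N l)"
          by (simp add: sum_negf flip: sum_divide_distrib)
        also have "\<dots> \<le> 0" using min[OF that] Npos by (intro divide_nonpos_pos) auto
        finally show ?thesis by simp
      qed
    qed
  qed
qed

lemma convex_vecs_sum:
  assumes C: "convex_vecs p C" and F: "finite F" "\<And>f. f \<in> F \<Longrightarrow> x f \<in> C"
    and l: "\<And>f. 0 \<le> l f" "sum l F = 1"
  shows "(\<lambda>j\<in>{1..p}. \<Sum>f\<in>F. l f * x f j) \<in> C"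
  using F l
proof (induction F arbitrary: l)
  case (insert f F)
  have ext: "(\<lambda>j\<in>{1..p}. x f j) = x f"
  proof -
    have "x f \<in> vecs p" using C insert.prems(1)[of f] by (auto simp: convex_vecs_def)
    then show ?thesis by (auto simp: borel_vec_def space_PiM PiE_def extensional_def)
  qed
  have sum: "l f + sum l F = 1" using insert by simp
  show ?case
  \<comment> \<open>Otherwise the remaining weights are renormalised through division by
    \<open>1 - l f\<close>.\<close>
  proof (cases "l f = 1")
    case True
    then have "\<forall>g\<in>F. l g = 0"
      using sum insert.hyps(1) insert.prems(2) by (simp add: sum_nonneg_eq_0_iff)
    then have "(\<lambda>j\<in>{1..p}. \<Sum>f\<in>insert f F. l f * x f j) = (\<lambda>j\<in>{1..p}. x f j)"
      using insert.hyps True by (intro restrict_ext) simp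
    then show ?thesis using ext insert.prems(1) by simp
  next
    case False
    have "0 \<le> sum l F" using insert.prems(2) by (simp add: sum_nonneg)
    then have lf: "0 \<le> l f" "l f < 1" using sum False insert.prems(2) by (auto simp: less_le)
    define y where "y = (\<lambda>j\<in>{1..p}. \<Sum>g\<in>F. (l g / (1 - l f)) * x g j)"
    have "y \<in> C"
      unfolding y_def using insert.prems lf sum
      by (intro insert.IH) (auto simp: sum_divide_distrib[symmetric])
    then have "(\<lambda>j\<in>{1..p}. (1 - l f) * y j + l f * x f j) \<in> C"
      using C insert.prems(1)[of f] lf unfolding convex_vecs_def by auto
    also have "(\<lambda>j\<in>{1..p}. (1 - l f) * y j + l f * x f j) = (\<lambda>j\<in>{1..p}. \<Sum>f\<in>insert f F. l f * x f j)"
      using insert.hyps lf by (intro restrict_ext) (simp add: y_def sum_distrib_left)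
    finally show ?thesis .
  qed
qed simp

section \<open>Inner polytopes from a grid of sparse directions\<close>

definition box :: "nat \<Rightarrow> real \<Rightarrow> rvec set" where
  "box p R = {w \<in> vecs p. \<forall>j\<in>{1..p}. \<bar>w j\<bar> \<le> R}"

lemma abs_dot_le:
  assumes "w \<in> box p R" "(\<Sum>j\<in>{1..p}. \<bar>v j\<bar>) \<le> t" "0 \<le> R"
  shows "\<bar>dot p w v\<bar> \<le> R * t"
proof -
  have "\<bar>dot p w v\<bar> \<le> (\<Sum>j\<in>{1..p}. R * \<bar>v j\<bar>)"
    unfolding dot_def using assms
    by (intro order_trans[OF sum_abs] sum_mono) (auto simp: box_def abs_mult intro!: mult_right_mono)
  also have "\<dots> \<le> R * t" using assms by (auto simp: sum_distrib_left[symmetric] intro!: mult_left_mono)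
  finally show ?thesis .
qed

text \<open>
  A point outside some \<open>C q\<close> is separated, in the at most \<open>s\<close> coordinates relevant to \<open>C q\<close>, from
  the finitely many points of \<open>A\<close> nearly attaining the suprema, and the direction of separation is
  then rounded to the net.
\<close>

lemma sparsely_convex_inner:
  assumes A: "A = (\<Inter>q\<in>{1..k::nat}. C q)" and ne: "A \<inter> box p R \<noteq> {}"
    and C: "\<And>q. q \<in> {1..k} \<Longrightarrow> convex_vecs p (C q) \<and> depends_on_at_most p s (C q)"
    and V: "finite V" "V \<noteq> {}"
    and net: "\<And>J u. J \<subseteq> {1..p} \<Longrightarrow> card J \<le> s \<Longrightarrow> (\<And>j. j \<notin> J \<Longrightarrow> u j = 0) \<Longrightarrow> (\<Sum>j\<in>J. (u j)\<^sup>2) = 1 \<Longrightarrow>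
        \<exists>v\<in>V. (\<Sum>j\<in>{1..p}. \<bar>u j - v j\<bar>) \<le> t"
    and R: "0 \<le> R" "2 * R * t < e"
    and w: "w \<in> box p R" "\<And>v. v \<in> V \<Longrightarrow> dot p w v \<le> Sup ((\<lambda>x. dot p x v) ` (A \<inter> box p R)) - e"
  shows "w \<in> A"
  unfolding A
proof (intro INT_I)
  fix q assume q: "q \<in> {1..k}"
  \<comment> \<open>The suprema need not be attained. The slack \<open>e - 2 * R * t\<close> is what
    remains of the margin \<open>e\<close> after two rounding errors \<open>R * t\<close>.\<close>
  have "\<exists>x\<in>A \<inter> box p R. Sup ((\<lambda>x. dot p x v) ` (A \<inter> box p R)) - (e - 2 * R * t) < dot p x v" for v
  proof -
    have "bdd_above ((\<lambda>x. dot p x v) ` (A \<inter> box p R))"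
    proof (rule bdd_aboveI2)
      show "dot p x v \<le> R * (\<Sum>j\<in>{1..p}. \<bar>v j\<bar>)" if "x \<in> A \<inter> box p R" for x
        using abs_dot_le[of x p R v "\<Sum>j\<in>{1..p}. \<bar>v j\<bar>"] that R by auto
    qed
    moreover have "Sup ((\<lambda>x. dot p x v) ` (A \<inter> box p R)) - (e - 2 * R * t) < Sup ((\<lambda>x. dot p x v) ` (A \<inter> box p R))"
      using R by simp
    ultimately show ?thesis
      using ne by (subst (asm) less_cSup_iff) auto
  qed
  then obtain x where x: "\<And>v. x v \<in> A \<inter> box p R"
    "\<And>v. Sup ((\<lambda>x. dot p x v) ` (A \<inter> box p R)) - (e - 2 * R * t) < dot p (x v) v"
    by metis
  obtain J where J: "J \<subseteq> {1..p}" "card J \<le> s"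
    "\<And>x y. x \<in> vecs p \<Longrightarrow> y \<in> vecs p \<Longrightarrow> (\<forall>j\<in>J. x j = y j) \<Longrightarrow> (x \<in> C q \<longleftrightarrow> y \<in> C q)"
    using C[OF q] unfolding depends_on_at_most_def by blast
  have finJ: "finite J" using J(1) finite_subset by blast
  have xC: "x v \<in> C q" for v using x(1)[of v] q A by auto
  show "w \<in> C q"
  proof (rule finite_hull_separation[OF V finJ, where x=x and w=w])
    fix l assume hull: "\<And>f. 0 \<le> l f" "sum l V = 1" "\<And>j. j \<in> J \<Longrightarrow> (\<Sum>f\<in>V. l f * x f j) = w j"
    \<comment> \<open>This convex combination agrees with \<open>w\<close> on \<open>J\<close>, and
      membership in \<open>C q\<close> depends on the coordinates in \<open>J\<close> alone.\<close>
    have "(\<lambda>j\<in>{1..p}. \<Sum>f\<in>V. l f * x f j) \<in> C q"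
      using C[OF q] xC by (intro convex_vecs_sum[OF _ V(1)] hull) auto
    moreover from this have "(\<lambda>j\<in>{1..p}. \<Sum>f\<in>V. l f * x f j) \<in> vecs p"
      using C[OF q] unfolding convex_vecs_def by blast
    moreover have "w \<in> vecs p" using w by (simp add: box_def)
    moreover have "\<forall>j\<in>J. (\<lambda>j\<in>{1..p}. \<Sum>f\<in>V. l f * x f j) j = w j"
    proof
      fix j assume "j \<in> J"
      then show "(\<lambda>j\<in>{1..p}. \<Sum>f\<in>V. l f * x f j) j = w j"
        using J(1) hull(3)[of j] by auto
    qed
    ultimately show "w \<in> C q" using J(3) by blast
  next
    fix u assume sep: "\<And>j. j \<notin> J \<Longrightarrow> u j = 0" "(\<Sum>j\<in>J. (u j)\<^sup>2) = 1"
      "\<And>f. f \<in> V \<Longrightarrow> (\<Sum>j\<in>J. u j * x f j) \<le> (\<Sum>j\<in>J. u j * w j)"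
    obtain v where v: "v \<in> V" "(\<Sum>j\<in>{1..p}. \<bar>u j - v j\<bar>) \<le> t"
      using net[OF J(1,2) sep(1,2)] by blast
    have dotJ: "dot p y u = (\<Sum>j\<in>J. u j * y j)" for y
      unfolding dot_def using J(1) sep(1) by (intro sum.mono_neutral_cong_right) auto
    have diff: "\<bar>dot p y u - dot p y v\<bar> \<le> R * t" if "y \<in> box p R" for y
    proof -
      have "dot p y u - dot p y v = dot p y (\<lambda>j. u j - v j)"
        by (simp add: dot_def right_diff_distrib sum_subtractf)
      then show ?thesis using abs_dot_le[OF that v(2) R(1)] by simp
    qed
    \<comment> \<open>Rounding \<open>u\<close> to \<open>v\<close> costs \<open>R * t\<close> at
      \<open>x v\<close> and again at \<open>w\<close>; the slack in the choice of
      \<open>x v\<close> absorbs exactly this, so its strict inequality is contradicted.\<close>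
    have "dot p (x v) v \<le> dot p (x v) u + R * t" using diff[of "x v"] x(1)[of v] by auto
    also have "dot p (x v) u \<le> dot p w u" unfolding dotJ by (rule sep(3)[OF v(1)])
    also have "dot p w u \<le> dot p w v + R * t" using diff[OF w(1)] by auto
    also have "dot p w v \<le> Sup ((\<lambda>x. dot p x v) ` (A \<inter> box p R)) - e" by (rule w(2)[OF v(1)])
    finally have False using x(2)[of v] by simp
    then show "w \<in> C q" ..
  qed
qed

text \<open>Entries are multiples of \<open>1 / N\<close>, left unnormalised so that the vectors can
  be counted; squared norm at least 1/2 costs only a factor 2 in the lower bound for the
  variances.\<close>

definition sparse_grid :: "nat \<Rightarrow> nat \<Rightarrow> nat \<Rightarrow> rvec set" where
  "sparse_grid p s N = {v. \<exists>J z. J \<subseteq> {1..p} \<and> card J \<le> s \<and> (\<forall>j\<in>J. \<bar>z j\<bar> \<le> int N) \<and>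
     v = (\<lambda>j. if j \<in> J then of_int (z j) / real N else 0) \<and> 1 / 2 \<le> (\<Sum>j\<in>{1..p}. (v j)\<^sup>2)}"

text \<open>A grid vector is coded by a list of exactly \<open>s\<close> pairs of a coordinate and
  an integer, read back as an association list. Smaller supports are padded by repeating one of
  their indices, so the count is a single power.\<close>

lemma sparse_grid_card:
  assumes "1 \<le> s"
  shows "finite (sparse_grid p s N)" "card (sparse_grid p s N) \<le> (p * (2 * N + 1)) ^ s"
proof -
  define X where "X = {1..p} \<times> {- int N..int N}"
  define dec :: "(nat \<times> int) list \<Rightarrow> rvec"
    where "dec xs = (\<lambda>j. case map_of xs j of None \<Rightarrow> 0 | Some z \<Rightarrow> of_int z / real N)" for xs
  have "sparse_grid p s N \<subseteq> dec ` {xs. set xs \<subseteq> X \<and> length xs = s}"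
  proof
    fix v assume "v \<in> sparse_grid p s N"
    then obtain J z where J: "J \<subseteq> {1..p}" "card J \<le> s" "\<forall>j\<in>J. \<bar>z j\<bar> \<le> int N"
      "v = (\<lambda>j. if j \<in> J then of_int (z j) / real N else 0)" and v: "1 / 2 \<le> (\<Sum>j\<in>{1..p}. (v j)\<^sup>2)"
      unfolding sparse_grid_def by blast
    \<comment> \<open>The norm condition excludes the zero vector, so an index for the padding
      exists.\<close>
    have "J \<noteq> {}" using v J(4) by (auto simp: power2_eq_square)
    then obtain j0 where j0: "j0 \<in> J" by blast
    have finJ: "finite J" using J(1) finite_subset by blast
    define js where "js = sorted_list_of_set J @ replicate (s - card J) j0"
    have js: "set js = J" "length js = s"
      using finJ j0 J(2) by (auto simp: js_def)
    have "dec (map (\<lambda>j. (j, z j)) js) = v"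
    proof
      fix j
      show "dec (map (\<lambda>j. (j, z j)) js) j = v j"
        unfolding dec_def map_of_map_restrict J(4) using js by (cases "j \<in> J") auto
    qed
    moreover have "set (map (\<lambda>j. (j, z j)) js) \<subseteq> X"
      using J(1,3) js by (force simp: X_def)
    ultimately show "v \<in> dec ` {xs. set xs \<subseteq> X \<and> length xs = s}"
      using js by (intro image_eqI[of _ _ "map (\<lambda>j. (j, z j)) js"]) auto
  qed
  moreover have fin: "finite {xs. set xs \<subseteq> X \<and> length xs = s}"
    by (intro finite_lists_length_eq) (simp add: X_def)
  ultimately show "finite (sparse_grid p s N)" using finite_surj by blast
  have "card (sparse_grid p s N) \<le> card {xs. set xs \<subseteq> X \<and> length xs = s}"
    using \<open>_ \<subseteq> dec ` _\<close> fin by (meson surj_card_le)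
  also have "\<dots> = card X ^ s"
    by (intro card_lists_length_eq) (simp add: X_def)
  also have "card X = p * (2 * N + 1)"
  proof -
    have "nat (int N - - int N + 1) = 2 * N + 1" by linarith
    then show ?thesis unfolding X_def card_cartesian_product card_atLeastAtMost_int by simp
  qed
  finally show "card (sparse_grid p s N) \<le> (p * (2 * N + 1)) ^ s" .
qed

lemma sparse_grid_support:
  assumes "v \<in> sparse_grid p s N"
  obtains J where "J \<subseteq> {1..p}" "card J \<le> s" "\<And>j. j \<notin> J \<Longrightarrow> v j = 0" "\<And>j. \<bar>v j\<bar> \<le> 1"
    "1 / 2 \<le> (\<Sum>j\<in>{1..p}. (v j)\<^sup>2)"
proof -
  obtain J z where J: "J \<subseteq> {1..p}" "card J \<le> s" "\<forall>j\<in>J. \<bar>z j\<bar> \<le> int N"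
    "v = (\<lambda>j. if j \<in> J then of_int (z j) / real N else 0)" "1 / 2 \<le> (\<Sum>j\<in>{1..p}. (v j)\<^sup>2)"
    using assms unfolding sparse_grid_def by blast
  have "\<bar>v j\<bar> \<le> 1" for j
  proof (cases "j \<in> J")
    case True
    then have "\<bar>real_of_int (z j)\<bar> \<le> real N"
      using J(3) by (metis of_int_abs of_int_le_iff of_int_of_nat_eq)
    then show ?thesis using True by (cases "N = 0") (auto simp: J(4) abs_divide divide_le_eq)
  qed (simp add: J(4))
  then show thesis using J by (intro that[of J]) auto
qed

text \<open>Rounding down to multiples of \<open>1 / N\<close> moves each of at most
  \<open>s\<close> coordinates by at most \<open>1 / N\<close>. The squared norm drops by at most
  twice the total change, so \<open>4 * s \<le> N\<close> keeps it at least 1/2.\<close>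

lemma sparse_grid_net:
  assumes J: "J \<subseteq> {1..p}" "card J \<le> s" and N: "4 * s \<le> N" "1 \<le> s"
    and u: "\<And>j. j \<notin> J \<Longrightarrow> u j = 0" "(\<Sum>j\<in>J. (u j)\<^sup>2) = 1"
  shows "\<exists>v\<in>sparse_grid p s N. (\<Sum>j\<in>{1..p}. \<bar>u j - v j\<bar>) \<le> real s / real N"
proof -
  have N0: "0 < real N" using N by simp
  have finJ: "finite J" using J(1) finite_subset by blast
  define z where "z j = \<lfloor>u j * N\<rfloor>" for j
  define v where "v j = (if j \<in> J then of_int (z j) / real N else 0)" for j
  have u1: "\<bar>u j\<bar> \<le> 1" for j
  proof (cases "j \<in> J")
    case True
    then have "(u j)\<^sup>2 \<le> 1" using member_le_sum[of j J "\<lambda>j. (u j)\<^sup>2"] finJ u(2) by simp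
    then show ?thesis by (simp add: abs_square_le_1)
  qed (simp add: u)
  have zN: "\<bar>z j\<bar> \<le> int N" for j
  proof -
    have "\<bar>u j * N\<bar> \<le> 1 * real N" unfolding abs_mult using u1[of j] by (intro mult_mono) auto
    then have "- real N \<le> u j * N" "u j * N \<le> real N" by auto
    then have "- int N \<le> z j" "z j \<le> int N" unfolding z_def by (simp_all add: le_floor_iff floor_le_iff)
    then show ?thesis by simp
  qed
  have close: "\<bar>u j - v j\<bar> \<le> (if j \<in> J then 1 / N else 0)" for j
  proof (cases "j \<in> J")
    case True
    have "\<bar>u j * N - z j\<bar> \<le> 1" unfolding z_def by linarith
    moreover have "u j - v j = (u j * N - z j) / N" using True N0 by (simp add: v_def diff_divide_distrib)
    ultimately show ?thesis using True N0 by (simp add: abs_divide divide_right_mono)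
  qed (simp add: v_def u)
  have sumJ: "(\<Sum>j\<in>{1..p}. g j) = (\<Sum>j\<in>J. g j)" if "\<And>j. j \<notin> J \<Longrightarrow> g j = 0" for g :: "nat \<Rightarrow> real"
    using J(1) that by (intro sum.mono_neutral_right) auto
  have dist: "(\<Sum>j\<in>{1..p}. \<bar>u j - v j\<bar>) \<le> real s / real N"
  proof -
    have "(\<Sum>j\<in>{1..p}. \<bar>u j - v j\<bar>) = (\<Sum>j\<in>J. \<bar>u j - v j\<bar>)"
      by (rule sumJ) (simp add: u v_def)
    also have "\<dots> \<le> (\<Sum>j\<in>J. 1 / real N)"
    proof (rule sum_mono)
      fix j assume "j \<in> J"
      then show "\<bar>u j - v j\<bar> \<le> 1 / real N" using close[of j] by simp
    qed
    also have "\<dots> \<le> real s / real N" using J(2) N0 by (simp add: divide_right_mono)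
    finally show ?thesis .
  qed
  have v1: "\<bar>v j\<bar> \<le> 1" for j
  proof (cases "j \<in> J")
    case True
    have "\<bar>real_of_int (z j)\<bar> \<le> real N"
      using zN[of j] by (metis of_int_abs of_int_le_iff of_int_of_nat_eq)
    then show ?thesis using True N0 by (simp add: v_def abs_divide)
  qed (simp add: v_def)
  have "1 / 2 \<le> (\<Sum>j\<in>{1..p}. (v j)\<^sup>2)"
  proof -
    have "(u j)\<^sup>2 - (v j)\<^sup>2 \<le> 2 * \<bar>u j - v j\<bar>" for j
    proof -
      have "(u j)\<^sup>2 - (v j)\<^sup>2 = (u j + v j) * (u j - v j)" by (simp add: power2_eq_square algebra_simps)
      also have "\<dots> \<le> \<bar>u j + v j\<bar> * \<bar>u j - v j\<bar>" by (metis abs_ge_self abs_mult)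
      also have "\<dots> \<le> 2 * \<bar>u j - v j\<bar>" using u1[of j] v1[of j] by (intro mult_right_mono) auto
      finally show ?thesis .
    qed
    then have "(\<Sum>j\<in>{1..p}. (u j)\<^sup>2 - (v j)\<^sup>2) \<le> (\<Sum>j\<in>{1..p}. 2 * \<bar>u j - v j\<bar>)"
      by (intro sum_mono)
    also have "\<dots> \<le> 2 * (real s / real N)" using dist by (simp flip: sum_distrib_left)
    also have "\<dots> \<le> 1 / 2"
    proof -
      have "4 * real s \<le> real N" using N(1) by (metis of_nat_le_iff of_nat_mult of_nat_numeral)
      then show ?thesis using N0 by (simp add: divide_le_eq)
    qed
    moreover have "(\<Sum>j\<in>{1..p}. (u j)\<^sup>2) = 1" using u by (subst sumJ) auto
    ultimately show ?thesis by (simp add: sum_subtractf)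
  qed
  then have "v \<in> sparse_grid p s N"
    unfolding sparse_grid_def using J zN
    by (intro CollectI exI[of _ J] exI[of _ z] conjI ballI) (auto simp: v_def)
  then show ?thesis using dist by blast
qed

text \<open>For \<open>y \<ge> 0\<close>, \<open>y\<^sup>2\<close> is at most
  \<open>1 + 2 * (exp (y powr \<gamma>) - 1)\<close>: beyond 1 this is the quadratic Taylor bound of
  \<open>exp\<close> with \<open>y \<le> y powr \<gamma>\<close>. An admissible scale
  \<open>l\<close> below \<open>2 * B\<close> then gives the moment bound
  \<open>3 * l\<^sup>2\<close>, at most \<open>12 * B\<^sup>2\<close>.\<close>

lemma psi_norm_second_moment:
  fixes \<xi> :: "'w \<Rightarrow> real"
  assumes M: "prob_space M" and \<xi> [measurable]: "\<xi> \<in> borel_measurable M"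
    and psi: "psi_norm \<gamma> M \<xi> \<le> ennreal B" and \<gamma>: "1 \<le> \<gamma>" and B: "0 < B"
  shows "integrable M (\<lambda>\<omega>. (\<xi> \<omega>)\<^sup>2)" "(\<integral>\<omega>. (\<xi> \<omega>)\<^sup>2 \<partial>M) \<le> 12 * B\<^sup>2"
proof -
  interpret prob_space M by fact
  \<comment> \<open>The norm is an infimum; doubling \<open>B\<close> makes the inequality strict,
    so that some admissible scale lies below.\<close>
  have "psi_norm \<gamma> M \<xi> < ennreal (2 * B)"
    using B by (intro le_less_trans[OF psi]) (simp add: ennreal_less_iff)
  then obtain l where l: "0 < l" "ennreal l < ennreal (2 * B)"
    and le: "(\<integral>\<^sup>+ \<omega>. ennreal (exp ((\<bar>\<xi> \<omega>\<bar> / l) powr \<gamma>) - 1) \<partial>M) \<le> 1"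
    unfolding psi_norm_def Inf_less_iff by blast
  have l2: "l < 2 * B" using l by (simp add: ennreal_less_iff)
  have pt: "y\<^sup>2 \<le> 1 + 2 * (exp (y powr \<gamma>) - 1)" if "0 \<le> y" for y :: real
  proof (cases "y \<le> 1")
    case True
    then have "y\<^sup>2 \<le> 1" using that by (simp add: power_le_one)
    also have "1 \<le> 1 + 2 * (exp (y powr \<gamma>) - 1)" by simp
    finally show ?thesis .
  next
    case False
    then have "y \<le> y powr \<gamma>" using powr_mono[of 1 \<gamma> y] \<gamma> by simp
    then have le: "exp y \<le> exp (y powr \<gamma>)" by simp
    have gen: "q \<le> 1 + 2 * (e - 1)" if "1 + y + q / 2 \<le> e'" "e' \<le> e" for q e' e :: real
      using that \<open>0 \<le> y\<close> by (simp add: field_simps)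
    show ?thesis by (rule gen[OF exp_lower_Taylor_quadratic[OF that] le])
  qed
  have "(\<integral>\<^sup>+ \<omega>. ennreal ((\<xi> \<omega>)\<^sup>2) \<partial>M) \<le>
      (\<integral>\<^sup>+ \<omega>. ennreal (l\<^sup>2) * (1 + 2 * ennreal (exp ((\<bar>\<xi> \<omega>\<bar> / l) powr \<gamma>) - 1)) \<partial>M)"
  proof (rule nn_integral_mono)
    fix \<omega>
    have "(\<bar>\<xi> \<omega>\<bar> / l)\<^sup>2 \<le> 1 + 2 * (exp ((\<bar>\<xi> \<omega>\<bar> / l) powr \<gamma>) - 1)"
      using l by (intro pt) auto
    then have "l\<^sup>2 * (\<bar>\<xi> \<omega>\<bar> / l)\<^sup>2 \<le> l\<^sup>2 * (1 + 2 * (exp ((\<bar>\<xi> \<omega>\<bar> / l) powr \<gamma>) - 1))"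
      by (intro mult_left_mono) auto
    moreover have "l\<^sup>2 * (\<bar>\<xi> \<omega>\<bar> / l)\<^sup>2 = (\<xi> \<omega>)\<^sup>2"
      using l by (simp add: power_divide)
    ultimately have "ennreal ((\<xi> \<omega>)\<^sup>2) \<le> ennreal (l\<^sup>2 * (1 + 2 * (exp ((\<bar>\<xi> \<omega>\<bar> / l) powr \<gamma>) - 1)))"
      by (simp add: ennreal_leI)
    also have "\<dots> = ennreal (l\<^sup>2) * (1 + 2 * ennreal (exp ((\<bar>\<xi> \<omega>\<bar> / l) powr \<gamma>) - 1))"
    proof -
      have "ennreal (1 + 2 * x) = 1 + 2 * ennreal x" if "0 \<le> x" for x
        using that by (simp add: ennreal_mult)
      moreover have "0 \<le> exp ((\<bar>\<xi> \<omega>\<bar> / l) powr \<gamma>) - 1" by simp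
      ultimately show ?thesis by (simp only: ennreal_mult'[OF zero_le_power2])
    qed
    finally show "ennreal ((\<xi> \<omega>)\<^sup>2) \<le> ennreal (l\<^sup>2) * (1 + 2 * ennreal (exp ((\<bar>\<xi> \<omega>\<bar> / l) powr \<gamma>) - 1))" .
  qed
  also have "\<dots> = ennreal (l\<^sup>2) * (1 + 2 * (\<integral>\<^sup>+ \<omega>. ennreal (exp ((\<bar>\<xi> \<omega>\<bar> / l) powr \<gamma>) - 1) \<partial>M))"
    by (simp add: nn_integral_cmult nn_integral_add emeasure_space_1)
  also have "\<dots> \<le> ennreal (l\<^sup>2) * (1 + 2 * 1)"
    using le by (intro mult_left_mono add_left_mono) auto
  also have "\<dots> = ennreal (l\<^sup>2 * 3)"
    by (simp add: ennreal_mult)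
  finally have nn: "(\<integral>\<^sup>+ \<omega>. ennreal ((\<xi> \<omega>)\<^sup>2) \<partial>M) \<le> ennreal (l\<^sup>2 * 3)" .
  show int: "integrable M (\<lambda>\<omega>. (\<xi> \<omega>)\<^sup>2)"
    using nn by (intro integrableI_bounded) (auto simp: less_top[symmetric] top_unique)
  have "ennreal (\<integral>\<omega>. (\<xi> \<omega>)\<^sup>2 \<partial>M) \<le> ennreal (l\<^sup>2 * 3)"
    using nn int by (simp add: nn_integral_eq_integral)
  then have "(\<integral>\<omega>. (\<xi> \<omega>)\<^sup>2 \<partial>M) \<le> l\<^sup>2 * 3"
    by (simp add: ennreal_le_iff)
  also have "l\<^sup>2 \<le> (2 * B)\<^sup>2" using l l2 by (intro power_mono) auto
  finally show "(\<integral>\<omega>. (\<xi> \<omega>)\<^sup>2 \<partial>M) \<le> 12 * B\<^sup>2" by (simp add: power_mult_distrib)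
qed

section \<open>Truncation to a box and the bound for sparsely convex sets\<close>

lemma sets_box: "box p R \<in> sets (borel_vec p)"
proof -
  note [measurable] = measurable_vec_coord
  show ?thesis unfolding box_def by measurable
qed

lemma gaussian_box_tail:
  assumes \<mu>: "centered_gaussian p \<Sigma> \<mu>" and \<sigma>: "0 < \<sigma>" "\<And>j. j \<in> {1..p} \<Longrightarrow> \<Sigma> j j \<le> \<sigma>\<^sup>2" and R: "0 < R"
  shows "measure \<mu> (vecs p - box p R) \<le> real p * (4 * \<sigma> / R)"
proof -
  interpret prob_space \<mu> by (rule prob_space_centered_gaussian[OF \<mu>])
  note [measurable] = measurable_vec_coord
  have s: "{w \<in> vecs p. R < \<bar>w j\<bar>} \<in> sets \<mu>" if "j \<in> {1..p}" for j
    unfolding sets_centered_gaussian(1)[OF \<mu>] using that by measurable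
  have "vecs p - box p R = (\<Union>j\<in>{1..p}. {w \<in> vecs p. R < \<bar>w j\<bar>})"
    by (auto simp: box_def not_le)
  then have "measure \<mu> (vecs p - box p R) \<le> (\<Sum>j\<in>{1..p}. measure \<mu> {w \<in> vecs p. R < \<bar>w j\<bar>})"
    using s by (auto intro!: measure_UNION_le)
  also have "\<dots> \<le> (\<Sum>j\<in>{1..p}. 4 * \<sigma> / R)"
    using \<sigma> R by (intro sum_mono gaussian_coord_tail[OF \<mu>]) auto
  finally show ?thesis by simp
qed

lemma abs_bilin_sparse_le:
  assumes v: "J \<subseteq> {1..p}" "card J \<le> s" "\<And>j. j \<notin> J \<Longrightarrow> v j = 0" "\<And>j. \<bar>v j\<bar> \<le> 1"
    and w: "J' \<subseteq> {1..p}" "card J' \<le> s" "\<And>j. j \<notin> J' \<Longrightarrow> w j = 0" "\<And>j. \<bar>w j\<bar> \<le> 1"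
    and D: "\<And>i j. i \<in> {1..p} \<Longrightarrow> j \<in> {1..p} \<Longrightarrow> \<bar>D i j\<bar> \<le> \<Delta>" "0 \<le> \<Delta>"
  shows "\<bar>bilin p D v w\<bar> \<le> (real s)\<^sup>2 * \<Delta>"
proof -
  have "bilin p D v w = (\<Sum>i\<in>J. \<Sum>j\<in>J'. v i * D i j * w j)"
  proof -
    have "bilin p D v w = (\<Sum>i\<in>J. \<Sum>j\<in>{1..p}. v i * D i j * w j)"
      unfolding bilin_def using v(1,3) by (intro sum.mono_neutral_right) auto
    also have "\<dots> = (\<Sum>i\<in>J. \<Sum>j\<in>J'. v i * D i j * w j)"
      using w(1,3) by (intro sum.cong refl sum.mono_neutral_right) auto
    finally show ?thesis .
  qed
  also have "\<bar>\<dots>\<bar> \<le> (\<Sum>i\<in>J. \<Sum>j\<in>J'. \<Delta>)"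
  proof (intro order_trans[OF sum_abs] sum_mono)
    fix i j assume ij: "i \<in> J" "j \<in> J'"
    have "\<bar>D i j\<bar> \<le> \<Delta>" using ij v(1) w(1) by (intro D(1)) auto
    then have "\<bar>v i\<bar> * \<bar>D i j\<bar> * \<bar>w j\<bar> \<le> 1 * \<Delta> * 1"
      using v(4) w(4) D(2) by (intro mult_mono) auto
    then show "\<bar>v i * D i j * w j\<bar> \<le> \<Delta>" by (simp add: abs_mult)
  qed
  also have "\<dots> = real (card J) * real (card J') * \<Delta>"
    by simp
  also have "\<dots> \<le> real s * real s * \<Delta>"
    using v(2) w(2) D(2) by (intro mult_right_mono mult_mono) auto
  finally show ?thesis by (simp add: power2_eq_square)
qed

context array_row
begin

text \<open>The vectors may depend on each other in any way, so the squared sum is bounded by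
  Cauchy-Schwarz at the cost of a factor \<open>n\<close>. This is harmless, as the bound serves
  only to choose the box.\<close>

lemma nsum_second_moment:
  assumes j: "j \<in> {1..p}"
    and sq: "\<And>t. t \<in> {1..n} \<Longrightarrow> integrable M (\<lambda>\<omega>. (X t \<omega> j)\<^sup>2)"
      "\<And>t. t \<in> {1..n} \<Longrightarrow> (\<integral>\<omega>. (X t \<omega> j)\<^sup>2 \<partial>M) \<le> b"
  shows "\<Xi> j j \<le> real n * b"
proof -
  interpret prob_space M by (rule M)
  let ?S = "\<lambda>\<omega>. nsum n X p \<omega> j"
  have int: "integrable M ?S"
    using square_integrable_imp_integrable[OF measurable_nsum_coord[OF j] S_sq[OF j]] .
  have "\<Xi> j j = variance ?S"
    by (simp add: cov_mat_def power2_eq_square)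
  also have "\<dots> \<le> expectation (\<lambda>\<omega>. (?S \<omega>)\<^sup>2)"
    using variance_eq[OF int S_sq[OF j]] by simp
  also have "\<dots> \<le> expectation (\<lambda>\<omega>. \<Sum>t\<in>{1..n}. (X t \<omega> j)\<^sup>2)"
  proof (rule integral_mono)
    fix \<omega>
    have "(?S \<omega>)\<^sup>2 = (\<Sum>t\<in>{1..n}. X t \<omega> j)\<^sup>2 / real n"
      using j by (simp add: nsum_def power_divide)
    also have "\<dots> \<le> (\<Sum>t\<in>{1..n}. (X t \<omega> j)\<^sup>2) * real (card {1..n}) / real n"
      by (intro divide_right_mono sum_squared_le_sum_of_squares) auto
    also have "\<dots> = (\<Sum>t\<in>{1..n}. (X t \<omega> j)\<^sup>2)"
      using n by simp
    finally show "(?S \<omega>)\<^sup>2 \<le> (\<Sum>t\<in>{1..n}. (X t \<omega> j)\<^sup>2)" .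
  qed (use sq S_sq[OF j] in auto)
  also have "\<dots> = (\<Sum>t\<in>{1..n}. expectation (\<lambda>\<omega>. (X t \<omega> j)\<^sup>2))"
    using sq(1) by (intro Bochner_Integration.integral_sum) auto
  also have "\<dots> \<le> (\<Sum>t\<in>{1..n}. b)"
    using sq(2) by (intro sum_mono) auto
  finally show ?thesis by simp
qed

lemma sparsely_convex_bound:
  assumes \<kappa>: "0 < \<kappa>" and lnp: "1 \<le> ln (real p)" and A: "A \<in> sparsely_convex_sets p s"
    and s: "1 \<le> s" "s \<le> n" and B: "0 \<le> B" "B \<le> real n"
    and var: "\<And>j. j \<in> {1..p} \<Longrightarrow> \<Xi> j j \<le> 12 * real n * B\<^sup>2"
    and \<Delta>1: "\<Delta> \<le> 1"
    and K: "0 < K" "\<And>v. v \<in> unit_sphere p \<Longrightarrow> nnz p v \<le> s \<Longrightarrow> K \<le> bilin p \<Xi> v v"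
    and L: "L = real s * ((8 + 5 / \<kappa>) * ln (real p))"
  shows "gap A \<le>
    (8 + 128 / sqrt (K / 2)) * (1 / real n * sqrt L +
      ((real s)\<^sup>2 * \<Delta>) powr (1/3) * L powr (2/3)) + 8 / real n" (is "_ \<le> ?bound")
proof -
  have np1: "1 \<le> real n" "1 \<le> real p" using n p_ge_1 by auto
  \<comment> \<open>Since \<open>B \<le> n\<close>, \<open>\<sigma>\<^sup>2 = 16 * n ^ 4\<close>
    dominates \<open>12 * n * B\<^sup>2\<close> with 1 to spare; the spare 1 covers the diagonal of
    the estimator, as \<Delta> is at most 1.\<close>
  define \<sigma> where "\<sigma> = 4 * real n ^ 2"
  \<comment> \<open>Makes the tail bound \<open>p * (4 * \<sigma> / R)\<close> equal to
    \<open>4 / n\<close>.\<close>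
  define R where "R = 4 * real n ^ 3 * real p"
  \<comment> \<open>Makes the two rounding errors in the box sum to
    \<open>2 * R * (s / N) = s / (2 * n\<^sup>2)\<close>, below the margin \<open>1 / n\<close>
    since \<open>s \<le> n\<close>.\<close>
  define N where "N = 16 * n ^ 5 * p"
  have pos: "0 < \<sigma>" "0 < R" using np1 by (auto simp: \<sigma>_def R_def)
  have s2: "12 * real n * B\<^sup>2 + 1 \<le> \<sigma>\<^sup>2"
  proof -
    have "B\<^sup>2 \<le> (real n)\<^sup>2" using B by (intro power_mono) auto
    then have "real n * B\<^sup>2 \<le> real n * (real n)\<^sup>2" using np1 by (intro mult_left_mono) auto
    also have "\<dots> = real n ^ 3" by (simp add: power3_eq_cube power2_eq_square)
    also have "\<dots> \<le> real n ^ 4" using np1 by (intro power_increasing) auto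
    finally have "real n * B\<^sup>2 \<le> real n ^ 4" .
    moreover have "1 \<le> real n ^ 4" using np1 by simp
    moreover have "\<sigma>\<^sup>2 = 16 * real n ^ 4" by (simp add: \<sigma>_def power_mult_distrib flip: power_mult)
    ultimately show ?thesis by simp
  qed
  have "\<Xi> j j \<le> \<sigma>\<^sup>2" "\<Xi>h j j \<le> \<sigma>\<^sup>2" if j: "j \<in> {1..p}" for j
    using var[OF j] Delta_r_ge[OF j j] \<Delta>1 s2 by (auto simp: mat_diff_def)
  then have "measure G (vecs p - box p R) \<le> real p * (4 * \<sigma> / R)"
    "measure (Ghat (sample n X \<omega>)) (vecs p - box p R) \<le> real p * (4 * \<sigma> / R)"
    using gaussian_box_tail[OF G pos(1) _ pos(2)] gaussian_box_tail[OF Ghat pos(1) _ pos(2)] by auto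
  moreover have "real p * (4 * \<sigma> / R) = 4 / real n"
    using np1 by (simp add: \<sigma>_def R_def power3_eq_cube power2_eq_square)
  ultimately have tail: "measure G (vecs p - box p R) \<le> 4 / real n"
    "measure (Ghat (sample n X \<omega>)) (vecs p - box p R) \<le> 4 / real n" by auto
  obtain k C where A_sets: "A \<in> sets (borel_vec p)" and A_eq: "A = (\<Inter>q\<in>{1..k::nat}. C q)"
    and C: "\<And>q. q \<in> {1..k} \<Longrightarrow> convex_vecs p (C q) \<and> depends_on_at_most p s (C q)"
    using A unfolding sparsely_convex_sets_def by blast
  have Asub: "A \<subseteq> vecs p" using sets.sets_into_space[OF A_sets] .
  have L1: "1 \<le> L"
  proof -
    have "1 * (1 * 1) \<le> real s * ((8 + 5 / \<kappa>) * ln (real p))"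
      using s lnp \<kappa> by (intro mult_mono) (auto intro: add_increasing2)
    then show ?thesis using L by simp
  qed
  show ?thesis
  \<comment> \<open>A set that misses the box has at most the tail mass under both laws; otherwise
    the suprema over \<open>A \<inter> box p R\<close> are meaningful.\<close>
  proof (cases "A \<inter> box p R = {}")
    case True
    have "measure \<mu> A \<le> 4 / real n" if "centered_gaussian p \<Sigma> \<mu>" "measure \<mu> (vecs p - box p R) \<le> 4 / real n" for \<Sigma> \<mu>
    proof -
      interpret prob_space \<mu> by (rule prob_space_centered_gaussian[OF that(1)])
      have "measure \<mu> A \<le> measure \<mu> (vecs p - box p R)"
        using True Asub sets_box[of p R] sets.top[of "borel_vec p"]
        by (intro finite_measure_mono) (auto simp: sets_centered_gaussian(1)[OF that(1)])
      then show ?thesis using that(2) by simp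
    qed
    from this[OF G tail(1)] this[OF Ghat tail(2)]
    have "gap A \<le> 4 / real n"
      using measure_nonneg[of G A] measure_nonneg[of "Ghat (sample n X \<omega>)" A] by linarith
    also have "\<dots> \<le> 0 + 8 / real n" by (simp add: divide_right_mono)
    also have "\<dots> \<le> ?bound"
      using K L1 by (intro add_right_mono mult_nonneg_nonneg add_nonneg_nonneg) auto
    finally show ?thesis .
  next
    case ne: False
    define V where "V = sparse_grid p s N"
    define b where "b v = Sup ((\<lambda>x. dot p x v) ` (A \<inter> box p R))" for v
    have sN: "4 * s \<le> N"
    proof -
      have "n * 1 \<le> n ^ 5 * p" using n p_ge_1 by (intro mult_mono) (auto simp: self_le_power)
      then show ?thesis using s unfolding N_def mult.assoc by linarith
    qed
    have fin: "finite V" and card: "card V \<le> (p * (2 * N + 1)) ^ s"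
      using sparse_grid_card[OF s(1)] by (auto simp: V_def)
    have Vne: "V \<noteq> {}"
      using sparse_grid_net[of "{1}" p s N "\<lambda>j. if j = 1 then 1 else 0"] p_ge_1 s sN by (auto simp: V_def)
    have supp: "\<exists>J. J \<subseteq> {1..p} \<and> card J \<le> s \<and> (\<forall>j. j \<notin> J \<longrightarrow> v j = 0) \<and> (\<forall>j. \<bar>v j\<bar> \<le> 1) \<and>
        1 / 2 \<le> (\<Sum>j\<in>{1..p}. (v j)\<^sup>2)" if v: "v \<in> V" for v
    proof (rule sparse_grid_support[of v p s N])
      show "v \<in> sparse_grid p s N" using v by (simp add: V_def)
    next
      fix J assume "J \<subseteq> {1..p}" "card J \<le> s" "\<And>j. j \<notin> J \<Longrightarrow> v j = 0" "\<And>j. \<bar>v j\<bar> \<le> 1"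
        "1 / 2 \<le> (\<Sum>j\<in>{1..p}. (v j)\<^sup>2)"
      then show ?thesis by (intro exI[of _ J] conjI allI impI)
    qed
    have cardL: "real (card V) \<le> exp L"
    proof -
      \<comment> \<open>In the exponent \<open>8 + 5 / \<kappa>\<close>, 6 comes from
        \<open>33 \<le> exp 6\<close> together with \<open>ln p \<ge> 1\<close>, 2 from
        \<open>p\<^sup>2\<close>, and \<open>5 / \<kappa>\<close> from \<open>n ^ 5\<close>.\<close>
      have "real (p * (2 * N + 1)) \<le> 33 * (real n ^ 5 * real p ^ 2)"
      proof -
        have "1 * 1 \<le> real n ^ 5 * real p" using np1 by (intro mult_mono) auto
        then have "real p * 1 \<le> real p * (real n ^ 5 * real p)" using np1 by (intro mult_left_mono) auto
        then show ?thesis by (simp add: N_def power2_eq_square algebra_simps)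
      qed
      also have "\<dots> \<le> exp 6 * (exp (5 / \<kappa> * ln (real p)) * exp (2 * ln (real p)))"
      proof (intro mult_mono)
        have "(2::real) ^ 6 \<le> exp 1 ^ 6" using exp_ge_add_one_self[of 1] by (intro power_mono) auto
        then show "33 \<le> exp (6::real)" by (simp flip: exp_of_nat_mult)
        have "real n ^ 5 = exp (5 * ln (real n))" using np1 exp_of_nat_mult[of 5 "ln (real n)"] by simp
        also have "\<dots> \<le> exp (5 / \<kappa> * ln (real p))"
          using mult_left_mono[OF ln_le_ln_dim[OF \<kappa> n np], of 5] by simp
        finally show "real n ^ 5 \<le> exp (5 / \<kappa> * ln (real p))" .
        show "real p ^ 2 \<le> exp (2 * ln (real p))" using np1 exp_of_nat_mult[of 2 "ln (real p)"] by simp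
      qed auto
      also have "\<dots> = exp (6 + 5 / \<kappa> * ln (real p) + 2 * ln (real p))" by (simp add: exp_add)
      also have "\<dots> \<le> exp ((8 + 5 / \<kappa>) * ln (real p))" using lnp by (simp add: algebra_simps)
      finally have base: "real (p * (2 * N + 1)) \<le> exp ((8 + 5 / \<kappa>) * ln (real p))" .
      have "real (card V) \<le> real ((p * (2 * N + 1)) ^ s)" using card of_nat_le_iff by blast
      also have "\<dots> = real (p * (2 * N + 1)) ^ s" by simp
      also have "\<dots> \<le> exp ((8 + 5 / \<kappa>) * ln (real p)) ^ s" using base by (intro power_mono) auto
      also have "\<dots> = exp L" by (simp only: exp_of_nat_mult[symmetric] L)
      finally show ?thesis .
    qed
    show ?thesis
    proof -
      have "gap A \<le>
        (8 + 128 / sqrt (K / 2)) * (1 / real n * sqrt L + ((real s)\<^sup>2 * \<Delta>) powr (1/3) * L powr (2/3)) + 2 * (4 / real n)"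
      proof (rule gaussian_comparison[OF G Ghat fin Vne L1 cardL, where v="\<lambda>v. v" and X="box p R" and b=b])
        \<comment> \<open>Scaled to the unit sphere the vector has variance at least
          \<open>K\<close>; the factor lost is its squared norm, at least 1/2.\<close>
        show "K / 2 \<le> bilin p \<Xi> v v" if "v \<in> V" for v
        proof -
          obtain J where J: "J \<subseteq> {1..p}" "card J \<le> s" "\<And>j. j \<notin> J \<Longrightarrow> v j = 0"
            "1 / 2 \<le> (\<Sum>j\<in>{1..p}. (v j)\<^sup>2)"
            using supp[OF \<open>v \<in> V\<close>] by auto
          define r where "r = (\<Sum>j\<in>{1..p}. (v j)\<^sup>2)"
          have r: "0 < r" "1 / 2 \<le> r" using J(4) by (auto simp: r_def)
          \<comment> \<open>Grid vectors are 0 outside \<open>{1..p}\<close>; the restriction makes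
            the normalised vector a member of \<open>vecs p\<close>.\<close>
          define u where "u = (\<lambda>j\<in>{1..p}. v j / sqrt r)"
          have "u \<in> unit_sphere p"
          proof -
            have "dot p u u = (\<Sum>j\<in>{1..p}. (v j)\<^sup>2 / r)"
              unfolding dot_def using r by (intro sum.cong) (auto simp: u_def power2_eq_square)
            also have "\<dots> = 1" using r by (simp add: r_def flip: sum_divide_distrib)
            finally show ?thesis by (simp add: unit_sphere_def u_def borel_vec_def space_PiM)
          qed
          moreover have "nnz p u \<le> s"
          proof -
            have "{j \<in> {1..p}. u j \<noteq> 0} \<subseteq> J" using J(3) by (auto simp: u_def)
            then have "nnz p u \<le> card J"
              unfolding nnz_def using J(1) finite_subset by (intro card_mono) auto
            then show ?thesis using J(2) by simp
          qed
          ultimately have Ku: "K \<le> bilin p \<Xi> u u" by (rule K(2))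
          have "bilin p \<Xi> v v = r * bilin p \<Xi> u u"
            unfolding bilin_def sum_distrib_left using r
            by (intro sum.cong refl) (simp add: u_def)
          moreover have "1 / 2 * K \<le> r * bilin p \<Xi> u u"
            using r Ku K(1) by (intro mult_mono) auto
          ultimately show ?thesis by simp
        qed
        show "\<bar>bilin p (mat_diff \<Xi>h \<Xi>) v w\<bar> \<le> (real s)\<^sup>2 * \<Delta>" if v: "v \<in> V" and w: "w \<in> V" for v w
        proof -
          obtain J where "J \<subseteq> {1..p}" "card J \<le> s" "\<And>j. j \<notin> J \<Longrightarrow> v j = 0" "\<And>j. \<bar>v j\<bar> \<le> 1"
            using supp[OF v] by auto
          moreover obtain J' where "J' \<subseteq> {1..p}" "card J' \<le> s" "\<And>j. j \<notin> J' \<Longrightarrow> w j = 0" "\<And>j. \<bar>w j\<bar> \<le> 1"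
            using supp[OF w] by auto
          ultimately show ?thesis
            using Delta_r_ge Delta_r_nonneg by (rule abs_bilin_sparse_le)
        qed
        show "dot p w v \<le> b v" if "w \<in> A" "w \<in> box p R" "v \<in> V" for w v
          unfolding b_def
        proof (rule cSup_upper)
          show "bdd_above ((\<lambda>x. dot p x v) ` (A \<inter> box p R))"
          proof (rule bdd_aboveI2)
            show "dot p x v \<le> R * (\<Sum>j\<in>{1..p}. \<bar>v j\<bar>)" if "x \<in> A \<inter> box p R" for x
              using abs_dot_le[of x p R v "\<Sum>j\<in>{1..p}. \<bar>v j\<bar>"] that pos by auto
          qed
        qed (use that in auto)
        show "w \<in> A" if w: "w \<in> box p R" "\<And>v. v \<in> V \<Longrightarrow> dot p w v \<le> b v - 1 / real n" for w
        proof (rule sparsely_convex_inner[OF A_eq ne C fin Vne, where t="real s / real N" and e="1 / real n"])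
          show "\<exists>v\<in>V. (\<Sum>j\<in>{1..p}. \<bar>u j - v j\<bar>) \<le> real s / real N"
            if "J \<subseteq> {1..p}" "card J \<le> s" "\<And>j. j \<notin> J \<Longrightarrow> u j = 0" "(\<Sum>j\<in>J. (u j)\<^sup>2) = 1" for J u
            unfolding V_def using that sN s by (intro sparse_grid_net) auto
          have "2 * R * (real s / real N) = real s / (2 * real n ^ 2)"
            using np1 by (simp add: R_def N_def field_simps power_numeral_reduce)
          also have "\<dots> \<le> real n / (2 * real n ^ 2)" using s by (intro divide_right_mono) auto
          also have "\<dots> < 1 / real n" using np1 by (simp add: power2_eq_square field_simps)
          finally show "2 * R * (real s / real N) < 1 / real n" .
        qed (use w pos in \<open>auto simp: b_def\<close>)
      qed (use A_sets sets_box tail K in auto)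
      then show "gap A \<le>
        (8 + 128 / sqrt (K / 2)) * (1 / real n * sqrt L + ((real s)\<^sup>2 * \<Delta>) powr (1/3) * L powr (2/3)) + 8 / real n"
        by simp
    qed
  qed
qed

text \<open>
  The bound exceeds one, and is trivial, unless \<open>B \<le> n\<close>, \<open>s \<le> n\<close> and \<open>\<Delta> \<le> 1\<close>; these make the box
  and the grid polynomial in \<open>n\<close> and \<open>p\<close>.
\<close>

lemma sparsely_convex_ln_bound:
  fixes B \<gamma> :: real
  assumes \<kappa>: "0 < \<kappa>" and lnp: "1 \<le> ln (real p)" and A: "A \<in> sparsely_convex_sets p s"
    and s: "1 \<le> s" and B: "1 \<le> B" and \<gamma>: "1 \<le> \<gamma>"
    and psi: "\<And>t j. t \<in> {1..n} \<Longrightarrow> j \<in> {1..p} \<Longrightarrow> psi_norm \<gamma> M (\<lambda>\<omega>. X t \<omega> j) \<le> ennreal B"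
    and K: "0 < K" "\<And>v. v \<in> unit_sphere p \<Longrightarrow> nnz p v \<le> s \<Longrightarrow> K \<le> bilin p \<Xi> v v"
  shows "gap A \<le> (8 + (8 + 128 / sqrt (K / 2)) * (8 + 5 / \<kappa>)) *
    ((real s)\<^sup>2 * \<Delta> powr (1/3) * ln (real p) powr (2/3) + (B + real s * ln (real p) powr (1/2)) / real n)"
proof -
  define c where "c = 8 + 128 / sqrt (K / 2)"
  define C where "C = 8 + 5 / \<kappa>"
  define l where "l = ln (real p)"
  define Q1 where "Q1 = (real s)\<^sup>2 * \<Delta> powr (1/3) * l powr (2/3)"
  define Q2 where "Q2 = (B + real s * l powr (1/2)) / real n"
  have c: "0 \<le> c" using K(1) by (simp add: c_def)
  have C: "1 \<le> C" using \<kappa> by (simp add: C_def add_increasing2)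
  have l: "1 \<le> l" using lnp by (simp add: l_def)
  have l1: "1 \<le> l powr (1/2)" "1 \<le> l powr (2/3)" using l by (auto intro: ge_one_powr_ge_zero)
  have s1: "1 \<le> real s" using s by simp
  have n0: "1 \<le> real n" using n by simp
  note \<Delta>0 = Delta_r_nonneg
  have Q: "0 \<le> Q1" "0 \<le> Q2" using l B by (auto simp: Q1_def Q2_def intro!: divide_nonneg_nonneg add_nonneg_nonneg)
  have "gap A \<le> (8 + c * C) * (Q1 + Q2)"
  proof (cases "Q1 + Q2 < 1")
    case False
    have "gap A \<le> 1"
      using prob_space.prob_le_1[OF prob_spaces(2), of A] prob_space.prob_le_1[OF prob_spaces(3), of A]
        measure_nonneg[of G A] measure_nonneg[of "Ghat (sample n X \<omega>)" A] by linarith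
    also have "1 \<le> (8 + c * C) * (Q1 + Q2)"
      using mult_mono[of 1 "8 + c * C" 1 "Q1 + Q2"] False c C by simp
    finally show ?thesis .
  next
    case True
    then have Q1: "Q1 < 1" and Q2: "Q2 < 1" using Q by auto
    have Bs: "B + real s * l powr (1/2) < real n" using Q2 n0 by (simp add: Q2_def)
    have ss: "real s * 1 \<le> real s * l powr (1/2)" using l1 s1 by (intro mult_left_mono) auto
    have Bn: "B \<le> real n" and sn: "s \<le> n" using Bs ss B s1 by linarith+
    have \<Delta>1: "\<Delta> \<le> 1"
    proof (rule ccontr)
      assume "\<not> \<Delta> \<le> 1"
      then have "1 \<le> \<Delta> powr (1/3)" by (intro ge_one_powr_ge_zero) auto
      then have "1 * 1 * 1 \<le> Q1"
        unfolding Q1_def using s1 l1 by (intro mult_mono) auto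
      then show False using Q1 by simp
    qed
    define L where "L = real s * (C * l)"
    have v: "\<Xi> j j \<le> 12 * real n * B\<^sup>2" if j: "j \<in> {1..p}" for j
    proof -
      have "integrable M (\<lambda>\<omega>. (X t \<omega> j)\<^sup>2)" "(\<integral>\<omega>. (X t \<omega> j)\<^sup>2 \<partial>M) \<le> 12 * B\<^sup>2"
        if t: "t \<in> {1..n}" for t
        using psi_norm_second_moment[OF M _ psi[OF t j] \<gamma>] X_int[OF t j] B by auto
      from nsum_second_moment[OF j this] show ?thesis by simp
    qed
    have "gap A \<le>
        c * (1 / real n * sqrt L + ((real s)\<^sup>2 * \<Delta>) powr (1/3) * L powr (2/3)) + 8 / real n"
      unfolding c_def
    proof (rule sparsely_convex_bound[OF \<kappa> lnp A s sn _ Bn v \<Delta>1 K])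
      show "0 \<le> B" using B by simp
    qed (simp_all add: L_def C_def l_def)
    also have "\<dots> \<le> c * (1 / real n * (C * (real s * l powr (1/2))) + C * Q1) + 8 * Q2"
    proof (intro add_mono mult_left_mono)
      show "sqrt L \<le> C * (real s * l powr (1/2))"
      proof -
        have "L powr (1/2) \<le> C * (real s * l) powr (1/2)"
          using C l s1 by (intro powr_le_scaled) (auto simp: L_def)
        also have "(real s * l) powr (1/2) \<le> real s * l powr (1/2)"
          using s1 l by (intro powr_le_scaled) auto
        finally show ?thesis using C l s1 by (simp add: powr_half_sqrt L_def)
      qed
      show "((real s)\<^sup>2 * \<Delta>) powr (1/3) * L powr (2/3) \<le> C * Q1"
      proof -
        have e1: "((real s)\<^sup>2 * \<Delta>) powr (1/3) = real s powr (2/3) * \<Delta> powr (1/3)"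
        proof -
          have "(real s)\<^sup>2 = real s powr 2" using s1 by simp
          then have "(real s)\<^sup>2 powr (1/3) = (real s powr 2) powr (1/3)" by (simp only:)
          also have "\<dots> = real s powr (2/3)" by (simp only: powr_powr) simp
          finally show ?thesis using \<Delta>0 by (simp only: powr_mult zero_le_power2)
        qed
        have e2: "L powr (2/3) \<le> C * (real s powr (2/3) * l powr (2/3))"
        proof -
          have "L powr (2/3) \<le> C * (real s * l) powr (2/3)"
            using C l s1 by (intro powr_le_scaled) (auto simp: L_def)
          then show ?thesis using s1 l by (simp add: powr_mult)
        qed
        \<comment> \<open>One factor comes from the covariance error
          \<open>s\<^sup>2 * \<Delta>\<close>, the other from \<open>L\<close>; their product
          \<open>s powr (4/3)\<close> is rounded up to the \<open>s\<^sup>2\<close> of the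
          claim.\<close>
        have e3: "real s powr (2/3) * real s powr (2/3) \<le> (real s)\<^sup>2"
        proof -
          have "real s powr (2/3) * real s powr (2/3) = real s powr (4/3)"
            by (simp flip: powr_add)
          also have "\<dots> \<le> real s powr 2" using s1 by (intro powr_mono) auto
          finally show ?thesis using s1 by simp
        qed
        have "((real s)\<^sup>2 * \<Delta>) powr (1/3) * L powr (2/3) \<le>
           (real s powr (2/3) * \<Delta> powr (1/3)) * (C * (real s powr (2/3) * l powr (2/3)))"
          unfolding e1 using e2 by (intro mult_left_mono) auto
        also have "\<dots> = C * ((real s powr (2/3) * real s powr (2/3)) * (\<Delta> powr (1/3) * l powr (2/3)))"
          by (simp add: mult_ac)
        also have "\<dots> \<le> C * ((real s)\<^sup>2 * (\<Delta> powr (1/3) * l powr (2/3)))"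
          using C e3 by (intro mult_left_mono mult_right_mono) auto
        finally show ?thesis by (simp add: Q1_def mult.assoc)
      qed
      \<comment> \<open>The mass outside the box, \<open>8 / n\<close>, is charged to the term
        \<open>B / n\<close>.\<close>
      have "1 \<le> B + real s * l powr (1/2)" using B s1 l1 by (simp add: add_increasing2)
      then have "8 * (1 / real n) \<le> 8 * Q2" unfolding Q2_def by (intro mult_left_mono divide_right_mono) auto
      then show "8 / real n \<le> 8 * Q2" by simp
    qed (use c in auto)
    also have "\<dots> \<le> c * (C * Q2 + C * Q1) + 8 * Q2"
    proof -
      have "real s * l powr (1/2) / real n \<le> Q2"
        unfolding Q2_def using B by (intro divide_right_mono) auto
      then have "C * (real s * l powr (1/2) / real n) \<le> C * Q2" using C by (intro mult_left_mono) auto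
      then have "1 / real n * (C * (real s * l powr (1/2))) \<le> C * Q2" by simp
      then show ?thesis using c by (intro add_right_mono mult_left_mono) auto
    qed
    also have "\<dots> \<le> (8 + c * C) * (Q1 + Q2)"
      using Q by (simp add: algebra_simps)
    finally show ?thesis .
  qed
  then show ?thesis
    unfolding c_def C_def Q1_def Q2_def l_def .
qed

end

lemma sparsely_convex_asymp:
  fixes \<kappa> \<gamma> K5 :: real and M :: "nat \<Rightarrow> 'w measure" and s :: "nat \<Rightarrow> nat" and B :: "nat \<Rightarrow> real"
  assumes \<kappa>: "0 < \<kappa>" and \<gamma>: "1 \<le> \<gamma>" and K5: "0 < K5"
    and setting: "array_setting \<kappa> M p X Xihat G Ghat"
    and s: "\<And>n. 1 \<le> n \<Longrightarrow> 1 \<le> s n" and B: "\<And>n. 1 \<le> n \<Longrightarrow> 1 \<le> B n"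
    and psi: "\<And>n t j. 1 \<le> n \<Longrightarrow> t \<in> {1..n} \<Longrightarrow> j \<in> {1..p n} \<Longrightarrow>
       psi_norm \<gamma> (M n) (\<lambda>\<omega>. X n t \<omega> j) \<le> ennreal (B n)"
    and var: "\<And>n v. 1 \<le> n \<Longrightarrow> v \<in> unit_sphere (p n) \<Longrightarrow> nnz (p n) v \<le> s n \<Longrightarrow>
       K5 \<le> proj_var n (M n) (X n) (p n) v"
    and \<omega>: "\<forall>n\<ge>1. \<omega> n \<in> space (M n)"
  shows "asymp_le (9 + (8 + 128 / sqrt (K5 / 2)) * (8 + 5 / \<kappa>))
     (\<lambda>n. rho_hat n (M n) (p n) (X n) (Ghat n) (sparsely_convex_sets (p n) (s n)) (\<omega> n))
     (\<lambda>n. rho n (M n) (p n) (X n) (G n) (sparsely_convex_sets (p n) (s n)) +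
          (real (s n))\<^sup>2 * Delta_r n (M n) (p n) (X n) (Xihat n) (\<omega> n) powr (1/3) *
            ln (real (p n)) powr (2/3) +
          (B n + real (s n) * ln (real (p n)) powr (1/2)) / real n)"
proof -
  \<comment> \<open>Of the constant 9, 1 comes from the triangle inequality and 8 from the mass
    outside the box.\<close>
  have "asymp_le (1 + (8 + (8 + 128 / sqrt (K5 / 2)) * (8 + 5 / \<kappa>)))
     (\<lambda>n. rho_hat n (M n) (p n) (X n) (Ghat n) (sparsely_convex_sets (p n) (s n)) (\<omega> n))
     (\<lambda>n. rho n (M n) (p n) (X n) (G n) (sparsely_convex_sets (p n) (s n)) +
          ((real (s n))\<^sup>2 * Delta_r n (M n) (p n) (X n) (Xihat n) (\<omega> n) powr (1/3) *
            ln (real (p n)) powr (2/3) +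
          (B n + real (s n) * ln (real (p n)) powr (1/2)) / real n))" (is "asymp_le (1 + ?C) _ (\<lambda>n. _ n + ?Q n)")
  proof (rule rho_hat_asymp[OF \<kappa> setting \<omega>])
    show "\<forall>\<^sub>F n in sequentially. 0 \<le> ?Q n \<and> (\<forall>A\<in>sparsely_convex_sets (p n) (s n).
        \<bar>measure (G n) A - measure (Ghat n (sample n (X n) (\<omega> n))) A\<bar> \<le> ?C * ?Q n)"
      using eventually_array_row[OF \<kappa> setting \<omega>, where C=1]
    proof eventually_elim
      case (elim n)
      then interpret array_row \<kappa> n "p n" "M n" "X n" "Xihat n" "G n" "Ghat n" "\<omega> n" by simp
      have "gap A \<le> ?C * ?Q n" if "A \<in> sparsely_convex_sets (p n) (s n)" for A
        using sparsely_convex_ln_bound[OF \<kappa> _ that s[OF n] B[OF n] \<gamma> psi[OF n] K5] var[OF n] elim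
        by (simp add: proj_var_eq)
      moreover have "0 \<le> ?Q n"
        using B[OF n] by (intro add_nonneg_nonneg divide_nonneg_nonneg mult_nonneg_nonneg) auto
      ultimately show ?case by blast
    qed
  qed (use K5 \<kappa> in auto)
  then show ?thesis by (simp add: add.assoc)
qed

theorem theorem10:
  fixes \<kappa> :: real
  assumes "\<kappa> > 0"
  shows
    "(\<forall>K3>0. \<exists>c>0.
       \<forall>(M :: nat \<Rightarrow> 'w measure) p X Xihat G Ghat.
         array_setting \<kappa> M p X Xihat G Ghat \<and>
         (\<forall>n\<ge>1. K3 \<le> (MIN j\<in>{1..p n}.
            prob_space.variance (M n) (\<lambda>\<omega>. (\<Sum>t\<in>{1..n}. X n t \<omega> j) / sqrt (real n))))
         \<longrightarrow> (\<forall>\<omega>. (\<forall>n\<ge>1. \<omega> n \<in> space (M n)) \<longrightarrow>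
               asymp_le c
                 (\<lambda>n. rho_hat n (M n) (p n) (X n) (Ghat n) (hyper_rectangles (p n)) (\<omega> n))
                 (\<lambda>n. rho n (M n) (p n) (X n) (G n) (hyper_rectangles (p n)) +
                      Delta_r n (M n) (p n) (X n) (Xihat n) (\<omega> n) powr (1/3) *
                        ln (real (p n)) powr (2/3))))
     \<and>
     (\<forall>K4>0. \<exists>c>0. \<forall>a\<ge>0. \<forall>d>0.
       \<forall>(M :: nat \<Rightarrow> 'w measure) p X Xihat G Ghat
         (\<A> :: nat \<Rightarrow> rvec set set) (P :: nat \<Rightarrow> rvec set \<Rightarrow> rvec set)
         (V :: nat \<Rightarrow> rvec set \<Rightarrow> rvec set).
         array_setting \<kappa> M p X Xihat G Ghat \<and>
         (\<forall>n\<ge>1. \<A> n \<subseteq> simple_convex_sets n (p n) a d) \<and>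
         (\<forall>n\<ge>1. \<forall>A\<in>\<A> n. simple_approx n (p n) a d A (V n A) (P n A)) \<and>
         (\<forall>n\<ge>1. \<forall>A\<in>\<A> n. \<forall>v\<in>V n A. K4 \<le> proj_var n (M n) (X n) (p n) v)
         \<longrightarrow> (\<forall>\<omega>. (\<forall>n\<ge>1. \<omega> n \<in> space (M n)) \<longrightarrow>
               asymp_le c
                 (\<lambda>n. rho_hat n (M n) (p n) (X n) (Ghat n) (\<A> n) (\<omega> n))
                 (\<lambda>n. rho n (M n) (p n) (X n) (G n) (\<A> n) +
                      a / real n * (d * ln (real (p n))) powr (1/2) +
                      Delta_class n (M n) (p n) (X n) (Xihat n) (\<A> n) (V n) (\<omega> n) powr (1/3) *
                        (d * ln (real (p n))) powr (2/3))))
     \<and>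
     (\<forall>\<gamma>1\<ge>1. \<forall>K5>0. \<exists>c>0.
       \<forall>(M :: nat \<Rightarrow> 'w measure) p X Xihat G Ghat (s :: nat \<Rightarrow> nat) (B :: nat \<Rightarrow> real).
         array_setting \<kappa> M p X Xihat G Ghat \<and>
         (\<forall>n\<ge>1. 1 \<le> s n) \<and>
         (\<forall>n\<ge>1. 1 \<le> B n) \<and>
         (\<forall>n\<ge>1. \<forall>t\<in>{1..n}. \<forall>j\<in>{1..p n}.
            psi_norm \<gamma>1 (M n) (\<lambda>\<omega>. X n t \<omega> j) \<le> ennreal (B n)) \<and>
         (\<forall>n\<ge>1. \<forall>v\<in>unit_sphere (p n). nnz (p n) v \<le> s n \<longrightarrow>
            K5 \<le> proj_var n (M n) (X n) (p n) v)
         \<longrightarrow> (\<forall>\<omega>. (\<forall>n\<ge>1. \<omega> n \<in> space (M n)) \<longrightarrow>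
               asymp_le c
                 (\<lambda>n. rho_hat n (M n) (p n) (X n) (Ghat n)
                        (sparsely_convex_sets (p n) (s n)) (\<omega> n))
                 (\<lambda>n. rho n (M n) (p n) (X n) (G n) (sparsely_convex_sets (p n) (s n)) +
                      (real (s n))\<^sup>2 *
                        Delta_r n (M n) (p n) (X n) (Xihat n) (\<omega> n) powr (1/3) *
                        ln (real (p n)) powr (2/3) +
                      (B n + real (s n) * ln (real (p n)) powr (1/2)) / real n)))"
proof (intro conjI allI impI, goal_cases)
  case (1 K3)
  then show ?case
    by (intro exI[of _ "1 + (8 + 128 / sqrt K3) * 3"] conjI allI impI hyper_rectangles_asymp[OF assms])
       (auto simp: add_pos_nonneg)
next
  case (2 K4)
  then have "0 < 1 + (8 + 128 / sqrt K4) * (2 + 1 / \<kappa>)"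
    using assms by (intro add_pos_nonneg mult_nonneg_nonneg) auto
  with 2 show ?case
    by (intro exI[of _ "1 + (8 + 128 / sqrt K4) * (2 + 1 / \<kappa>)"] conjI allI impI
        simple_convex_asymp[OF assms]) auto
next
  case (3 \<gamma>1 K5)
  then have "0 < 9 + (8 + 128 / sqrt (K5 / 2)) * (8 + 5 / \<kappa>)"
    using assms by (intro add_pos_nonneg mult_nonneg_nonneg) auto
  with 3 show ?case
    by (intro exI[of _ "9 + (8 + 128 / sqrt (K5 / 2)) * (8 + 5 / \<kappa>)"] conjI allI impI
        sparsely_convex_asymp[OF assms, where \<gamma>=\<gamma>1]) auto
qed

end
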